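(* Let the depth $L$ be given, let $(N^*,s^* )=\arg\min_{N,s}\{r_n(L,N,s)+\xi_n(L,N,s)\}$, and suppose that (1) $1\prec\max\{Ls^*\log(pN^* ),\,s^*\log(nL/s^* )\}=o(n^{\alpha})$ for some $\alpha<1$; (2) $r_n^*\asymp\xi_n^*$; (3) $s^*\ge 12pN^*+L$, where $r_n^*=r_n(L,N^*,s^* )$ and $\xi_n^*=\xi_n(L,N^*,s^* )$. Let $\widehat q$ be the adaptive variational posterior. Then, with dominating probability, for some constant $C''>0$, $$\int d^2(P_\theta,P_0)\,\widehat q(\theta)\,d\theta\le C''\left[\varepsilon_n^{*2}+r_n^*+\xi_n^*\right],$$ where $$\varepsilon_n^*=M'\sqrt{\frac{Ls^*\log N^*+s^*\log(Ln/s^* )}{n}}\,\log^{\delta}(n)$$ for some constant $M'$ and $\delta\ge1$.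
   Context: Model. The observations $D_i=(X_i,Y_i)$, $i=1,\dots,n$, are i.i.d. with $X_i\sim\mathcal U([-1,1]^p)$ and $Y_i=f_0(X_i)+\epsilon_i$, where $\epsilon_i\sim N(0,\sigma_\epsilon^2)$ are i.i.d., $\sigma_\epsilon>0$ is a known constant and $f_0:[-1,1]^p\to\mathbb R$ is the unknown true function. Write $\boldsymbol D^{(n)}=(D_1,\dots,D_n)$. $P_0$ is the true distribution, with density $p_0(D_i)=\phi([Y_i-f_0(X_i)]/\sigma_\epsilon)/\sigma_\epsilon$ ($\phi$ the standard normal pdf); $P_\theta,p_\theta$ are the same with $f_0$ replaced by $f_\theta$. Densities of $\boldsymbol D^{(n)}$ are products. Networks. An $(L-1)$-hidden-layer ReLU network with hidden widths $\boldsymbol p=(p_1,\dots,p_{L-1})$, input dimension $p$ and scalar output is $f_\theta(X)=W_L\sigma_{b_{L-1}}(W_{L-1}\cdots\sigma_{b_1}(W_1X))+b_L$, where $W_i$ are weight matrices, $b_i$ bias vectors, $\sigma(x)=\max(0,x)$ and $\sigma_b(y)_i=\sigma(y_i-b_i)$. The vector $\theta=(\theta_1,\dots,\theta_H)$ collects all entries of the $W_i$ and $b_i$. $\Theta(L,\boldsymbol p,s)=\{\theta:\|\theta\|_0\le s\}$, $\mathcal F(L,\boldsymbol p,s)=\{f_\theta:\theta\in\Theta(L,\boldsymbol p,s)\}$, $\Theta_B(L,\boldsymbol p,s)=\{\theta\in\Theta(L,\boldsymbol p,s):\|\theta\|_\infty\le B\}$. For width parameter $N$, $\boldsymbol p_N^L=(12pN,\dots,12pN)$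 and $H_N$ is the total number of possible edges ($\theta$-coordinates) of the network of that width. $L$ and $N^*,s^*$ may depend on $n$. Error terms. $r_n(L,N,s)=\frac{Ls}{n}\log(12BpN)+\frac sn\log(nL/s)$ and $\xi_n(L,N,s)=\inf_{\theta\in\Theta_B(L,\boldsymbol p_N^L,s)}\|f_\theta-f_0\|_\infty^2$, where the constant $B$ equals $B_0$ under the uniform slab prior and $B\ge2$ under the normal slab prior. Adaptive prior. $\pi(N)=\frac{\lambda^N}{(e^\lambda-1)N!}$ for $N\ge1$ and $\pi(s)\propto e^{-\lambda_s s}$ for $s\ge0$, the overall prior support being $\bigcup_{N\ge1}\bigcup_{s=0}^{H_N}\mathcal F(L,\boldsymbol p_N^L,s)$, where $\lambda>0$ and $\lambda_s$ satisfies $n\varepsilon_n^{*2}/s^*\succ\lambda_s\ge aL\log n$ for some $a>0$. Given $(N,s)$: $\gamma\in\{0,1\}^{H_N}$ has $\pi(\gamma)\propto1\{\sum_i\gamma_i=s\}$ and, given $\gamma$, independently $\theta_i\sim\gamma_i\mathcal M_0+(1-\gamma_i)\delta_0$, where $\mathcal M_0$ is either $\mathcal U([-B_0,B_0])$ (uniform prior, fixed $B_0>1$) or $N(0,\sigma_0^2)$ (normal prior, fixed $\sigma_0^2>0$). Adaptive variational posterior. $\mathcal Q_{N,s}$ is the family of distributions $q(\theta,N,s)$ with $q(N)=\delta_{\bar N}$, $q(s)=\delta_{\bar s}$ for some $\bar N\in\mathbb Z^+$, $\bar s\in\mathbb Z^{\ge0}$, and, independently over coordinates, $\gamma_i\sim\mathrm{Bern}(\nu_i)$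 and $\theta_i|\gamma_i\sim\gamma_i\mathcal M_i+(1-\gamma_i)\delta_0$, with $\mathcal M_i=\mathcal U(l_i,u_i)$, $-B_0\le l_i\le u_i\le B_0$ (uniform prior), or $\mathcal M_i=N(\mu_i,\sigma_i^2)$ (normal prior). The adaptive variational posterior is $\widehat q(\theta,N,s)=\arg\min_{q\in\mathcal Q_{N,s}}\mathrm{KL}(q(\theta,N,s)\|\pi(\theta,N,s|\boldsymbol D^{(n)}))$, and $\widehat q(\theta)$ denotes its $\theta$-marginal. Hellinger distance: $d^2(P_\theta,P_0)=\mathbb E_X\left(1-\exp\{-[f_\theta(X)-f_0(X)]^2/(8\sigma_\epsilon^2)\}\right)$. $a_n\prec b_n$ (or $b_n\succ a_n$) means $a_n=o(b_n)$; $a_n\asymp b_n$ means same order. "With dominating probability" means with $P_0$-probability tending to one as $n\to\infty$. *)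

theory Defs
  imports "HOL-Probability.Probability" "HOL-Library.Landau_Symbols"
begin

section \<open>Regression model\<close>

text \<open>A point of \<open>\<real>\<^sup>p\<close> is an extensional function on \<open>{..<p}\<close>.
  An observation is a pair \<open>(x, y)\<close>.\<close>

type_synonym obs = "(nat \<Rightarrow> real) \<times> real"

definition cube :: "nat \<Rightarrow> (nat \<Rightarrow> real) set" where
  "cube p = ({..<p} \<rightarrow>\<^sub>E {-1..1})"

definition unif_cube :: "nat \<Rightarrow> (nat \<Rightarrow> real) measure" where
  "unif_cube p = uniform_measure (\<Pi>\<^sub>M i\<in>{..<p}. lborel) (cube p)"

definition normal_measure :: "real \<Rightarrow> real \<Rightarrow> real measure" where
  "normal_measure \<mu> \<sigma> = density lborel (\<lambda>x. ennreal (normal_density \<mu> \<sigma> x))"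

definition obs_measure :: "nat \<Rightarrow> real \<Rightarrow> ((nat \<Rightarrow> real) \<Rightarrow> real) \<Rightarrow> obs measure" where
  "obs_measure p \<sigma> f =
     distr (unif_cube p \<Otimes>\<^sub>M normal_measure 0 \<sigma>)
       ((\<Pi>\<^sub>M i\<in>{..<p}. borel) \<Otimes>\<^sub>M borel) (\<lambda>(x, e). (x, f x + e))"

definition data_measure ::
  "nat \<Rightarrow> real \<Rightarrow> ((nat \<Rightarrow> real) \<Rightarrow> real) \<Rightarrow> nat \<Rightarrow> (nat \<Rightarrow> obs) measure" where
  "data_measure p \<sigma> f n = (\<Pi>\<^sub>M i\<in>{..<n}. obs_measure p \<sigma> f)"

text \<open>The density of an observation, with respect to \<open>unif_cube p \<Otimes>\<^sub>M lborel\<close>.\<close>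

definition obs_density :: "real \<Rightarrow> ((nat \<Rightarrow> real) \<Rightarrow> real) \<Rightarrow> obs \<Rightarrow> real" where
  "obs_density \<sigma> f d = std_normal_density ((snd d - f (fst d)) / \<sigma>) / \<sigma>"

definition likelihood ::
  "real \<Rightarrow> ((nat \<Rightarrow> real) \<Rightarrow> real) \<Rightarrow> nat \<Rightarrow> (nat \<Rightarrow> obs) \<Rightarrow> real" where
  "likelihood \<sigma> f n D = (\<Prod>i<n. obs_density \<sigma> f (D i))"

definition hellinger_sq ::
  "nat \<Rightarrow> real \<Rightarrow> ((nat \<Rightarrow> real) \<Rightarrow> real) \<Rightarrow> ((nat \<Rightarrow> real) \<Rightarrow> real) \<Rightarrow> real" where
  "hellinger_sq p \<sigma> f g = (\<integral>x. (1 - exp (- ((f x - g x)\<^sup>2 / (8 * \<sigma>\<^sup>2)))) \<partial>unif_cube p)"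

text \<open>Extended-real valued, so that it is infinite (and not an arbitrary real) when \<open>f - g\<close> is
  unbounded on the cube.\<close>

definition sup_dist ::
  "nat \<Rightarrow> ((nat \<Rightarrow> real) \<Rightarrow> real) \<Rightarrow> ((nat \<Rightarrow> real) \<Rightarrow> real) \<Rightarrow> ereal" where
  "sup_dist p f g = (SUP x\<in>cube p. ereal \<bar>f x - g x\<bar>)"


section \<open>ReLU networks\<close>

text \<open>\<open>Weight l i j\<close> is the \<open>(i, j)\<close> entry of \<open>W\<^sub>l\<close> and \<open>Bias l i\<close> the
  \<open>i\<close>-th entry of \<open>b\<^sub>l\<close>, with layers \<open>l\<close> counted from 1 and units from 0.  The architecture is
  given by the number \<open>w l\<close> of units of layer \<open>l\<close>: \<open>w 0\<close> is the input dimension,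
  \<open>w 1, \<dots>, w (L - 1)\<close> are the hidden widths and \<open>w L\<close> is the output dimension.\<close>

datatype coord = Weight nat nat nat | Bias nat nat

type_synonym param = "coord \<Rightarrow> real"

definition coords :: "nat \<Rightarrow> (nat \<Rightarrow> nat) \<Rightarrow> coord set" where
  "coords L w =
     {Weight l i j | l i j. 1 \<le> l \<and> l \<le> L \<and> i < w l \<and> j < w (l - 1)} \<union>
     {Bias l i | l i. 1 \<le> l \<and> l \<le> L \<and> i < w l}"

primrec hidden :: "(nat \<Rightarrow> nat) \<Rightarrow> param \<Rightarrow> (nat \<Rightarrow> real) \<Rightarrow> nat \<Rightarrow> nat \<Rightarrow> real" where
  "hidden w \<theta> x 0 = x"
| "hidden w \<theta> x (Suc l) =
     (\<lambda>i. max 0 ((\<Sum>j<w l. \<theta> (Weight (Suc l) i j) * hidden w \<theta> x l j) - \<theta> (Bias (Suc l) i)))"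

definition network :: "nat \<Rightarrow> (nat \<Rightarrow> nat) \<Rightarrow> param \<Rightarrow> (nat \<Rightarrow> real) \<Rightarrow> real" where
  "network L w \<theta> x =
     (\<Sum>j<w (L - 1). \<theta> (Weight L 0 j) * hidden w \<theta> x (L - 1) j) + \<theta> (Bias L 0)"

text \<open>A parameter vector of an architecture is zero outside the coordinates of that
  architecture, so that the vectors of all architectures live in one type.\<close>

definition Theta_B :: "nat \<Rightarrow> (nat \<Rightarrow> nat) \<Rightarrow> nat \<Rightarrow> real \<Rightarrow> param set" where
  "Theta_B L w s B =
     {\<theta>. (\<forall>c. c \<notin> coords L w \<longrightarrow> \<theta> c = 0) \<and>
         card {c \<in> coords L w. \<theta> c \<noteq> 0} \<le> s \<and>
         (\<forall>c\<in>coords L w. \<bar>\<theta> c\<bar> \<le> B)}"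

definition widths :: "nat \<Rightarrow> nat \<Rightarrow> nat \<Rightarrow> nat \<Rightarrow> nat" where
  "widths p L N l = (if l = 0 then p else if l < L then 12 * p * N else 1)"

abbreviation coords_N :: "nat \<Rightarrow> nat \<Rightarrow> nat \<Rightarrow> coord set" where
  "coords_N p L N \<equiv> coords L (widths p L N)"

abbreviation net_N :: "nat \<Rightarrow> nat \<Rightarrow> nat \<Rightarrow> param \<Rightarrow> (nat \<Rightarrow> real) \<Rightarrow> real" where
  "net_N p L N \<equiv> network L (widths p L N)"


section \<open>Error terms\<close>

text \<open>For \<open>s = 0\<close> the terms \<open>s * ln (n * L / s)\<close> are zero.\<close>

definition r_err :: "nat \<Rightarrow> real \<Rightarrow> nat \<Rightarrow> nat \<Rightarrow> nat \<Rightarrow> nat \<Rightarrow> real" where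
  "r_err p B n L N s =
     real L * real s / real n * ln (12 * B * real p * real N) +
     real s / real n * ln (real n * real L / real s)"

definition xi_err ::
  "nat \<Rightarrow> real \<Rightarrow> ((nat \<Rightarrow> real) \<Rightarrow> real) \<Rightarrow> nat \<Rightarrow> nat \<Rightarrow> nat \<Rightarrow> ereal" where
  "xi_err p B f0 L N s =
     (INF \<theta>\<in>Theta_B L (widths p L N) s B. (sup_dist p (net_N p L N \<theta>) f0)\<^sup>2)"

definition eps_star :: "real \<Rightarrow> real \<Rightarrow> nat \<Rightarrow> nat \<Rightarrow> nat \<Rightarrow> nat \<Rightarrow> real" where
  "eps_star M \<delta> n L N s =
     M * sqrt ((real L * real s * ln (real N) + real s * ln (real L * real n / real s)) / real n)
       * (ln (real n)) powr \<delta>"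


section \<open>Adaptive prior and posterior\<close>

text \<open>The slab distribution of the prior: uniform on \<open>[-B\<^sub>0, B\<^sub>0]\<close>, or centred normal with standard
  deviation \<open>\<sigma>\<^sub>0\<close>.\<close>

datatype slab = Unif_Slab real | Normal_Slab real

fun admissible_slab :: "slab \<Rightarrow> real \<Rightarrow> bool" where
  "admissible_slab (Unif_Slab B0) B \<longleftrightarrow> B0 > 1 \<and> B = B0"
| "admissible_slab (Normal_Slab \<sigma>0) B \<longleftrightarrow> \<sigma>0 > 0 \<and> B \<ge> 2"

definition unif_interval :: "real \<Rightarrow> real \<Rightarrow> real measure" where
  "unif_interval l u = (if l = u then return borel l else uniform_measure lborel {l..u})"

fun prior_slab :: "slab \<Rightarrow> real measure" where
  "prior_slab (Unif_Slab B0) = unif_interval (- B0) B0"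
| "prior_slab (Normal_Slab \<sigma>0) = normal_measure 0 \<sigma>0"

fun var_slabs :: "slab \<Rightarrow> real measure set" where
  "var_slabs (Unif_Slab B0) = {unif_interval l u | l u. - B0 \<le> l \<and> l \<le> u \<and> u \<le> B0}"
| "var_slabs (Normal_Slab \<sigma>0) = {normal_measure \<mu> \<sigma> | \<mu> \<sigma>. \<sigma> > 0}"

definition param_space :: "param measure" where
  "param_space = (\<Pi>\<^sub>M c\<in>UNIV. borel)"

text \<open>Independent coordinates in \<open>I\<close>, and zero elsewhere.\<close>

definition indep_coords :: "coord set \<Rightarrow> (coord \<Rightarrow> real measure) \<Rightarrow> param measure" where
  "indep_coords I M =
     distr (\<Pi>\<^sub>M c\<in>I. M c) param_space (\<lambda>\<theta> c. if c \<in> I then \<theta> c else 0)"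

definition prior_N :: "real \<Rightarrow> nat pmf" where
  "prior_N lam =
     embed_pmf (\<lambda>N. if N \<ge> 1 then lam ^ N / ((exp lam - 1) * fact N) else 0)"

definition prior_s :: "real \<Rightarrow> nat \<Rightarrow> nat pmf" where
  "prior_s lams H =
     embed_pmf (\<lambda>s. if s \<le> H then exp (- lams * real s) / (\<Sum>t\<le>H. exp (- lams * real t)) else 0)"

text \<open>Joint law of \<open>(N, s, \<gamma>)\<close>, where \<open>\<gamma>\<close> is identified with its support.  Given \<open>N\<close>, the
  sparsity \<open>s\<close> ranges over \<open>{0..H\<^sub>N}\<close>, with the exponential weights normalised on that range.\<close>

definition prior_index :: "nat \<Rightarrow> nat \<Rightarrow> real \<Rightarrow> real \<Rightarrow> (nat \<times> nat \<times> coord set) pmf" where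
  "prior_index p L lam lams =
     bind_pmf (prior_N lam) (\<lambda>N.
     bind_pmf (prior_s lams (card (coords_N p L N))) (\<lambda>s.
     bind_pmf (pmf_of_set {\<gamma>. \<gamma> \<subseteq> coords_N p L N \<and> card \<gamma> = s}) (\<lambda>\<gamma>.
     return_pmf (N, s, \<gamma>))))"

definition at_Ns :: "param measure \<Rightarrow> nat \<Rightarrow> nat \<Rightarrow> (param \<times> nat \<times> nat) measure" where
  "at_Ns M N s = M \<Otimes>\<^sub>M (return (count_space UNIV) N \<Otimes>\<^sub>M return (count_space UNIV) s)"

definition prior ::
  "slab \<Rightarrow> nat \<Rightarrow> nat \<Rightarrow> real \<Rightarrow> real \<Rightarrow> (param \<times> nat \<times> nat) measure" where
  "prior S p L lam lams =
     measure_pmf (prior_index p L lam lams) \<bind> (\<lambda>(N, s, \<gamma>).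
       at_Ns (indep_coords (coords_N p L N)
                (\<lambda>c. if c \<in> \<gamma> then prior_slab S else return borel 0)) N s)"

definition posterior ::
  "slab \<Rightarrow> nat \<Rightarrow> real \<Rightarrow> nat \<Rightarrow> real \<Rightarrow> real \<Rightarrow> nat \<Rightarrow> (nat \<Rightarrow> obs) \<Rightarrow>
     (param \<times> nat \<times> nat) measure" where
  "posterior S p \<sigma> L lam lams n D =
     (let lik = (\<lambda>(\<theta>, N, s). ennreal (likelihood \<sigma> (net_N p L N \<theta>) n D));
          Z = (\<integral>\<^sup>+ t. lik t \<partial>prior S p L lam lams)
      in density (prior S p L lam lams) (\<lambda>t. lik t / Z))"


section \<open>Adaptive variational posterior\<close>

definition spike_slab :: "real \<Rightarrow> real measure \<Rightarrow> real measure" where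
  "spike_slab \<nu> M =
     measure_pmf (bernoulli_pmf \<nu>) \<bind> (\<lambda>g. if g then M else return borel 0)"

definition var_family ::
  "slab \<Rightarrow> nat \<Rightarrow> nat \<Rightarrow> (param \<times> nat \<times> nat) measure set" where
  "var_family S p L =
     {at_Ns (indep_coords (coords_N p L N) (\<lambda>c. spike_slab (\<nu> c) (M c))) N s | N s \<nu> M.
        1 \<le> N \<and> (\<forall>c\<in>coords_N p L N. 0 \<le> \<nu> c \<and> \<nu> c \<le> 1 \<and> M c \<in> var_slabs S)}"

text \<open>Kullback-Leibler divergence of the probability measure \<open>Q\<close> from \<open>P\<close>.  The library's
  real-valued \<open>KL_divergence\<close> (whose arguments are in the opposite order) is a junk value when
  \<open>Q\<close> has no density with respect to \<open>P\<close> or the log-density is not integrable; in these cases the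
  divergence is infinite.\<close>

definition KL :: "'a measure \<Rightarrow> 'a measure \<Rightarrow> ereal" where
  "KL Q P =
     (if absolutely_continuous P Q \<and> integrable Q (entropy_density (exp 1) P Q)
      then ereal (KL_divergence (exp 1) P Q) else \<infinity>)"

definition is_adaptive_vp ::
  "slab \<Rightarrow> nat \<Rightarrow> real \<Rightarrow> nat \<Rightarrow> real \<Rightarrow> real \<Rightarrow> nat \<Rightarrow> (nat \<Rightarrow> obs) \<Rightarrow>
     (param \<times> nat \<times> nat) measure \<Rightarrow> bool" where
  "is_adaptive_vp S p \<sigma> L lam lams n D =
     is_arg_min (\<lambda>q. KL q (posterior S p \<sigma> L lam lams n D)) (\<lambda>q. q \<in> var_family S p L)"


section \<open>The two discrete priors have the intended mass functions\<close>

lemma pmf_prior_N: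
  assumes "lam > 0"
  shows "pmf (prior_N lam) N = (if N \<ge> 1 then lam ^ N / ((exp lam - 1) * fact N) else 0)"
proof -
  let ?f = "\<lambda>N::nat. if N \<ge> 1 then lam ^ N / ((exp lam - 1) * fact N) else 0"
  have pos: "exp lam - 1 > 0" using assms by simp
  have nn: "?f N \<ge> 0" for N using assms pos by auto
  have "(\<lambda>n. lam ^ n / fact n) sums exp lam"
    using exp_converges[of lam] by (simp add: scaleR_conv_of_real field_simps)
  then have "(\<lambda>n. lam ^ Suc n / fact (Suc n)) sums (exp lam - 1)"
    using sums_Suc_iff[of "\<lambda>n. lam ^ n / fact n" "exp lam - 1"] by simp
  then have "(\<lambda>n. lam ^ Suc n / fact (Suc n) / (exp lam - 1)) sums 1"
    using sums_divide[of _ "exp lam - 1" "exp lam - 1"] pos by fastforce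
  then have "(\<lambda>n. ?f (Suc n)) sums 1" by (simp add: field_simps)
  then have s: "?f sums 1" using sums_Suc_iff[of ?f 1] by simp
  have "(\<integral>\<^sup>+ N. ennreal (?f N) \<partial>count_space UNIV) = (\<Sum>N. ennreal (?f N))"
    by (rule nn_integral_count_space_nat)
  also have "\<dots> = 1" using suminf_ennreal_eq[OF nn s] by simp
  finally show ?thesis unfolding prior_N_def by (subst pmf_embed_pmf[OF nn]) auto
qed

lemma pmf_prior_s:
  "pmf (prior_s lams H) s =
     (if s \<le> H then exp (- lams * real s) / (\<Sum>t\<le>H. exp (- lams * real t)) else 0)"
proof -
  let ?Z = "\<Sum>t\<le>H. exp (- lams * real t)"
  let ?f = "\<lambda>s. if s \<le> H then exp (- lams * real s) / ?Z else 0"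
  have Z: "?Z > 0" by (rule sum_pos) auto
  have nn: "?f s \<ge> 0" for s using Z by auto
  have "(\<integral>\<^sup>+ s. ennreal (?f s) \<partial>count_space UNIV) = (\<Sum>s\<le>H. ennreal (?f s))"
    by (rule nn_integral_count_space') auto
  also have "\<dots> = ennreal (\<Sum>s\<le>H. ?f s)" using nn by (intro sum_ennreal) blast
  also have "(\<Sum>s\<le>H. ?f s) = 1" using Z by (simp add: sum_divide_distrib[symmetric])
  finally show ?thesis unfolding prior_s_def by (subst pmf_embed_pmf[OF nn]) auto
qed

end

theory Submission
  imports Defs
begin

text \<open>The test-and-sieve argument is replaced by a uniform bound on the likelihood ratio
  \<open>exp (llr f)\<close> of \<open>f\<close> against \<open>f0\<close>.  Since \<open>exp (llr f / 2 + n * hell f)\<close> has expectation at most 1 for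
  every \<open>f\<close>, a union bound over a fine grid of parameters shows that with high probability
  \<open>llr f / 2 + n * hell f \<le> O(s * L * ln n)\<close> for all networks with \<open>s\<close> active weights at once.  Raising this
  to a small power \<open>c\<close>, the factor \<open>exp (c * O(s * L * ln n))\<close> is absorbed by the sparsity prior, whose
  weights decay at least like \<open>exp (- a * s * L * ln n)\<close>; so the prior integral of
  \<open>exp (llr f + c * n * hell f)\<close> is at most polynomial in \<open>n\<close>.  By the inequality of Donsker and Varadhan
  \<open>c * n\<close> times the variational Hellinger risk is then at most the divergence of the variational
  posterior from the posterior, up to \<open>O(ln n)\<close> and the log-evidence.  By minimality it may be replaced
  by the divergence of any competitor; slabs of tiny width around the weights of a near-optimal
  sparse network give the claimed rate.\<close>

section \<open>Kullback-Leibler divergence\<close>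

text \<open>The minimiser may sit at any \<open>N\<close> and \<open>s\<close> and, under normal
  slabs, at arbitrarily large weights, so the exponential moment has to be controlled over the whole
  prior support, while a union bound reaches only a bounded part of it. The cut is made at
  \<open>n\<close>. When \<open>N\<close>, the sparsity and all weights are at most
  \<open>n\<close>, the uniform bound applies; beyond that the Hellinger distance is at most 1 and
  the likelihood ratio has mean 1, so each parameter contributes at most \<open>exp n\<close> in
  expectation, and exponential moments of order 2 of \<open>N\<close>, of \<open>s\<close> and of
  the slabs pay for it. The constant \<open>c\<close> is at most \<open>a / 32\<close> because a
  grid point costs \<open>16 * L * ln n\<close> per active weight and half of the prior decay must
  remain for summability. The density of the competitor against the posterior is never computed: it
  is dominated setwise through a single component of the prior mixture, and the weight of that
  component is part of the rate. The rounding argument needs \<open>f0\<close> bounded on the cube;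
  this is extracted from the finiteness of the approximation error at one sample size.\<close>

lemma RN_deriv_le_AE:
  assumes P: "prob_space P" and Q: "prob_space Q" and sets: "sets Q = sets P"
    and k[measurable]: "k \<in> borel_measurable P"
    and le: "\<And>A. A \<in> sets P \<Longrightarrow> emeasure Q A \<le> (\<integral>\<^sup>+x. ennreal (exp (k x)) * indicator A x \<partial>P)"
  shows "absolutely_continuous P Q" and "AE x in P. RN_deriv P Q x \<le> ennreal (exp (k x))"
proof -
  interpret P: prob_space P by fact
  interpret Q: prob_space Q by fact
  have [measurable_cong]: "sets Q = sets P" by fact
  show ac: "absolutely_continuous P Q"
    unfolding absolutely_continuous_def
  proof safe
    fix A assume A: "A \<in> null_sets P"
    then have [measurable]: "A \<in> sets P" by auto
    have "AE x in P. x \<notin> A" using A by (rule AE_not_in)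
    then have "(\<integral>\<^sup>+x. ennreal (exp (k x)) * indicator A x \<partial>P) = (\<integral>\<^sup>+x. 0 \<partial>P)"
      by (intro nn_integral_cong_AE) auto
    with le[of A] have "emeasure Q A = 0" by simp
    then show "A \<in> null_sets Q" using sets by (auto simp: null_sets_def)
  qed
  define f where "f = RN_deriv P Q"
  have f[measurable]: "f \<in> borel_measurable P" unfolding f_def by measurable
  have Qf: "density P f = Q" unfolding f_def using P.density_RN_deriv[OF ac sets] .
  \<comment> \<open>The cap \<open>k x \<le> real m\<close> keeps the integral of
    \<open>exp k\<close> over \<open>N m\<close> finite; otherwise the strict comparison below could
    be between two infinite integrals. The sets \<open>N m\<close> exhaust the exceptional
    set.\<close>
  define N where "N m = {x \<in> space P. ennreal (exp (k x)) < f x \<and> k x \<le> real m}" for m :: nat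
  have N[measurable]: "N m \<in> sets P" for m unfolding N_def by measurable
  have "AE x in P. x \<notin> N m" for m
  proof (rule ccontr)
    assume *: "\<not> (AE x in P. x \<notin> N m)"
    let ?e = "\<lambda>x. ennreal (exp (k x)) * indicator (N m) x" and ?f = "\<lambda>x. f x * indicator (N m) x"
    have "(\<integral>\<^sup>+x. ?e x \<partial>P) < (\<integral>\<^sup>+x. ?f x \<partial>P)"
    proof (rule nn_integral_less)
      have "(\<integral>\<^sup>+x. ?e x \<partial>P) \<le> (\<integral>\<^sup>+x. ennreal (exp m) \<partial>P)"
        by (intro nn_integral_mono) (auto simp: N_def indicator_def intro!: ennreal_leI)
      also have "\<dots> < \<infinity>" by (simp add: P.emeasure_space_1)
      finally show "(\<integral>\<^sup>+x. ?e x \<partial>P) \<noteq> \<infinity>" by simp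
      show "AE x in P. ?e x \<le> ?f x" by (auto simp: N_def indicator_def)
      show "\<not> (AE x in P. ?f x \<le> ?e x)"
      proof
        assume "AE x in P. ?f x \<le> ?e x"
        then have "AE x in P. x \<notin> N m" by eventually_elim (auto simp: N_def indicator_def)
        with * show False by simp
      qed
    qed measurable
    also have "(\<integral>\<^sup>+x. ?f x \<partial>P) = emeasure Q (N m)"
      by (subst Qf[symmetric]) (rule emeasure_density[symmetric]; simp)
    also have "\<dots> \<le> (\<integral>\<^sup>+x. ?e x \<partial>P)" by (rule le) simp
    finally show False by simp
  qed
  then have "AE x in P. \<forall>m. x \<notin> N m" by (simp add: AE_all_countable)
  then show "AE x in P. RN_deriv P Q x \<le> ennreal (exp (k x))"
  proof (rule AE_mp, intro AE_I2 impI)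
    fix x assume "x \<in> space P" "\<forall>m. x \<notin> N m"
    moreover obtain m :: nat where "k x \<le> real m" using real_arch_simple by blast
    ultimately show "RN_deriv P Q x \<le> ennreal (exp (k x))"
      by (auto simp: N_def f_def not_less)
  qed
qed

text \<open>The divergence is the mean of a log-density, so an upper bound of the density is enough.
  The care goes into \<open>KL\<close> being infinite unless the log-density is integrable:
  \<open>k\<close> controls it from above, and its negative part is always integrable.\<close>

lemma KL_le_integral:
  assumes P: "prob_space P" and Q: "prob_space Q" and sets: "sets Q = sets P"
    and k[measurable]: "k \<in> borel_measurable P"
    and le: "\<And>A. A \<in> sets P \<Longrightarrow> emeasure Q A \<le> (\<integral>\<^sup>+x. ennreal (exp (k x)) * indicator A x \<partial>P)"
    and int: "integrable Q k"
  shows "KL Q P \<le> ereal (\<integral>x. k x \<partial>Q)"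
proof -
  interpret P: prob_space P by fact
  interpret Q: prob_space Q by fact
  have [measurable_cong]: "sets Q = sets P" by fact
  have ac: "absolutely_continuous P Q" by (rule RN_deriv_le_AE(1)[OF P Q sets k]) (rule le)
  have RN_le: "AE x in P. RN_deriv P Q x \<le> ennreal (exp (k x))"
    by (rule RN_deriv_le_AE(2)[OF P Q sets k]) (rule le)
  obtain D where D[measurable]: "D \<in> borel_measurable P"
    and RN: "AE x in P. RN_deriv P Q x = ennreal (D x)"
    and D_pos: "AE x in Q. 0 < D x" and D_nn: "\<And>x. 0 \<le> D x"
    by (rule P.real_RN_deriv[OF Q.finite_measure_axioms ac sets]) (rule that)
  have dens: "density P (\<lambda>x. ennreal (D x)) = Q"
    by (subst P.density_RN_deriv[OF ac sets, symmetric], rule density_cong) (use RN in auto)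
  have "AE x in Q. RN_deriv P Q x = ennreal (D x) \<and> RN_deriv P Q x \<le> ennreal (exp (k x))"
    using RN RN_le by (intro absolutely_continuous_AE[OF sets ac]) auto
  then have ent: "AE x in Q. entropy_density (exp 1) P Q x = ln (D x) \<and> ln (D x) \<le> k x"
    using D_pos
  proof eventually_elim
    case (elim x)
    then have "D x \<le> exp (k x)" by (metis ennreal_le_iff exp_ge_zero)
    then have "ln (D x) \<le> ln (exp (k x))" using elim by (subst ln_le_cancel_iff) auto
    then have "ln (D x) \<le> k x" by simp
    with elim D_nn[of x] show ?case by (simp add: entropy_density_def log_def)
  qed
  \<comment> \<open>Since \<open>D * ln (1 / D) \<le> 1\<close> pointwise, the negative part of the
    log-density has \<open>Q\<close>-mean at most 1 for any two probability measures.\<close>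
  have neg: "integrable Q (\<lambda>x. max 0 (- ln (D x)))"
  proof (rule integrableI_nonneg)
    have "(\<integral>\<^sup>+x. ennreal (max 0 (- ln (D x))) \<partial>Q) = (\<integral>\<^sup>+x. ennreal (D x) * ennreal (max 0 (- ln (D x))) \<partial>P)"
      by (subst dens[symmetric], subst nn_integral_density) auto
    also have "\<dots> \<le> (\<integral>\<^sup>+x. 1 \<partial>P)"
    proof (intro nn_integral_mono)
      fix x
      have "D x * max 0 (- ln (D x)) \<le> 1"
      proof (cases "D x > 0")
        case True
        have "ln (inverse (D x)) \<le> inverse (D x) - 1" using True by (intro ln_le_minus_one) auto
        then have "max 0 (- ln (D x)) \<le> inverse (D x)" using True by (simp add: ln_inverse)
        then have "D x * max 0 (- ln (D x)) \<le> D x * inverse (D x)" using True by (intro mult_left_mono) auto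
        then show ?thesis using True by simp
      qed (use D_nn[of x] in auto)
      then show "ennreal (D x) * ennreal (max 0 (- ln (D x))) \<le> 1"
        using D_nn[of x] by (subst ennreal_mult[symmetric]) auto
    qed
    also have "\<dots> < \<infinity>" by (simp add: P.emeasure_space_1)
    finally show "(\<integral>\<^sup>+x. ennreal (max 0 (- ln (D x))) \<partial>Q) < \<infinity>" .
  qed auto
  have ed[measurable]: "entropy_density (exp 1) P Q \<in> borel_measurable Q" 
    using measurable_entropy_density[of "exp 1" P Q] measurable_cong_sets[OF sets refl] by blast
  have ie: "integrable Q (entropy_density (exp 1) P Q)"
  proof (rule Bochner_Integration.integrable_bound)
    show "integrable Q (\<lambda>x. \<bar>k x\<bar> + max 0 (- ln (D x)))" using int neg by auto
    show "AE x in Q. norm (entropy_density (exp 1) P Q x) \<le> norm (\<bar>k x\<bar> + max 0 (- ln (D x)))"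
      using ent by eventually_elim auto
  qed fact
  have "(\<integral>x. entropy_density (exp 1) P Q x \<partial>Q) \<le> (\<integral>x. k x \<partial>Q)"
    using ie int ent by (intro integral_mono_AE) auto
  then show ?thesis using ac ie by (simp add: KL_def KL_divergence_def)
qed

text \<open>The inequality of Donsker and Varadhan, obtained by integrating
  \<open>ln t \<le> t - 1\<close> at \<open>t = exp g / (J * dQ/dP)\<close>.\<close>

lemma integral_le_KL_plus_ln:
  assumes P: "prob_space P" and Q: "prob_space Q" and sets: "sets Q = sets P"
    and g[measurable]: "g \<in> borel_measurable P" and int: "integrable Q g"
    and J: "J > 0" "(\<integral>\<^sup>+x. ennreal (exp (g x)) \<partial>P) \<le> ennreal J"
  shows "ereal (\<integral>x. g x \<partial>Q) \<le> KL Q P + ereal (ln J)"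
proof (cases "absolutely_continuous P Q \<and> integrable Q (entropy_density (exp 1) P Q)")
  case False
  then show ?thesis by (auto simp: KL_def)
next
  case True
  interpret P: prob_space P by fact
  interpret Q: prob_space Q by fact
  have [measurable_cong]: "sets Q = sets P" by fact
  from True have ac: "absolutely_continuous P Q" and ie: "integrable Q (entropy_density (exp 1) P Q)"
    by auto
  obtain D where D[measurable]: "D \<in> borel_measurable P"
    and RN: "AE x in P. RN_deriv P Q x = ennreal (D x)"
    and D_pos: "AE x in Q. 0 < D x" and D_nn: "\<And>x. 0 \<le> D x"
    by (rule P.real_RN_deriv[OF Q.finite_measure_axioms ac sets]) (rule that)
  have dens: "density P (\<lambda>x. ennreal (D x)) = Q"
    by (subst P.density_RN_deriv[OF ac sets, symmetric], rule density_cong) (use RN in auto)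
  have RNQ: "AE x in Q. RN_deriv P Q x = ennreal (D x)"
    using RN by (rule absolutely_continuous_AE[OF sets ac])
  let ?t = "\<lambda>x. exp (g x) / (D x * J)"
  have "(\<integral>\<^sup>+x. ennreal (?t x) \<partial>Q) = (\<integral>\<^sup>+x. ennreal (D x) * ennreal (?t x) \<partial>P)"
    by (subst dens[symmetric], subst nn_integral_density) auto
  also have "\<dots> \<le> (\<integral>\<^sup>+x. ennreal (1 / J) * ennreal (exp (g x)) \<partial>P)"
  proof (intro nn_integral_mono)
    fix x
    \<comment> \<open>Where \<open>D x = 0\<close> the convention for division makes
      \<open>?t x\<close> zero too, so no positivity of \<open>D\<close> under \<open>P\<close> is
      required.\<close>
    have "D x * ?t x \<le> 1 / J * exp (g x)" using J by (cases "D x = 0") auto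
    then show "ennreal (D x) * ennreal (?t x) \<le> ennreal (1 / J) * ennreal (exp (g x))"
      using J D_nn[of x] by (simp add: ennreal_mult[symmetric] ennreal_leI)
  qed
  also have "\<dots> \<le> ennreal (1 / J) * ennreal J"
    by (subst nn_integral_cmult) (auto intro!: mult_left_mono J)
  also have "\<dots> = 1" using J by (simp add: ennreal_mult[symmetric])
  finally have t: "(\<integral>\<^sup>+x. ennreal (?t x) \<partial>Q) \<le> 1" .
  have t_nn: "?t x \<ge> 0" for x using D_nn[of x] J by simp
  have it: "integrable Q ?t"
    using t t_nn by (intro integrableI_nonneg) (auto simp: top.extremum_strict intro: le_less_trans)
  have "ennreal (\<integral>x. ?t x \<partial>Q) = (\<integral>\<^sup>+x. ennreal (?t x) \<partial>Q)"
    using it t_nn by (intro nn_integral_eq_integral[symmetric]) auto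
  then have It: "(\<integral>x. ?t x \<partial>Q) \<le> 1" using t by (metis ennreal_le_1)
  have "AE x in Q. g x - entropy_density (exp 1) P Q x - ln J \<le> ?t x - 1"
    using RNQ D_pos
  proof eventually_elim
    case (elim x)
    have "ln (?t x) \<le> ?t x - 1" using elim J by (intro ln_le_minus_one) auto
    then show ?case using elim J by (simp add: ln_div ln_mult entropy_density_def log_def)
  qed
  then have "(\<integral>x. g x - entropy_density (exp 1) P Q x - ln J \<partial>Q) \<le> (\<integral>x. ?t x - 1 \<partial>Q)"
    using int ie it by (intro integral_mono_AE) auto
  then have "(\<integral>x. g x \<partial>Q) - (\<integral>x. entropy_density (exp 1) P Q x \<partial>Q) - ln J \<le> 0"
    using int ie it It by (simp add: Q.prob_space)
  then show ?thesis using True by (simp add: KL_def KL_divergence_def)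
qed

section \<open>Slab distributions\<close>

lemma sets_normal_measure[simp, measurable_cong]: "sets (normal_measure \<mu> \<sigma>) = sets borel"
  by (simp add: normal_measure_def)

lemma prob_space_normal_measure: "\<sigma> > 0 \<Longrightarrow> prob_space (normal_measure \<mu> \<sigma>)"
  unfolding normal_measure_def by (rule prob_space_normal_density)

lemma nn_integral_normal_measure:
  "g \<in> borel_measurable borel \<Longrightarrow>
    (\<integral>\<^sup>+x. g x \<partial>normal_measure \<mu> \<sigma>) = (\<integral>\<^sup>+x. ennreal (normal_density \<mu> \<sigma> x) * g x \<partial>lborel)"
  unfolding normal_measure_def by (subst nn_integral_density) auto

text \<open>Completing the square: tilting by \<open>exp (t * x)\<close> moves the mean to
  \<open>\<mu> + \<sigma>\<^sup>2 * t\<close> and keeps the variance, so the integral is the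
  leftover constant.\<close>

lemma nn_integral_exp_normal_measure:
  assumes \<sigma>: "\<sigma> > 0"
  shows "(\<integral>\<^sup>+x. ennreal (exp (t * x)) \<partial>normal_measure \<mu> \<sigma>) = ennreal (exp (t * \<mu> + \<sigma>\<^sup>2 * t\<^sup>2 / 2))"
proof -
  have eq: "normal_density \<mu> \<sigma> x * exp (t * x) =
      exp (t * \<mu> + \<sigma>\<^sup>2 * t\<^sup>2 / 2) * normal_density (\<mu> + \<sigma>\<^sup>2 * t) \<sigma> x" for x
  proof -
    have "- ((x - \<mu>)\<^sup>2 / (2 * \<sigma>\<^sup>2)) + t * x =
        (t * \<mu> + \<sigma>\<^sup>2 * t\<^sup>2 / 2) - (x - (\<mu> + \<sigma>\<^sup>2 * t))\<^sup>2 / (2 * \<sigma>\<^sup>2)"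
      using \<sigma> by (simp add: field_simps power2_eq_square)
    then show ?thesis by (simp add: normal_density_def mult_exp_exp)
  qed
  interpret N: prob_space "density lborel (\<lambda>x. ennreal (normal_density (\<mu> + \<sigma>\<^sup>2 * t) \<sigma> x))"
    using \<sigma> by (rule prob_space_normal_density)
  have one: "(\<integral>\<^sup>+x. ennreal (normal_density (\<mu> + \<sigma>\<^sup>2 * t) \<sigma> x) \<partial>lborel) = 1"
    using N.emeasure_space_1 by (subst (asm) emeasure_density) auto
  have "(\<integral>\<^sup>+x. ennreal (exp (t * x)) \<partial>normal_measure \<mu> \<sigma>) =
      (\<integral>\<^sup>+x. ennreal (normal_density \<mu> \<sigma> x * exp (t * x)) \<partial>lborel)"
    by (subst nn_integral_normal_measure) (auto simp: ennreal_mult)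
  also have "\<dots> = (\<integral>\<^sup>+x. ennreal (exp (t * \<mu> + \<sigma>\<^sup>2 * t\<^sup>2 / 2)) *
      ennreal (normal_density (\<mu> + \<sigma>\<^sup>2 * t) \<sigma> x) \<partial>lborel)"
    unfolding eq by (simp add: ennreal_mult)
  also have "\<dots> = ennreal (exp (t * \<mu> + \<sigma>\<^sup>2 * t\<^sup>2 / 2))"
    by (subst nn_integral_cmult) (auto simp: one)
  finally show ?thesis .
qed

text \<open>The two-sided exponential is at most the sum of the two one-sided ones, which have equal
  integrals after centring; hence the factor 2.\<close>

lemma nn_integral_exp_abs_normal_measure:
  assumes \<sigma>: "\<sigma> > 0" and t: "t \<ge> 0"
  shows "(\<integral>\<^sup>+x. ennreal (exp (t * \<bar>x - \<mu>\<bar>)) \<partial>normal_measure \<mu> \<sigma>) \<le> ennreal (2 * exp (\<sigma>\<^sup>2 * t\<^sup>2 / 2))"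
proof -
  have "(\<integral>\<^sup>+x. ennreal (exp (t * \<bar>x - \<mu>\<bar>)) \<partial>normal_measure \<mu> \<sigma>) \<le>
      (\<integral>\<^sup>+x. ennreal (exp (- t * \<mu>)) * ennreal (exp (t * x)) +
             ennreal (exp (t * \<mu>)) * ennreal (exp (- t * x)) \<partial>normal_measure \<mu> \<sigma>)"
  proof (intro nn_integral_mono)
    fix x :: real
    have "exp (t * \<bar>x - \<mu>\<bar>) \<le> exp (- t * \<mu>) * exp (t * x) + exp (t * \<mu>) * exp (- t * x)"
      by (cases "x \<ge> \<mu>") (auto simp: mult_exp_exp algebra_simps)
    then show "ennreal (exp (t * \<bar>x - \<mu>\<bar>)) \<le>
       ennreal (exp (- t * \<mu>)) * ennreal (exp (t * x)) + ennreal (exp (t * \<mu>)) * ennreal (exp (- t * x))"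
      by (simp add: ennreal_mult[symmetric] ennreal_plus[symmetric] del: ennreal_plus)
  qed
  also have "\<dots> = ennreal (exp (- t * \<mu>)) * ennreal (exp (t * \<mu> + \<sigma>\<^sup>2 * t\<^sup>2 / 2)) +
      ennreal (exp (t * \<mu>)) * ennreal (exp (- t * \<mu> + \<sigma>\<^sup>2 * (- t)\<^sup>2 / 2))"
    unfolding nn_integral_exp_normal_measure[OF \<sigma>, symmetric]
    by (subst nn_integral_add; (subst nn_integral_cmult)?) (auto simp: nn_integral_cmult)
  also have "\<dots> = ennreal (2 * exp (\<sigma>\<^sup>2 * t\<^sup>2 / 2))"
    by (simp add: ennreal_mult[symmetric] ennreal_plus[symmetric] mult_exp_exp del: ennreal_plus)
  finally show ?thesis .
qed

lemma sets_unif_interval[simp, measurable_cong]: "sets (unif_interval l u) = sets borel"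
  by (simp add: unif_interval_def)

lemma prob_space_unif_interval: "l \<le> u \<Longrightarrow> prob_space (unif_interval l u)"
  by (auto simp: unif_interval_def intro!: prob_space_return prob_space_uniform_measure)

lemma sets_prior_slab[simp, measurable_cong]: "sets (prior_slab S) = sets borel"
  by (cases S) auto

lemma prob_space_prior_slab: "admissible_slab S B \<Longrightarrow> prob_space (prior_slab S)"
  by (cases S) (auto intro: prob_space_normal_measure prob_space_unif_interval)

lemma admissible_slab_ge_1: "admissible_slab S B \<Longrightarrow> 1 \<le> B"
  by (cases S) auto

lemma var_slabs_prob_space: "M \<in> var_slabs S \<Longrightarrow> prob_space M"
  by (cases S) (auto intro: prob_space_normal_measure prob_space_unif_interval)

lemma sets_var_slabs: "M \<in> var_slabs S \<Longrightarrow> sets M = sets borel"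
  by (cases S) auto

lemma AE_unif_interval: 
  assumes "l < u" shows "AE x in unif_interval l u. l \<le> x \<and> x \<le> u"
  using assms unfolding unif_interval_def
  by (auto intro!: AE_uniform_measureI)

text \<open>Order 2 is what a large weight calls for: \<open>\<bar>x\<bar> > n\<close> gives
  \<open>exp n \<le> exp (2 * \<bar>x\<bar>) / exp n\<close>.\<close>

lemma nn_integral_exp_prior_slab:
  assumes "admissible_slab S B"
  obtains C where "C \<ge> 1" "(\<integral>\<^sup>+x. ennreal (exp (2 * \<bar>x\<bar>)) \<partial>prior_slab S) \<le> ennreal C"
proof (cases S)
  case (Unif_Slab B0)
  then have "B0 > 1" using assms by simp
  interpret prob_space "unif_interval (- B0) B0" using \<open>B0 > 1\<close> by (intro prob_space_unif_interval) simp
  have "(\<integral>\<^sup>+x. ennreal (exp (2 * \<bar>x\<bar>)) \<partial>unif_interval (- B0) B0) \<le>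
      (\<integral>\<^sup>+x. ennreal (exp (2 * B0)) \<partial>unif_interval (- B0) B0)"
  proof (intro nn_integral_mono_AE)
    show "AE x in unif_interval (- B0) B0. ennreal (exp (2 * \<bar>x\<bar>)) \<le> ennreal (exp (2 * B0))"
      using AE_unif_interval[of "- B0" B0] \<open>B0 > 1\<close> by (auto intro!: ennreal_leI)
  qed
  also have "\<dots> = ennreal (exp (2 * B0))" by (simp add: emeasure_space_1)
  finally show ?thesis using that[of "exp (2 * B0)"] Unif_Slab \<open>B0 > 1\<close> by simp
next
  case (Normal_Slab \<sigma>0)
  then have "\<sigma>0 > 0" using assms by simp
  moreover have "1 \<le> 2 * exp (2 * \<sigma>0\<^sup>2)"
    using exp_ge_add_one_self[of "2 * \<sigma>0\<^sup>2"] zero_le_power2[of \<sigma>0] by linarith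
  ultimately show ?thesis
    using nn_integral_exp_abs_normal_measure[of \<sigma>0 2 0] that[of "2 * exp (2 * \<sigma>0\<^sup>2)"] Normal_Slab
    by (simp add: mult.commute)
qed

lemma power2_le_exp_abs: "(x::real)\<^sup>2 \<le> exp (4 * \<bar>x\<bar>)"
proof -
  have "\<bar>x\<bar> \<le> exp \<bar>x\<bar>" using exp_ge_add_one_self[of "\<bar>x\<bar>"] by linarith
  then have "\<bar>x\<bar>\<^sup>2 \<le> (exp \<bar>x\<bar>)\<^sup>2" by (intro power_mono) auto
  also have "\<dots> = exp (2 * \<bar>x\<bar>)" by (simp add: power2_eq_square mult_exp_exp)
  also have "\<dots> \<le> exp (4 * \<bar>x\<bar>)" by simp
  finally show ?thesis by simp
qed

text \<open>One coordinate of the competitor: a variational slab at scale \<open>\<eta>\<close>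
  around a target weight. Its price against the prior slab is \<open>ln (1 / \<eta>)\<close> up to a
  constant. The bound \<open>k\<close> is a function because the ratio of two normal densities is
  dominated by a term quadratic in \<open>x\<close> in the exponent, and only the mean of
  \<open>k\<close> is paid. The moment of order \<open>4 / \<eta>\<close> is the only tail
  information that the perturbation of networks will ask for.\<close>

lemma concentrated_slab:
  assumes adm: "admissible_slab S B"
  obtains C \<eta>0 where "C \<ge> 1" "0 < \<eta>0" "\<eta>0 \<le> 1"
    "\<And>\<eta> t. 0 < \<eta> \<Longrightarrow> \<eta> \<le> \<eta>0 \<Longrightarrow> \<bar>t\<bar> \<le> B \<Longrightarrow>
      \<exists>M\<in>var_slabs S. \<exists>g k. g \<in> borel_measurable borel \<and> k \<in> borel_measurable borel \<and>
        M = density (prior_slab S) g \<and> (\<forall>x. 0 \<le> k x \<and> g x \<le> ennreal (exp (k x))) \<and>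
        (\<integral>\<^sup>+x. ennreal (k x) \<partial>M) \<le> ennreal (ln (1 / \<eta>) + C) \<and>
        (\<integral>\<^sup>+x. ennreal (exp (4 * \<bar>x - t\<bar> / \<eta>)) \<partial>M) \<le> ennreal C"
proof (cases S)
  case (Unif_Slab B0)
  then have B0: "B0 > 1" "B = B0" using adm by auto
  define C where "C = exp 4 + ln (2 * B0)"
  have C1: "C \<ge> exp 4" using B0 by (simp add: C_def)
  have "C \<ge> 1" using C1 exp_ge_add_one_self[of 4] by linarith
  moreover have "\<exists>M\<in>var_slabs S. \<exists>g k. g \<in> borel_measurable borel \<and> k \<in> borel_measurable borel \<and>
        M = density (prior_slab S) g \<and> (\<forall>x. 0 \<le> k x \<and> g x \<le> ennreal (exp (k x))) \<and>
        (\<integral>\<^sup>+x. ennreal (k x) \<partial>M) \<le> ennreal (ln (1 / \<eta>) + C) \<and>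
        (\<integral>\<^sup>+x. ennreal (exp (4 * \<bar>x - t\<bar> / \<eta>)) \<partial>M) \<le> ennreal C"
    if \<eta>: "0 < \<eta>" "\<eta> \<le> 1" and t: "\<bar>t\<bar> \<le> B" for \<eta> t
  proof -
    \<comment> \<open>The target is an endpoint, and the interval of length \<open>\<eta>\<close>
      extends from it towards or across zero. It therefore stays inside \<open>[-B0, B0]\<close>
      even for \<open>\<bar>t\<bar> = B0\<close>, because
      \<open>\<eta> \<le> 1 < B0\<close>.\<close>
    define l where "l = (if t \<ge> 0 then t - \<eta> else t)"
    define u where "u = l + \<eta>"
    have lu: "- B0 \<le> l" "l < u" "u \<le> B0" "l \<le> t" "t \<le> u"
      using \<eta> t B0 by (auto simp: l_def u_def)
    define M where "M = unif_interval l u"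
    define g where "g x = ennreal (2 * B0 / \<eta>) * indicator {l..u} x" for x :: real
    define k where "k x = ln (2 * B0 / \<eta>)" for x :: real
    have [measurable]: "g \<in> borel_measurable borel" unfolding g_def by measurable
    interpret M: prob_space M unfolding M_def using lu by (intro prob_space_unif_interval) simp
    have "2 * B0 / \<eta> \<ge> 1" using B0 \<eta> by (simp add: field_simps)
    have "M \<in> var_slabs S"
      unfolding M_def Unif_Slab var_slabs.simps mem_Collect_eq
      using lu by (intro exI[of _ l] exI[of _ u]) simp
    moreover have "M = density (prior_slab S) g"
    proof (rule measure_eqI)
      fix A assume "A \<in> sets M"
      then have A[measurable]: "A \<in> sets borel" by (simp add: M_def)
      have int: "{- B0..B0} \<inter> ({l..u} \<inter> A) = {l..u} \<inter> A" using lu by auto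
      have "emeasure (density (prior_slab S) g) A =
          (\<integral>\<^sup>+x. ennreal (2 * B0 / \<eta>) * indicator ({l..u} \<inter> A) x \<partial>prior_slab S)"
        by (subst emeasure_density)
          (auto simp: g_def indicator_def intro!: nn_integral_cong)
      also have "\<dots> = ennreal (2 * B0 / \<eta>) * emeasure (prior_slab S) ({l..u} \<inter> A)"
        by (subst nn_integral_cmult_indicator) auto
      also have "emeasure (prior_slab S) ({l..u} \<inter> A) = emeasure lborel ({l..u} \<inter> A) / ennreal (2 * B0)"
        using B0 Unif_Slab by (simp add: unif_interval_def int)
      also have "ennreal (2 * B0 / \<eta>) * (emeasure lborel ({l..u} \<inter> A) / ennreal (2 * B0)) =
          emeasure lborel ({l..u} \<inter> A) / ennreal \<eta>"
      proof -
        have "ennreal (2 * B0 / \<eta>) * ennreal (inverse (2 * B0)) = ennreal (inverse \<eta>)"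
          using B0 \<eta> by (subst ennreal_mult[symmetric]) (auto simp: field_simps)
        then show ?thesis
          using B0 \<eta> unfolding divide_ennreal_def
          by (subst (1 2) inverse_ennreal) (auto simp: mult.left_commute mult.assoc)
      qed
      also have "\<dots> = emeasure M A"
        using lu \<eta> by (simp add: M_def unif_interval_def u_def)
      finally show "emeasure M A = emeasure (density (prior_slab S) g) A" ..
    qed (simp add: M_def)
    moreover have "\<forall>x. 0 \<le> k x \<and> g x \<le> ennreal (exp (k x))"
      using \<open>2 * B0 / \<eta> \<ge> 1\<close> B0 \<eta> by (auto simp: k_def g_def indicator_def ln_ge_zero)
    moreover have "(\<integral>\<^sup>+x. ennreal (k x) \<partial>M) \<le> ennreal (ln (1 / \<eta>) + C)"
      using B0 \<eta> by (auto simp: k_def C_def M.emeasure_space_1 ln_div ln_mult intro!: ennreal_leI)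
    moreover have "(\<integral>\<^sup>+x. ennreal (exp (4 * \<bar>x - t\<bar> / \<eta>)) \<partial>M) \<le> ennreal C"
    proof -
      have "(\<integral>\<^sup>+x. ennreal (exp (4 * \<bar>x - t\<bar> / \<eta>)) \<partial>M) \<le> (\<integral>\<^sup>+x. ennreal (exp 4) \<partial>M)"
      proof (intro nn_integral_mono_AE)
        show "AE x in M. ennreal (exp (4 * \<bar>x - t\<bar> / \<eta>)) \<le> ennreal (exp 4)"
          unfolding M_def using AE_unif_interval[OF lu(2)]
        proof eventually_elim
          case (elim x)
          then have "\<bar>x - t\<bar> \<le> \<eta>" using lu by (auto simp: u_def)
          then show ?case using \<eta> by (intro ennreal_leI) (simp add: field_simps)
        qed
      qed
      also have "\<dots> \<le> ennreal C" using C1 by (simp add: M.emeasure_space_1 ennreal_leI)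
      finally show ?thesis .
    qed
    moreover have "g \<in> borel_measurable borel" "k \<in> borel_measurable borel"
      unfolding g_def k_def by measurable
    ultimately show ?thesis by blast
  qed
  ultimately show ?thesis using that[of C 1] by auto
next
  case (Normal_Slab \<sigma>0)
  then have \<sigma>0: "\<sigma>0 > 0" and B: "B \<ge> 2" using adm by auto
  \<comment> \<open>The exponent is \<open>\<eta>\<^sup>2 * (4 / \<eta>)\<^sup>2 / 2 = 8\<close>,
    independent of the scale.\<close>
  define K :: real where "K = 2 * exp 8"
  define C where "C = K + \<bar>ln \<sigma>0\<bar> + (B\<^sup>2 + K) / \<sigma>0\<^sup>2"
  have "K \<ge> 1" using exp_ge_add_one_self[of 8] by (simp add: K_def)
  then have CK: "C \<ge> K" by (simp add: C_def)
  then have "C \<ge> 1" using \<open>K \<ge> 1\<close> by simp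
  moreover have "\<exists>M\<in>var_slabs S. \<exists>g k. g \<in> borel_measurable borel \<and> k \<in> borel_measurable borel \<and>
        M = density (prior_slab S) g \<and> (\<forall>x. 0 \<le> k x \<and> g x \<le> ennreal (exp (k x))) \<and>
        (\<integral>\<^sup>+x. ennreal (k x) \<partial>M) \<le> ennreal (ln (1 / \<eta>) + C) \<and>
        (\<integral>\<^sup>+x. ennreal (exp (4 * \<bar>x - t\<bar> / \<eta>)) \<partial>M) \<le> ennreal C"
    if \<eta>: "0 < \<eta>" "\<eta> \<le> min 1 \<sigma>0" and t: "\<bar>t\<bar> \<le> B" for \<eta> t
  proof -
    define M where "M = normal_measure t \<eta>"
    define gr where "gr x = normal_density t \<eta> x / normal_density 0 \<sigma>0 x" for x
    define k where "k x = ln (\<sigma>0 / \<eta>) + x\<^sup>2 / (2 * \<sigma>0\<^sup>2)" for x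
    interpret M: prob_space M unfolding M_def using \<eta> by (intro prob_space_normal_measure)
    have [measurable_cong]: "sets M = sets borel" by (simp add: M_def)
    \<comment> \<open>The scale is capped by \<open>\<sigma>0\<close> for this reason:
      \<open>k\<close> has to be nonnegative.\<close>
    have "\<sigma>0 / \<eta> \<ge> 1" using \<sigma>0 \<eta> by (simp add: field_simps)
    then have l0: "ln (\<sigma>0 / \<eta>) \<ge> 0" by (rule ln_ge_zero)
    have pos: "normal_density 0 \<sigma>0 x > 0" for x using \<sigma>0 by (rule normal_density_pos)
    have nn: "gr x \<ge> 0" for x unfolding gr_def using pos[of x] by simp
    have gr[measurable]: "gr \<in> borel_measurable borel" and k[measurable]: "k \<in> borel_measurable borel"
      unfolding gr_def k_def by measurable
    have "M \<in> var_slabs S" using \<eta> Normal_Slab by (auto simp: M_def)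
    moreover have "M = density (prior_slab S) (\<lambda>x. ennreal (gr x))"
    proof -
      have "density (prior_slab S) (\<lambda>x. ennreal (gr x)) =
          density lborel (\<lambda>x. ennreal (normal_density 0 \<sigma>0 x) * ennreal (gr x))"
        using Normal_Slab by (simp add: normal_measure_def density_density_eq)
      also have "\<dots> = density lborel (\<lambda>x. ennreal (normal_density t \<eta> x))"
        using pos nn by (intro density_cong) (auto simp: gr_def ennreal_mult[symmetric] less_imp_neq[symmetric])
      finally show ?thesis by (simp add: M_def normal_measure_def)
    qed
    moreover have "0 \<le> k x \<and> ennreal (gr x) \<le> ennreal (exp (k x))" for x
    proof
      show "0 \<le> k x" using l0 by (simp add: k_def)
      have "gr x = (\<sigma>0 / \<eta>) * exp (x\<^sup>2 / (2 * \<sigma>0\<^sup>2) - (x - t)\<^sup>2 / (2 * \<eta>\<^sup>2))"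
      proof -
        have nd: "normal_density \<mu> s x = exp (- ((x - \<mu>)\<^sup>2 / (2 * s\<^sup>2))) / (sqrt (2 * pi) * s)" if "s > 0" for \<mu> s
          using that by (simp add: normal_density_def real_sqrt_mult)
        have "0 < sqrt (2 * pi)" by simp
        moreover define a b c where "a = x\<^sup>2 / (2 * \<sigma>0\<^sup>2)" and "b = (x - t)\<^sup>2 / (2 * \<eta>\<^sup>2)" and "c = sqrt (2 * pi)"
        ultimately have "c > 0" by simp
        have "gr x = (exp (- b) / (c * \<eta>)) / (exp (- a) / (c * \<sigma>0))"
          using nd[of \<eta> t] nd[of \<sigma>0 0] \<sigma>0 \<eta> by (simp add: gr_def a_def b_def c_def)
        also have "\<dots> = (\<sigma>0 / \<eta>) * exp (a - b)"
          using \<open>c > 0\<close> \<sigma>0 \<eta> by (simp add: exp_diff exp_minus field_simps)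
        finally show ?thesis by (simp add: a_def b_def)
      qed
      also have "\<dots> \<le> (\<sigma>0 / \<eta>) * exp (x\<^sup>2 / (2 * \<sigma>0\<^sup>2))"
        using \<sigma>0 \<eta> by (intro mult_left_mono) auto
      also have "\<dots> = exp (k x)" using \<sigma>0 \<eta> by (simp add: k_def exp_add)
      finally show "ennreal (gr x) \<le> ennreal (exp (k x))" by (rule ennreal_leI)
    qed
    moreover have e: "(\<integral>\<^sup>+x. ennreal (exp (4 * \<bar>x - t\<bar> / \<eta>)) \<partial>M) \<le> ennreal K"
      using nn_integral_exp_abs_normal_measure[of \<eta> "4 / \<eta>" t] \<eta> by (simp add: M_def K_def power_divide)
    moreover have "(\<integral>\<^sup>+x. ennreal (k x) \<partial>M) \<le> ennreal (ln (1 / \<eta>) + C)"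
    proof -
      \<comment> \<open>The quadratic part of \<open>k\<close> is charged to the exponential moment
        bounded just before, through
        \<open>(x - t)\<^sup>2 \<le> exp (4 * \<bar>x - t\<bar> / \<eta>)\<close> for
        \<open>\<eta> \<le> 1\<close>.\<close>
      have kle: "k x \<le> (ln (\<sigma>0 / \<eta>) + B\<^sup>2 / \<sigma>0\<^sup>2) + exp (4 * \<bar>x - t\<bar> / \<eta>) / \<sigma>0\<^sup>2" for x
      proof -
        have "x\<^sup>2 \<le> 2 * t\<^sup>2 + 2 * (x - t)\<^sup>2"
          using sum_squares_bound[of t "x - t"] by (simp add: power2_eq_square algebra_simps)
        moreover have "t\<^sup>2 \<le> B\<^sup>2" using t B by (intro abs_le_square_iff[THEN iffD1]) auto
        moreover have "(x - t)\<^sup>2 \<le> exp (4 * \<bar>x - t\<bar> / \<eta>)"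
        proof -
          have "\<bar>x - t\<bar> * \<eta> \<le> \<bar>x - t\<bar> * 1" using \<eta> by (intro mult_left_mono) auto
          then have "4 * \<bar>x - t\<bar> \<le> 4 * \<bar>x - t\<bar> / \<eta>" using \<eta> by (simp add: field_simps)
          then show ?thesis using power2_le_exp_abs[of "x - t"] by (meson exp_le_cancel_iff order_trans)
        qed
        ultimately have "x\<^sup>2 / 2 \<le> B\<^sup>2 + exp (4 * \<bar>x - t\<bar> / \<eta>)" by linarith
        then have "x\<^sup>2 / 2 / \<sigma>0\<^sup>2 \<le> (B\<^sup>2 + exp (4 * \<bar>x - t\<bar> / \<eta>)) / \<sigma>0\<^sup>2"
          by (intro divide_right_mono) auto
        then show ?thesis unfolding k_def by (simp add: add_divide_distrib mult.commute)
      qed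
      have "(\<integral>\<^sup>+x. ennreal (k x) \<partial>M) \<le>
        (\<integral>\<^sup>+x. ennreal (ln (\<sigma>0 / \<eta>) + B\<^sup>2 / \<sigma>0\<^sup>2) + ennreal (1 / \<sigma>0\<^sup>2) * ennreal (exp (4 * \<bar>x - t\<bar> / \<eta>)) \<partial>M)"
        using kle l0 by (intro nn_integral_mono)
          (auto simp: ennreal_mult[symmetric] ennreal_plus[symmetric] simp del: ennreal_plus intro!: ennreal_leI)
      also have "\<dots> = ennreal (ln (\<sigma>0 / \<eta>) + B\<^sup>2 / \<sigma>0\<^sup>2) +
          ennreal (1 / \<sigma>0\<^sup>2) * (\<integral>\<^sup>+x. ennreal (exp (4 * \<bar>x - t\<bar> / \<eta>)) \<partial>M)"
        by (simp add: nn_integral_add nn_integral_cmult M.emeasure_space_1)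
      also have "\<dots> \<le> ennreal (ln (\<sigma>0 / \<eta>) + B\<^sup>2 / \<sigma>0\<^sup>2) + ennreal (1 / \<sigma>0\<^sup>2) * ennreal K"
        by (intro add_left_mono mult_left_mono e) auto
      also have "\<dots> = ennreal (ln (\<sigma>0 / \<eta>) + B\<^sup>2 / \<sigma>0\<^sup>2 + K / \<sigma>0\<^sup>2)"
        using l0 \<open>K \<ge> 1\<close> by (simp add: ennreal_mult[symmetric] ennreal_plus[symmetric] del: ennreal_plus)
      also have "\<dots> \<le> ennreal (ln (1 / \<eta>) + C)"
        using \<sigma>0 \<eta> \<open>K \<ge> 1\<close> by (intro ennreal_leI) (simp add: C_def ln_div add_divide_distrib)
      finally show ?thesis .
    qed
    moreover have "ennreal K \<le> ennreal C" using CK by (rule ennreal_leI)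
    ultimately show ?thesis
      by (intro bexI[of _ M] exI[of _ "\<lambda>x. ennreal (gr x)"] exI[of _ k]) (auto intro: order_trans)
  qed
  ultimately show ?thesis using that[of C "min 1 \<sigma>0"] \<sigma>0 by auto
qed

section \<open>Likelihood ratios in the regression model\<close>

lemma sets_unif_cube[measurable_cong]: "sets (unif_cube p) = sets (\<Pi>\<^sub>M i\<in>{..<p}. borel)"
  unfolding unif_cube_def by (simp cong: sets_PiM_cong)

lemma cube_sets[measurable]: "cube p \<in> sets (\<Pi>\<^sub>M i\<in>{..<p}. borel)"
  unfolding cube_def by (rule sets_PiM_I_finite) auto

lemma cube_sets_lborel[measurable]: "cube p \<in> sets (\<Pi>\<^sub>M i\<in>{..<p}. lborel)"
  unfolding cube_def by (rule sets_PiM_I_finite) auto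

lemma emeasure_cube: "emeasure (\<Pi>\<^sub>M i\<in>{..<p}. lborel) (cube p) = ennreal (2 ^ p)"
proof -
  interpret product_sigma_finite "\<lambda>_::nat. lborel :: real measure" by standard
  show ?thesis unfolding cube_def
    by (subst emeasure_PiM) (auto simp: ennreal_power[symmetric])
qed

lemma prob_space_unif_cube: "prob_space (unif_cube p)"
  unfolding unif_cube_def
  by (rule prob_space_uniform_measure) (auto simp: emeasure_cube)

lemma AE_unif_cube: "AE x in unif_cube p. x \<in> cube p"
  unfolding unif_cube_def by (rule AE_uniform_measureI) auto

abbreviation obs_space :: "nat \<Rightarrow> obs measure" where
  "obs_space p \<equiv> (\<Pi>\<^sub>M i\<in>{..<p}. borel) \<Otimes>\<^sub>M borel"

lemma sets_obs_measure[simp, measurable_cong]: "sets (obs_measure p \<sigma> f) = sets (obs_space p)"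
  by (simp add: obs_measure_def)

lemma space_obs_measure[simp]: "space (obs_measure p \<sigma> f) = space (obs_space p)"
  by (simp add: obs_measure_def)

lemma sets_data_measure[measurable_cong]:
  "sets (data_measure p \<sigma> f n) = sets (\<Pi>\<^sub>M i\<in>{..<n}. obs_space p)"
  unfolding data_measure_def by (intro sets_PiM_cong) auto

locale regression =
  fixes p :: nat and \<sigma> :: real and f0 :: "(nat \<Rightarrow> real) \<Rightarrow> real"
  assumes \<sigma>: "\<sigma> > 0" and f0[measurable]: "f0 \<in> borel_measurable (\<Pi>\<^sub>M i\<in>{..<p}. borel)"
begin

abbreviation obs0 :: "obs measure" where
  "obs0 \<equiv> obs_measure p \<sigma> f0"

abbreviation data0 :: "nat \<Rightarrow> (nat \<Rightarrow> obs) measure" where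
  "data0 \<equiv> data_measure p \<sigma> f0"

lemma observe_measurable:
  "(\<lambda>(x, e). (x, f0 x + e)) \<in> measurable (unif_cube p \<Otimes>\<^sub>M normal_measure 0 \<sigma>) (obs_space p)"
  by measurable

lemma prob_space_obs: "prob_space obs0"
proof -
  interpret U: prob_space "unif_cube p" by (rule prob_space_unif_cube)
  interpret N: prob_space "normal_measure 0 \<sigma>" by (rule prob_space_normal_measure[OF \<sigma>])
  interpret pair_prob_space "unif_cube p" "normal_measure 0 \<sigma>" ..
  show ?thesis unfolding obs_measure_def by (rule prob_space_distr[OF observe_measurable])
qed

lemma prob_space_data: "prob_space (data0 n)"
  unfolding data_measure_def by (intro prob_space_PiM prob_space_obs)

lemma nn_integral_obs:
  assumes [measurable]: "u \<in> borel_measurable (obs_space p)"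
  shows "(\<integral>\<^sup>+d. u d \<partial>obs0) = (\<integral>\<^sup>+x. \<integral>\<^sup>+e. u (x, f0 x + e) \<partial>normal_measure 0 \<sigma> \<partial>unif_cube p)"
proof -
  interpret N: prob_space "normal_measure 0 \<sigma>" by (rule prob_space_normal_measure[OF \<sigma>])
  show ?thesis unfolding obs_measure_def
    by (subst nn_integral_distr[OF observe_measurable], measurable, subst N.nn_integral_fst[symmetric]) 
      (auto simp: case_prod_beta')
qed

lemma AE_obs_cube: "AE d in obs0. fst d \<in> cube p"
proof -
  interpret N: prob_space "normal_measure 0 \<sigma>" by (rule prob_space_normal_measure[OF \<sigma>])
  define v :: "obs \<Rightarrow> ennreal" where "v d = 1 - indicator (cube p) (fst d)" for d
  have v[measurable]: "v \<in> borel_measurable (obs_space p)" unfolding v_def[abs_def] by measurable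
  have "(\<integral>\<^sup>+d. v d \<partial>obs0) = (\<integral>\<^sup>+x. \<integral>\<^sup>+e. v (x, f0 x + e) \<partial>normal_measure 0 \<sigma> \<partial>unif_cube p)"
    by (rule nn_integral_obs[OF v])
  also have "\<dots> = (\<integral>\<^sup>+x. 0 \<partial>unif_cube p)"
  proof (intro nn_integral_cong_AE)
    show "AE x in unif_cube p. (\<integral>\<^sup>+e. v (x, f0 x + e) \<partial>normal_measure 0 \<sigma>) = 0"
      using AE_unif_cube[of p] by eventually_elim (simp add: v_def)
  qed
  finally have "(\<integral>\<^sup>+d. v d \<partial>obs0) = 0" by simp
  then have "AE d in obs0. v d = 0"
    by (subst (asm) nn_integral_0_iff_AE) auto
  then show ?thesis
  proof eventually_elim
    case (elim d)
    then show ?case by (cases "fst d \<in> cube p") (auto simp: v_def)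
  qed
qed

lemma nn_integral_prod_data:
  assumes "u \<in> borel_measurable (obs_space p)"
  shows "(\<integral>\<^sup>+D. (\<Prod>i<n. u (D i)) \<partial>data0 n) = (\<integral>\<^sup>+d. u d \<partial>obs0) ^ n"
proof -
  interpret O: prob_space obs0 by (rule prob_space_obs)
  interpret product_sigma_finite "\<lambda>_::nat. obs0" by standard
  show ?thesis unfolding data_measure_def
    using assms by (subst product_nn_integral_prod) (auto cong: measurable_cong_sets)
qed

lemma AE_data_cube: "AE D in data0 n. \<forall>i<n. fst (D i) \<in> cube p"
proof -
  have "AE D in data0 n. fst (D i) \<in> cube p" if "i < n" for i
    unfolding data_measure_def using that AE_obs_cube
    by (intro AE_PiM_component prob_space_obs) auto
  then have "AE D in data0 n. \<forall>i\<in>{..<n}. fst (D i) \<in> cube p"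
    by (intro AE_finite_allI) auto
  then show ?thesis by (auto elim!: eventually_mono)
qed

definition llr :: "((nat \<Rightarrow> real) \<Rightarrow> real) \<Rightarrow> nat \<Rightarrow> (nat \<Rightarrow> obs) \<Rightarrow> real" where
  "llr f n D = (\<Sum>i<n. ((snd (D i) - f0 (fst (D i)))\<^sup>2 - (snd (D i) - f (fst (D i)))\<^sup>2) / (2 * \<sigma>\<^sup>2))"

lemma likelihood_pos: "likelihood \<sigma> f n D > 0"
  using \<sigma> unfolding likelihood_def obs_density_def by (intro prod_pos divide_pos_pos ballI normal_density_pos) auto

lemma likelihood_eq_llr: "likelihood \<sigma> f n D = likelihood \<sigma> f0 n D * exp (llr f n D)"
proof -
  have "obs_density \<sigma> f d = obs_density \<sigma> f0 d *
      exp (((snd d - f0 (fst d))\<^sup>2 - (snd d - f (fst d))\<^sup>2) / (2 * \<sigma>\<^sup>2))" for d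
  proof -
    define a b s where "a = snd d - f (fst d)" and "b = snd d - f0 (fst d)" and "s = \<sigma>\<^sup>2"
    have "s > 0" using \<sigma> by (simp add: s_def)
    then have "- (a\<^sup>2 / s) / 2 = - (b\<^sup>2 / s) / 2 + (b\<^sup>2 - a\<^sup>2) / (2 * s)" by (simp add: diff_divide_distrib)
    then have "exp (- (a\<^sup>2 / s) / 2) = exp (- (b\<^sup>2 / s) / 2) * exp ((b\<^sup>2 - a\<^sup>2) / (2 * s))"
      by (simp only: exp_add)
    then show ?thesis
      unfolding obs_density_def std_normal_density_def power_divide a_def[symmetric] b_def[symmetric] s_def[symmetric]
      by simp
  qed
  then show ?thesis
    unfolding likelihood_def llr_def exp_sum[OF finite_lessThan] prod.distrib[symmetric]
    by (intro prod.cong refl)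
qed

lemma llr_measurable[measurable]:
  assumes [measurable]: "f \<in> borel_measurable (\<Pi>\<^sub>M i\<in>{..<p}. borel)"
  shows "llr f n \<in> borel_measurable (data0 n)"
  unfolding llr_def[abs_def] by measurable

text \<open>Given the design point, one summand of \<open>llr\<close> is \<open>h * e /
  \<sigma>\<^sup>2 - h\<^sup>2 / (2 * \<sigma>\<^sup>2)\<close> with \<open>h = f x - f0 x\<close>
  and normal noise \<open>e\<close>, so the normal moment generating function applies; independence
  gives the power \<open>n\<close>. The case \<open>t = 1\<close> is the mean of the likelihood
  ratio and \<open>t = 1/2\<close> the Hellinger affinity.\<close>

lemma nn_integral_exp_llr:
  assumes [measurable]: "f \<in> borel_measurable (\<Pi>\<^sub>M i\<in>{..<p}. borel)"
  shows "(\<integral>\<^sup>+D. ennreal (exp (t * llr f n D)) \<partial>data0 n) =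
    (\<integral>\<^sup>+x. ennreal (exp ((t\<^sup>2 - t) * (f x - f0 x)\<^sup>2 / (2 * \<sigma>\<^sup>2))) \<partial>unif_cube p) ^ n"
proof -
  define u where "u d = ennreal (exp (t * (((snd d - f0 (fst d))\<^sup>2 - (snd d - f (fst d))\<^sup>2) / (2 * \<sigma>\<^sup>2))))"
    for d :: obs
  have [measurable]: "u \<in> borel_measurable (obs_space p)" unfolding u_def by measurable
  have "(\<integral>\<^sup>+D. ennreal (exp (t * llr f n D)) \<partial>data0 n) = (\<integral>\<^sup>+D. (\<Prod>i<n. u (D i)) \<partial>data0 n)"
    by (simp add: u_def llr_def sum_distrib_left exp_sum prod_ennreal)
  also have "\<dots> = (\<integral>\<^sup>+d. u d \<partial>obs0) ^ n" by (rule nn_integral_prod_data) measurable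
  also have "(\<integral>\<^sup>+d. u d \<partial>obs0) = (\<integral>\<^sup>+x. \<integral>\<^sup>+e. u (x, f0 x + e) \<partial>normal_measure 0 \<sigma> \<partial>unif_cube p)"
    by (rule nn_integral_obs) measurable
  also have "\<dots> = (\<integral>\<^sup>+x. ennreal (exp ((t\<^sup>2 - t) * (f x - f0 x)\<^sup>2 / (2 * \<sigma>\<^sup>2))) \<partial>unif_cube p)"
  proof (intro nn_integral_cong)
    fix x
    define h where "h = f x - f0 x"
    have "u (x, f0 x + e) = ennreal (exp (- t * h\<^sup>2 / (2 * \<sigma>\<^sup>2))) * ennreal (exp ((t * h / \<sigma>\<^sup>2) * e))" for e
    proof -
      have "t * ((e\<^sup>2 - (e - h)\<^sup>2) / (2 * s)) = - t * h\<^sup>2 / (2 * s) + (t * h / s) * e" if "s > 0" for s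
        using that by (simp add: field_simps power2_eq_square)
      from this[of "\<sigma>\<^sup>2"]
      have "t * ((e\<^sup>2 - (e - h)\<^sup>2) / (2 * \<sigma>\<^sup>2)) = - t * h\<^sup>2 / (2 * \<sigma>\<^sup>2) + (t * h / \<sigma>\<^sup>2) * e"
        using \<sigma> by simp
      moreover have eq: "f0 x + e - f x = e - h" by (simp add: h_def)
      have "u (x, f0 x + e) = ennreal (exp (t * ((e\<^sup>2 - (e - h)\<^sup>2) / (2 * \<sigma>\<^sup>2))))"
        unfolding u_def fst_conv snd_conv eq by simp
      ultimately show ?thesis by (simp only: ennreal_mult[symmetric] exp_add exp_ge_zero)
    qed
    then have "(\<integral>\<^sup>+e. u (x, f0 x + e) \<partial>normal_measure 0 \<sigma>) =
        ennreal (exp (- t * h\<^sup>2 / (2 * \<sigma>\<^sup>2))) * ennreal (exp ((t * h / \<sigma>\<^sup>2) * 0 + \<sigma>\<^sup>2 * (t * h / \<sigma>\<^sup>2)\<^sup>2 / 2))"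
      by (simp only:) (subst nn_integral_cmult, simp, subst nn_integral_exp_normal_measure[OF \<sigma>], rule refl)
    also have "\<dots> = ennreal (exp ((t\<^sup>2 - t) * h\<^sup>2 / (2 * \<sigma>\<^sup>2)))"
    proof -
      have "- t * h\<^sup>2 / (2 * s) + ((t * h / s) * 0 + s * (t * h / s)\<^sup>2 / 2) = (t\<^sup>2 - t) * h\<^sup>2 / (2 * s)"
        if "s > 0" for s
        using that by (simp add: field_simps power2_eq_square)
      from this[of "\<sigma>\<^sup>2"]
      have "- t * h\<^sup>2 / (2 * \<sigma>\<^sup>2) + ((t * h / \<sigma>\<^sup>2) * 0 + \<sigma>\<^sup>2 * (t * h / \<sigma>\<^sup>2)\<^sup>2 / 2) = (t\<^sup>2 - t) * h\<^sup>2 / (2 * \<sigma>\<^sup>2)"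
        using \<sigma> by simp
      then show ?thesis by (simp only: ennreal_mult[symmetric] exp_ge_zero exp_add[symmetric])
    qed
    finally show "(\<integral>\<^sup>+e. u (x, f0 x + e) \<partial>normal_measure 0 \<sigma>) =
        ennreal (exp ((t\<^sup>2 - t) * (f x - f0 x)\<^sup>2 / (2 * \<sigma>\<^sup>2)))" by (simp add: h_def)
  qed
  finally show ?thesis .
qed

lemma nn_integral_exp_llr_1:
  assumes "f \<in> borel_measurable (\<Pi>\<^sub>M i\<in>{..<p}. borel)"
  shows "(\<integral>\<^sup>+D. ennreal (exp (llr f n D)) \<partial>data0 n) = 1"
proof -
  interpret prob_space "unif_cube p" by (rule prob_space_unif_cube)
  show ?thesis using nn_integral_exp_llr[OF assms, where t=1 and n=n] by (simp add: emeasure_space_1)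
qed

abbreviation hell :: "((nat \<Rightarrow> real) \<Rightarrow> real) \<Rightarrow> real" where
  "hell f \<equiv> hellinger_sq p \<sigma> f f0"

lemma hellinger_integrable:
  assumes [measurable]: "f \<in> borel_measurable (\<Pi>\<^sub>M i\<in>{..<p}. borel)"
  shows "integrable (unif_cube p) (\<lambda>x. exp (- ((f x - f0 x)\<^sup>2 / (8 * \<sigma>\<^sup>2))))"
proof -
  interpret prob_space "unif_cube p" by (rule prob_space_unif_cube)
  show ?thesis
  proof (rule integrable_const_bound[of _ 1])
    show "AE x in unif_cube p. norm (exp (- ((f x - f0 x)\<^sup>2 / (8 * \<sigma>\<^sup>2)))) \<le> 1" by simp
  qed measurable
qed

lemma hell_eq:
  assumes "f \<in> borel_measurable (\<Pi>\<^sub>M i\<in>{..<p}. borel)"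
  shows "hell f = 1 - (\<integral>x. exp (- ((f x - f0 x)\<^sup>2 / (8 * \<sigma>\<^sup>2))) \<partial>unif_cube p)"
proof -
  interpret prob_space "unif_cube p" by (rule prob_space_unif_cube)
  show ?thesis unfolding hellinger_sq_def using hellinger_integrable[OF assms]
    by (simp add: prob_space)
qed

lemma hell_nonneg: "hell f \<ge> 0"
  unfolding hellinger_sq_def by (rule Bochner_Integration.integral_nonneg) auto

lemma hell_le_1: "f \<in> borel_measurable (\<Pi>\<^sub>M i\<in>{..<p}. borel) \<Longrightarrow> hell f \<le> 1"
  by (simp add: hell_eq Bochner_Integration.integral_nonneg)

text \<open>At \<open>t = 1/2\<close> the factor \<open>(t\<^sup>2 - t) / 2\<close> equals
  \<open>-1/8\<close>, the constant in the definition of the Hellinger distance. One observation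
  thus contributes exactly \<open>1 - hell f\<close>, which is at most
  \<open>exp (- hell f)\<close>.\<close>

lemma nn_integral_exp_half_llr:
  assumes f: "f \<in> borel_measurable (\<Pi>\<^sub>M i\<in>{..<p}. borel)"
  shows "(\<integral>\<^sup>+D. ennreal (exp (llr f n D / 2)) \<partial>data0 n) \<le> ennreal (exp (- real n * hell f))"
proof -
  have q: "((1/2)\<^sup>2 - 1/2) * h / (2 * \<sigma>\<^sup>2) = - (h / (8 * \<sigma>\<^sup>2))" for h :: real
    by (simp add: power2_eq_square field_simps)
  have "(\<integral>\<^sup>+x. ennreal (exp (- ((f x - f0 x)\<^sup>2 / (8 * \<sigma>\<^sup>2)))) \<partial>unif_cube p) = ennreal (1 - hell f)"
    using hell_eq[OF f] hellinger_integrable[OF f] by (subst nn_integral_eq_integral) auto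
  also have "\<dots> \<le> ennreal (exp (- hell f))"
    using exp_ge_add_one_self[of "- hell f"] by (intro ennreal_leI) simp
  finally have "(\<integral>\<^sup>+x. ennreal (exp (- ((f x - f0 x)\<^sup>2 / (8 * \<sigma>\<^sup>2)))) \<partial>unif_cube p) ^ n \<le>
      ennreal (exp (- hell f)) ^ n" by (rule power_mono) simp
  then show ?thesis
    using nn_integral_exp_llr[OF f, where t="1/2" and n=n] unfolding q
    by (simp add: ennreal_power exp_of_nat_mult[symmetric])
qed

text \<open>Pointwise, \<open>a \<le> b + \<tau>\<close> with \<open>b \<ge> 0\<close> gives
  \<open>exp (- b) - exp (- a) \<le> \<tau>\<close>. This carries the Hellinger distance from a grid
  point to the networks that round to it.\<close>

lemma hell_le_add:
  assumes f: "f \<in> borel_measurable (\<Pi>\<^sub>M i\<in>{..<p}. borel)"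
    and g: "g \<in> borel_measurable (\<Pi>\<^sub>M i\<in>{..<p}. borel)"
    and le: "\<And>x. x \<in> cube p \<Longrightarrow> (f x - f0 x)\<^sup>2 \<le> (g x - f0 x)\<^sup>2 + 8 * \<sigma>\<^sup>2 * \<tau>" and \<tau>: "\<tau> \<ge> 0"
  shows "hell f \<le> hell g + \<tau>"
proof -
  interpret prob_space "unif_cube p" by (rule prob_space_unif_cube)
  have "(\<integral>x. exp (- ((g x - f0 x)\<^sup>2 / (8 * \<sigma>\<^sup>2))) - \<tau> \<partial>unif_cube p) \<le>
      (\<integral>x. exp (- ((f x - f0 x)\<^sup>2 / (8 * \<sigma>\<^sup>2))) \<partial>unif_cube p)"
  proof (rule integral_mono_AE)
    show "AE x in unif_cube p. exp (- ((g x - f0 x)\<^sup>2 / (8 * \<sigma>\<^sup>2))) - \<tau> \<le> exp (- ((f x - f0 x)\<^sup>2 / (8 * \<sigma>\<^sup>2)))"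
      using AE_unif_cube
    proof eventually_elim
      case (elim x)
      define a where "a = (f x - f0 x)\<^sup>2 / (8 * \<sigma>\<^sup>2)"
      define b where "b = (g x - f0 x)\<^sup>2 / (8 * \<sigma>\<^sup>2)"
      have "a \<le> b + \<tau>" using le[OF elim] \<sigma> by (simp add: a_def b_def field_simps)
      then have "exp (- b) * exp (- \<tau>) \<le> exp (- a)" by (simp add: mult_exp_exp)
      moreover have "exp (- b) * (1 - \<tau>) \<le> exp (- b) * exp (- \<tau>)"
        using exp_ge_add_one_self[of "- \<tau>"] by (intro mult_left_mono) auto
      moreover have "exp (- b) * \<tau> \<le> 1 * \<tau>" using \<tau> by (intro mult_right_mono) (auto simp: b_def)
      ultimately have "exp (- b) - \<tau> \<le> exp (- a)" by (simp add: algebra_simps)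
      then show ?case by (simp add: a_def b_def)
    qed
  qed (use hellinger_integrable[OF f] hellinger_integrable[OF g] in auto)
  then show ?thesis using hellinger_integrable[OF g] by (simp add: hell_eq f g prob_space)
qed


lemma nn_integral_square_normal_measure: "(\<integral>\<^sup>+e. ennreal (e\<^sup>2) \<partial>normal_measure 0 \<sigma>) = ennreal (\<sigma>\<^sup>2)"
proof -
  have "has_bochner_integral lborel (\<lambda>x. normal_density 0 \<sigma> x * (x - 0) ^ (2 * 1)) (\<sigma>\<^sup>2)"
    using normal_moment_even[OF \<sigma>, of 0 1] by (simp add: power2_eq_square)
  then have hb: "has_bochner_integral lborel (\<lambda>x. normal_density 0 \<sigma> x * x\<^sup>2) (\<sigma>\<^sup>2)" by simp
  have "(\<integral>\<^sup>+e. ennreal (e\<^sup>2) \<partial>normal_measure 0 \<sigma>) = (\<integral>\<^sup>+e. ennreal (normal_density 0 \<sigma> e * e\<^sup>2) \<partial>lborel)"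
    by (subst nn_integral_normal_measure) (auto simp: ennreal_mult)
  also have "\<dots> = ennreal (\<sigma>\<^sup>2)"
    using hb by (subst nn_integral_eq_integral) (auto simp: has_bochner_integral_iff)
  finally show ?thesis .
qed

lemma integral_normal_measure_0: "(\<integral>e. e \<partial>normal_measure 0 \<sigma>) = 0"
  using integral_normal_moment_nz_1[OF \<sigma>, of 0]
  by (simp add: normal_measure_def integral_real_density)

text \<open>The noise is centred given the design and independent across observations, so the mixed
  terms vanish and the mean square grows only linearly in \<open>n\<close>.\<close>

lemma noise_second_moment:
  assumes [measurable]: "h \<in> borel_measurable (\<Pi>\<^sub>M i\<in>{..<p}. borel)"
    and H: "\<And>x. x \<in> cube p \<Longrightarrow> (h x)\<^sup>2 \<le> H"
  shows "(\<integral>\<^sup>+D. ennreal ((\<Sum>i<n. (snd (D i) - f0 (fst (D i))) * h (fst (D i)))\<^sup>2) \<partial>data0 n)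
    \<le> ennreal (real n * (\<sigma>\<^sup>2 * H))"
proof -
  interpret U: prob_space "unif_cube p" by (rule prob_space_unif_cube)
  interpret N: prob_space "normal_measure 0 \<sigma>" by (rule prob_space_normal_measure[OF \<sigma>])
  interpret UN: pair_prob_space "unif_cube p" "normal_measure 0 \<sigma>" ..
  interpret O: prob_space obs0 by (rule prob_space_obs)
  interpret PO: product_sigma_finite "\<lambda>_::nat. obs0" by standard
  \<comment> \<open>The bound \<open>H\<close> is constrained only through points of the cube; the
    origin is one of them for every \<open>p\<close>.\<close>
  have H0: "H \<ge> 0"
  proof -
    have "(\<lambda>i\<in>{..<p}. 0) \<in> cube p" by (auto simp: cube_def)
    from H[OF this] show ?thesis by (meson order_trans zero_le_power2)
  qed
  define F where "F d = (snd d - f0 (fst d)) * h (fst d)" for d :: obs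
  have F[measurable]: "F \<in> borel_measurable (obs_space p)" unfolding F_def[abs_def] by measurable
  have "(\<integral>\<^sup>+d. ennreal ((F d)\<^sup>2) \<partial>obs0) =
      (\<integral>\<^sup>+x. \<integral>\<^sup>+e. ennreal ((F (x, f0 x + e))\<^sup>2) \<partial>normal_measure 0 \<sigma> \<partial>unif_cube p)"
    by (rule nn_integral_obs) measurable
  also have "\<dots> = (\<integral>\<^sup>+x. ennreal ((h x)\<^sup>2) * ennreal (\<sigma>\<^sup>2) \<partial>unif_cube p)"
  proof (intro nn_integral_cong)
    fix x
    have "(\<integral>\<^sup>+e. ennreal ((F (x, f0 x + e))\<^sup>2) \<partial>normal_measure 0 \<sigma>) =
        (\<integral>\<^sup>+e. ennreal ((h x)\<^sup>2) * ennreal (e\<^sup>2) \<partial>normal_measure 0 \<sigma>)"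
      by (intro nn_integral_cong) (simp add: F_def power_mult_distrib ennreal_mult mult.commute)
    also have "\<dots> = ennreal ((h x)\<^sup>2) * ennreal (\<sigma>\<^sup>2)"
      by (subst nn_integral_cmult) (auto simp: nn_integral_square_normal_measure)
    finally show "(\<integral>\<^sup>+e. ennreal ((F (x, f0 x + e))\<^sup>2) \<partial>normal_measure 0 \<sigma>) =
        ennreal ((h x)\<^sup>2) * ennreal (\<sigma>\<^sup>2)" .
  qed
  also have "\<dots> \<le> (\<integral>\<^sup>+x. ennreal (\<sigma>\<^sup>2 * H) \<partial>unif_cube p)"
  proof (intro nn_integral_mono_AE)
    show "AE x in unif_cube p. ennreal ((h x)\<^sup>2) * ennreal (\<sigma>\<^sup>2) \<le> ennreal (\<sigma>\<^sup>2 * H)"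
      using AE_unif_cube[of p]
    proof eventually_elim
      case (elim x)
      then have "(h x)\<^sup>2 * \<sigma>\<^sup>2 \<le> H * \<sigma>\<^sup>2" by (intro mult_right_mono H) auto
      then show ?case by (subst ennreal_mult[symmetric]) (auto intro!: ennreal_leI simp: mult.commute)
    qed
  qed
  also have "\<dots> = ennreal (\<sigma>\<^sup>2 * H)" by (simp add: U.emeasure_space_1)
  finally have F2: "(\<integral>\<^sup>+d. ennreal ((F d)\<^sup>2) \<partial>obs0) \<le> ennreal (\<sigma>\<^sup>2 * H)" .
  have iF2: "integrable obs0 (\<lambda>d. (F d)\<^sup>2)"
    using F2 by (intro integrableI_nonneg) (auto intro: le_less_trans)
  have IF2: "(\<integral>d. (F d)\<^sup>2 \<partial>obs0) \<le> \<sigma>\<^sup>2 * H"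
    using F2 iF2 H0 by (subst (asm) nn_integral_eq_integral) auto
  have iF: "integrable obs0 F"
    by (rule O.square_integrable_imp_integrable[OF _ iF2]) measurable
  \<comment> \<open>Integrating over the noise first gives zero at each design point. Fubini for
    real integrals requires integrability of \<open>F\<close>, which is why the second moment was
    settled before the mean.\<close>
  have "(\<integral>d. F d \<partial>obs0) = (\<integral>xe. fst (snd xe, ()) * h (fst xe) \<partial>(unif_cube p \<Otimes>\<^sub>M normal_measure 0 \<sigma>))"
    unfolding obs_measure_def by (subst integral_distr[OF observe_measurable]) (auto simp: F_def case_prod_beta)
  also have "\<dots> = (\<integral>xe. snd xe * h (fst xe) \<partial>(unif_cube p \<Otimes>\<^sub>M normal_measure 0 \<sigma>))" by simp
  also have "\<dots> = (\<integral>x. (\<integral>e. snd (x, e) * h (fst (x, e)) \<partial>normal_measure 0 \<sigma>) \<partial>unif_cube p)"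
  proof (rule UN.integral_fst'[symmetric])
    have "integrable (unif_cube p \<Otimes>\<^sub>M normal_measure 0 \<sigma>) (\<lambda>xe. F (case xe of (x, e) \<Rightarrow> (x, f0 x + e)))"
      using iF unfolding obs_measure_def by (subst (asm) integrable_distr_eq[OF observe_measurable]) auto
    then show "integrable (unif_cube p \<Otimes>\<^sub>M normal_measure 0 \<sigma>) (\<lambda>xe. snd xe * h (fst xe))"
      by (simp add: F_def case_prod_beta)
  qed
  also have "\<dots> = 0" by (simp add: integral_normal_measure_0)
  finally have F0: "(\<integral>d. F d \<partial>obs0) = 0" .
  \<comment> \<open>Pads the product of two factors to a product over all \<open>n\<close>
    observations, the form that integration over a product measure needs. The square occurs only on
    the diagonal \<open>i = j\<close>.\<close>
  define G where "G i j k = (if k = i then if k = j then (\<lambda>d. (F d)\<^sup>2) else F else if k = j then F else (\<lambda>_. 1))"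
    for i j k :: nat
  have G: "F (D i) * F (D j) = (\<Prod>k<n. G i j k (D k))" if "i < n" "j < n" for i j and D :: "nat \<Rightarrow> obs"
  proof -
    have "(\<Prod>k<n. G i j k (D k)) = (\<Prod>k<n. (if k = i then F (D k) else 1) * (if k = j then F (D k) else 1))"
      by (intro prod.cong) (auto simp: G_def power2_eq_square)
    also have "\<dots> = F (D i) * F (D j)" using that by (simp add: prod.distrib)
    finally show ?thesis ..
  qed
  have iG: "integrable obs0 (G i j k)" for i j k using iF iF2 by (auto simp: G_def)
  have iFF: "integrable (data0 n) (\<lambda>D. F (D i) * F (D j))" if "i < n" "j < n" for i j
    unfolding data_measure_def using that iG
    by (subst G[OF that], intro PO.product_integrable_prod) auto
  have IFF: "(\<integral>D. F (D i) * F (D j) \<partial>data0 n) = (if i = j then (\<integral>d. (F d)\<^sup>2 \<partial>obs0) else 0)"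
    if "i < n" "j < n" for i j
  proof -
    have "(\<integral>D. F (D i) * F (D j) \<partial>data0 n) = (\<Prod>k<n. (\<integral>d. G i j k d \<partial>obs0))"
      unfolding data_measure_def using that iG
      by (subst G[OF that], subst PO.product_integral_prod) auto
    also have "\<dots> = (\<Prod>k<n. if k = i then (if i = j then (\<integral>d. (F d)\<^sup>2 \<partial>obs0) else 0) else
        if k = j then 0 else 1)"
      by (intro prod.cong) (auto simp: G_def F0 O.prob_space[simplified])
    also have "\<dots> = (if i = j then (\<integral>d. (F d)\<^sup>2 \<partial>obs0) else 0)"
    proof (cases "i = j")
      case True
      then have "(\<Prod>k<n. if k = i then (if i = j then (\<integral>d. (F d)\<^sup>2 \<partial>obs0) else 0) else if k = j then 0 else 1) =
          (\<Prod>k<n. if k = i then (\<integral>d. (F d)\<^sup>2 \<partial>obs0) else 1)"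
        by (intro prod.cong) auto
      then show ?thesis using True that by simp
    qed (use that in \<open>auto intro!: prod_zero\<close>)
    finally show ?thesis .
  qed
  have sq: "(\<Sum>i<n. F (D i))\<^sup>2 = (\<Sum>i<n. \<Sum>j<n. F (D i) * F (D j))" for D :: "nat \<Rightarrow> obs"
    by (simp add: power2_eq_square sum_product)
  have i2: "integrable (data0 n) (\<lambda>D. (\<Sum>i<n. F (D i))\<^sup>2)"
    unfolding sq by (intro Bochner_Integration.integrable_sum iFF) auto
  have "(\<integral>D. (\<Sum>i<n. F (D i))\<^sup>2 \<partial>data0 n) = (\<Sum>i<n. \<Sum>j<n. (\<integral>D. F (D i) * F (D j) \<partial>data0 n))"
    unfolding sq by (subst Bochner_Integration.integral_sum; (intro Bochner_Integration.integrable_sum iFF)?)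
      (auto intro!: sum.cong Bochner_Integration.integral_sum iFF)
  also have "\<dots> = real n * (\<integral>d. (F d)\<^sup>2 \<partial>obs0)" by (simp add: IFF sum.delta)
  also have "\<dots> \<le> real n * (\<sigma>\<^sup>2 * H)" by (intro mult_left_mono IF2) auto
  finally have "(\<integral>D. (\<Sum>i<n. F (D i))\<^sup>2 \<partial>data0 n) \<le> real n * (\<sigma>\<^sup>2 * H)" .
  then show ?thesis
    using i2 by (subst nn_integral_eq_integral) (auto simp: F_def intro!: ennreal_leI)
qed

end

section \<open>Perturbation of networks\<close>

definition layer :: "(nat \<Rightarrow> nat) \<Rightarrow> nat \<Rightarrow> coord set" where
  "layer w l = (\<lambda>(i, j). Weight l i j) ` ({..<w l} \<times> {..<w (l - 1)}) \<union> Bias l ` {..<w l}"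

lemma finite_layer[simp]: "finite (layer w l)"
  by (simp add: layer_def)

lemma coords_eq_layers: "coords L w = (\<Union>l\<in>{1..L}. layer w l)"
  by (fastforce simp: coords_def layer_def)

lemma finite_coords[simp]: "finite (coords L w)"
  by (simp add: coords_eq_layers)

lemma layer_disjoint: "l \<noteq> l' \<Longrightarrow> layer w l \<inter> layer w l' = {}"
  by (auto simp: layer_def)

lemma card_layer: "card (layer w l) = w l * w (l - 1) + w l"
proof -
  have "card (layer w l) = card ((\<lambda>(i, j). Weight l i j) ` ({..<w l} \<times> {..<w (l - 1)})) + card (Bias l ` {..<w l})"
    unfolding layer_def by (rule card_Un_disjoint) auto
  also have "\<dots> = w l * w (l - 1) + w l"
    by (simp add: card_image inj_on_def card_cartesian_product)
  finally show ?thesis .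
qed

lemma sum_layer: "(\<Sum>c\<in>layer w l. g c) =
    (\<Sum>i<w l. \<Sum>j<w (l - 1). g (Weight l i j)) + (\<Sum>i<w l. g (Bias l i))"
proof -
  have "(\<Sum>c\<in>layer w l. g c) =
      (\<Sum>c\<in>(\<lambda>(i, j). Weight l i j) ` ({..<w l} \<times> {..<w (l - 1)}). g c) + (\<Sum>c\<in>Bias l ` {..<w l}. g c)"
    unfolding layer_def by (rule sum.union_disjoint) auto
  also have "\<dots> = (\<Sum>i<w l. \<Sum>j<w (l - 1). g (Weight l i j)) + (\<Sum>i<w l. g (Bias l i))"
    by (subst (1 2) sum.reindex) (auto simp: inj_on_def sum.cartesian_product case_prod_beta')
  finally show ?thesis .
qed

lemma sum_coords: "(\<Sum>c\<in>coords L w. g c) = (\<Sum>l=1..L. \<Sum>c\<in>layer w l. g c)"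
  unfolding coords_eq_layers by (subst sum.UNION_disjoint) (auto dest: layer_disjoint)

text \<open>Weights are measured by the sum over a whole layer instead of row by row. The loss is
  harmless, since these norms enter the rates only through logarithms.\<close>

lemma row_le_layer:
  fixes g :: "coord \<Rightarrow> real"
  assumes "\<And>c. g c \<ge> 0" "i < w l"
  shows "(\<Sum>j<w (l - 1). g (Weight l i j)) + g (Bias l i) \<le> (\<Sum>c\<in>layer w l. g c)"
proof -
  have "(\<Sum>j<w (l - 1). g (Weight l i j)) \<le> (\<Sum>i<w l. \<Sum>j<w (l - 1). g (Weight l i j))"
    using assms by (intro member_le_sum[of i "{..<w l}" "\<lambda>i. \<Sum>j<w (l - 1). g (Weight l i j)"]) (auto intro: sum_nonneg)
  moreover have "g (Bias l i) \<le> (\<Sum>i<w l. g (Bias l i))"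
    using assms by (intro member_le_sum[of i "{..<w l}" "\<lambda>i. g (Bias l i)"]) auto
  ultimately show ?thesis by (simp add: sum_layer)
qed

text \<open>One affine row applied to an input bounded by \<open>P\<close>, whose perturbation is at most \<open>P * U\<close>:
  the shape of both bounds survives the step, which is the induction through the layers.\<close>

lemma affine_row_bounds:
  fixes a b h h' :: "nat \<Rightarrow> real" and v u :: real
  assumes P: "P \<ge> 1" and h: "\<And>j. j < m \<Longrightarrow> \<bar>h j\<bar> \<le> P" and h': "\<And>j. j < m \<Longrightarrow> \<bar>h' j\<bar> \<le> P"
    and d: "\<And>j. j < m \<Longrightarrow> \<bar>h j - h' j\<bar> \<le> P * U" and U: "U \<ge> 0"
    and v: "1 + ((\<Sum>j<m. \<bar>a j\<bar>) + \<bar>a0\<bar>) \<le> v"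
    and u: "(\<Sum>j<m. \<bar>a j - b j\<bar>) + \<bar>a0 - b0\<bar> \<le> u"
  shows "\<bar>(\<Sum>j<m. a j * h j) + a0\<bar> \<le> v * P"
    and "\<bar>((\<Sum>j<m. a j * h j) + a0) - ((\<Sum>j<m. b j * h' j) + b0)\<bar> \<le> v * P * (U + u)"
proof -
  have 1: "\<bar>\<Sum>j<m. a j * h j\<bar> \<le> (\<Sum>j<m. \<bar>a j\<bar>) * P"
  proof -
    have "\<bar>\<Sum>j<m. a j * h j\<bar> \<le> (\<Sum>j<m. \<bar>a j * h j\<bar>)" by (rule sum_abs)
    also have "\<dots> \<le> (\<Sum>j<m. \<bar>a j\<bar> * P)"
      by (intro sum_mono) (auto simp: abs_mult intro!: mult_left_mono h)
    finally show ?thesis by (simp add: sum_distrib_right)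
  qed
  have 2: "\<bar>a0\<bar> \<le> \<bar>a0\<bar> * P" using P by (simp add: mult_left_mono[of 1 P "\<bar>a0\<bar>", simplified])
  have "\<bar>(\<Sum>j<m. a j * h j) + a0\<bar> \<le> ((\<Sum>j<m. \<bar>a j\<bar>) + \<bar>a0\<bar>) * P"
    using 1 2 by (simp add: distrib_right)
  also have "\<dots> \<le> v * P" using v P by (intro mult_right_mono) auto
  finally show "\<bar>(\<Sum>j<m. a j * h j) + a0\<bar> \<le> v * P" .
  have s0: "(\<Sum>j<m. \<bar>a j\<bar>) \<ge> 0" "(\<Sum>j<m. \<bar>a j - b j\<bar>) \<ge> 0" by (auto intro: sum_nonneg)
  have v1: "v \<ge> 1" "(\<Sum>j<m. \<bar>a j\<bar>) \<le> v" using v s0 by linarith+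
  have u0: "u \<ge> 0" using u s0 by linarith
  have "((\<Sum>j<m. a j * h j) + a0) - ((\<Sum>j<m. b j * h' j) + b0) =
      (\<Sum>j<m. a j * (h j - h' j)) + (\<Sum>j<m. (a j - b j) * h' j) + (a0 - b0)"
    by (simp add: algebra_simps sum.distrib sum_subtractf)
  moreover have "\<bar>\<Sum>j<m. a j * (h j - h' j)\<bar> \<le> (\<Sum>j<m. \<bar>a j\<bar>) * (P * U)"
  proof -
    have "\<bar>\<Sum>j<m. a j * (h j - h' j)\<bar> \<le> (\<Sum>j<m. \<bar>a j * (h j - h' j)\<bar>)" by (rule sum_abs)
    also have "\<dots> \<le> (\<Sum>j<m. \<bar>a j\<bar> * (P * U))"
      unfolding abs_mult by (intro sum_mono mult_left_mono d) auto
    finally show ?thesis by (simp add: sum_distrib_right)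
  qed
  moreover have "\<bar>\<Sum>j<m. (a j - b j) * h' j\<bar> \<le> (\<Sum>j<m. \<bar>a j - b j\<bar>) * P"
  proof -
    have "\<bar>\<Sum>j<m. (a j - b j) * h' j\<bar> \<le> (\<Sum>j<m. \<bar>(a j - b j) * h' j\<bar>)" by (rule sum_abs)
    also have "\<dots> \<le> (\<Sum>j<m. \<bar>a j - b j\<bar> * P)"
      unfolding abs_mult by (intro sum_mono mult_left_mono h') auto
    finally show ?thesis by (simp add: sum_distrib_right)
  qed
  moreover have "\<bar>a0 - b0\<bar> \<le> \<bar>a0 - b0\<bar> * P"
    using mult_left_mono[of 1 P "\<bar>a0 - b0\<bar>"] P by simp
  ultimately have "\<bar>((\<Sum>j<m. a j * h j) + a0) - ((\<Sum>j<m. b j * h' j) + b0)\<bar> \<le>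
      (\<Sum>j<m. \<bar>a j\<bar>) * (P * U) + ((\<Sum>j<m. \<bar>a j - b j\<bar>) + \<bar>a0 - b0\<bar>) * P"
    by (simp add: distrib_right)
  also have "\<dots> \<le> v * (P * U) + u * P"
    using v1 u P U by (intro add_mono mult_right_mono) auto
  also have "u * P \<le> v * (u * P)"
    using mult_right_mono[of 1 v "u * P"] v1 u0 P by simp
  finally show "\<bar>((\<Sum>j<m. a j * h j) + a0) - ((\<Sum>j<m. b j * h' j) + b0)\<bar> \<le> v * P * (U + u)"
    by (simp add: algebra_simps)
qed

context
  fixes w :: "nat \<Rightarrow> nat" and \<theta> \<theta>' :: param and x :: "nat \<Rightarrow> real" and v u :: "nat \<Rightarrow> real"
  assumes x: "\<And>i. i < w 0 \<Longrightarrow> \<bar>x i\<bar> \<le> 1"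
    and v: "\<And>l. 1 + (\<Sum>c\<in>layer w l. \<bar>\<theta> c\<bar>) \<le> v l" "\<And>l. 1 + (\<Sum>c\<in>layer w l. \<bar>\<theta>' c\<bar>) \<le> v l"
    and u: "\<And>l. (\<Sum>c\<in>layer w l. \<bar>\<theta> c - \<theta>' c\<bar>) \<le> u l"
begin

private lemma v1: "1 \<le> v l"
  using v(1)[of l] by (rule order_trans[rotated]) (auto intro: sum_nonneg)

private lemma u0: "0 \<le> u l"
  using u[of l] by (rule order_trans[rotated]) (auto intro: sum_nonneg)

text \<open>The activation fixes zero and is 1-Lipschitz, so a layer is controlled by its affine
  rows, and the two bounds on a row have the form that the induction reproduces.\<close>

lemma hidden_bounds:
  assumes "i < w l"
  shows "\<bar>hidden w \<theta> x l i\<bar> \<le> (\<Prod>k=1..l. v k)" (is ?A)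
    and "\<bar>hidden w \<theta>' x l i\<bar> \<le> (\<Prod>k=1..l. v k)" (is ?B)
    and "\<bar>hidden w \<theta> x l i - hidden w \<theta>' x l i\<bar> \<le> (\<Prod>k=1..l. v k) * (\<Sum>k=1..l. u k)" (is ?C)
proof -
  have "?A \<and> ?B \<and> ?C" using assms
  proof (induction l arbitrary: i)
    case 0
    then show ?case using x by simp
  next
    case (Suc l)
    let ?P = "\<Prod>k=1..l. v k" and ?U = "\<Sum>k=1..l. u k"
    have P1: "?P \<ge> 1" by (intro prod_ge_1) (auto simp: v1)
    have U0: "?U \<ge> 0" by (intro sum_nonneg) (auto simp: u0)
    have row: "1 + ((\<Sum>j<w l. \<bar>t (Weight (Suc l) i j)\<bar>) + \<bar>- t (Bias (Suc l) i)\<bar>) \<le> v (Suc l)"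
      if "1 + (\<Sum>c\<in>layer w (Suc l). \<bar>t c\<bar>) \<le> v (Suc l)" for t :: param
      using row_le_layer[of "\<lambda>c. \<bar>t c\<bar>" i w "Suc l"] Suc.prems that by simp
    have urow: "(\<Sum>j<w l. \<bar>\<theta> (Weight (Suc l) i j) - \<theta>' (Weight (Suc l) i j)\<bar>) +
        \<bar>(- \<theta> (Bias (Suc l) i)) - (- \<theta>' (Bias (Suc l) i))\<bar> \<le> u (Suc l)"
      using row_le_layer[of "\<lambda>c. \<bar>\<theta> c - \<theta>' c\<bar>" i w "Suc l"] Suc.prems u[of "Suc l"]
      by (simp add: abs_minus_commute)
    note IH = Suc.IH
    note b1 = affine_row_bounds[OF P1, of "w l" "hidden w \<theta> x l" "hidden w \<theta>' x l" ?U, OF _ _ _ U0 row[OF v(1)] urow]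
    \<comment> \<open>The size bound for \<open>\<theta>'\<close> comes from comparing
      \<open>\<theta>'\<close> with itself, so all differences are zero.\<close>
    note b2 = affine_row_bounds(1)[OF P1, of "w l" "hidden w \<theta>' x l" "hidden w \<theta>' x l" ?U
      "\<lambda>j. \<theta>' (Weight (Suc l) i j)" _ _ "\<lambda>j. \<theta>' (Weight (Suc l) i j)" _ 0, OF _ _ _ U0 row[OF v(2)]]
    have relu: "\<bar>max 0 a\<bar> \<le> \<bar>a\<bar>" "\<bar>max 0 a - max 0 b\<bar> \<le> \<bar>a - b\<bar>" for a b :: real by auto
    have 1: "\<bar>hidden w \<theta> x (Suc l) i\<bar> \<le> v (Suc l) * ?P"
      using b1(1) IH relu(1) by (fastforce intro: order_trans)
    have 2: "\<bar>hidden w \<theta>' x (Suc l) i\<bar> \<le> v (Suc l) * ?P"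
    proof -
      have "\<bar>(\<Sum>j<w l. \<theta>' (Weight (Suc l) i j) * hidden w \<theta>' x l j) + - \<theta>' (Bias (Suc l) i)\<bar> \<le> v (Suc l) * ?P"
        using IH P1 U0 by (intro b2) auto
      then show ?thesis using relu(1) by (fastforce intro: order_trans)
    qed
    have 3: "\<bar>hidden w \<theta> x (Suc l) i - hidden w \<theta>' x (Suc l) i\<bar> \<le> v (Suc l) * ?P * (?U + u (Suc l))"
      using b1(2) IH relu(2) by (fastforce intro: order_trans)
    from 1 2 3 show ?case by (simp add: mult.commute)
  qed
  then show ?A ?B ?C by auto
qed

text \<open>The output layer needs a step of its own: it has no activation, and its bias is added
  where the hidden layers subtract theirs.\<close>

lemma network_bounds:
  assumes L: "L \<ge> 1" and wL: "w L = 1"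
  shows "\<bar>network L w \<theta> x\<bar> \<le> (\<Prod>k=1..L. v k)"
    and "\<bar>network L w \<theta> x - network L w \<theta>' x\<bar> \<le> (\<Prod>k=1..L. v k) * (\<Sum>k=1..L. u k)"
proof -
  define l where "l = L - 1"
  have Ll: "L = Suc l" using L by (simp add: l_def)
  let ?P = "\<Prod>k=1..l. v k" and ?U = "\<Sum>k=1..l. u k"
  have P1: "?P \<ge> 1" by (intro prod_ge_1) (auto simp: v1)
  have U0: "?U \<ge> 0" by (intro sum_nonneg) (auto simp: u0)
  have row: "1 + ((\<Sum>j<w l. \<bar>\<theta> (Weight (Suc l) 0 j)\<bar>) + \<bar>\<theta> (Bias (Suc l) 0)\<bar>) \<le> v (Suc l)"
    using row_le_layer[of "\<lambda>c. \<bar>\<theta> c\<bar>" 0 w "Suc l"] wL Ll v(1)[of "Suc l"] by simp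
  have urow: "(\<Sum>j<w l. \<bar>\<theta> (Weight (Suc l) 0 j) - \<theta>' (Weight (Suc l) 0 j)\<bar>) +
      \<bar>\<theta> (Bias (Suc l) 0) - \<theta>' (Bias (Suc l) 0)\<bar> \<le> u (Suc l)"
    using row_le_layer[of "\<lambda>c. \<bar>\<theta> c - \<theta>' c\<bar>" 0 w "Suc l"] wL Ll u[of "Suc l"] by simp
  note b = affine_row_bounds[OF P1, of "w l" "hidden w \<theta> x l" "hidden w \<theta>' x l" ?U, OF _ _ _ U0 row urow]
  show "\<bar>network L w \<theta> x\<bar> \<le> (\<Prod>k=1..L. v k)"
    using b(1) hidden_bounds by (simp add: network_def Ll mult.commute)
  show "\<bar>network L w \<theta> x - network L w \<theta>' x\<bar> \<le> (\<Prod>k=1..L. v k) * (\<Sum>k=1..L. u k)"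
    using b(2) hidden_bounds by (simp add: network_def Ll mult.commute)
qed

end


text \<open>Number of weights and biases between two full hidden layers. Input and output layers are
  no wider than \<open>12 * p * N\<close>, so this dominates every layer and spares case
  distinctions.\<close>

definition layer_size :: "nat \<Rightarrow> nat \<Rightarrow> real" where
  "layer_size p N = 12 * real p * real N * (12 * real p * real N + 1)"

lemma layer_size_nonneg: "0 \<le> layer_size p N"
  by (simp add: layer_size_def)

lemma card_layer_widths:
  assumes "p \<ge> 1" "N \<ge> 1" "L \<ge> 1"
  shows "real (card (layer (widths p L N) l)) \<le> layer_size p N"
proof -
  have 1: "1 \<le> p * N" using assms by simp
  have "p * 1 \<le> p * N" using assms by (intro mult_le_mono) auto
  then have w: "widths p L N k \<le> 12 * p * N" for k
    using 1 unfolding widths_def by auto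
  have "card (layer (widths p L N) l) = widths p L N l * (widths p L N (l - 1) + 1)"
    by (simp add: card_layer)
  also have "\<dots> \<le> (12 * p * N) * (12 * p * N + 1)"
    using w by (intro mult_le_mono add_mono) auto
  finally have "real (card (layer (widths p L N) l)) \<le> real ((12 * p * N) * (12 * p * N + 1))"
    by (simp only: of_nat_le_iff)
  then show ?thesis by (simp add: layer_size_def algebra_simps)
qed

lemma card_coords_N:
  assumes "p \<ge> 1" "N \<ge> 1" "L \<ge> 1"
  shows "real (card (coords_N p L N)) \<le> real L * layer_size p N"
proof -
  have "card (coords_N p L N) \<le> (\<Sum>l\<in>{1..L}. card (layer (widths p L N) l))"
    unfolding coords_eq_layers by (rule card_UN_le) simp
  then have "real (card (coords_N p L N)) \<le> (\<Sum>l\<in>{1..L}. real (card (layer (widths p L N) l)))"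
    by (simp only: of_nat_sum[symmetric] of_nat_le_iff)
  also have "\<dots> \<le> (\<Sum>l\<in>{1..L}. layer_size p N)"
    using assms by (intro sum_mono card_layer_widths)
  finally show ?thesis by simp
qed

lemma cube_abs_le_1: "x \<in> cube p \<Longrightarrow> i < p \<Longrightarrow> \<bar>x i\<bar> \<le> 1"
  by (force simp: cube_def PiE_iff abs_le_iff)

lemma sum_layer_le:
  assumes "p \<ge> 1" "N \<ge> 1" "L \<ge> 1" and l: "l \<in> {1..L}" and B: "B \<ge> 0"
    and \<theta>: "\<And>c. c \<in> coords_N p L N \<Longrightarrow> \<bar>\<theta> c\<bar> \<le> B"
  shows "(\<Sum>c\<in>layer (widths p L N) l. \<bar>\<theta> c\<bar>) \<le> layer_size p N * B"
proof -
  have "(\<Sum>c\<in>layer (widths p L N) l. \<bar>\<theta> c\<bar>) \<le> (\<Sum>c\<in>layer (widths p L N) l. B)"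
    using l by (intro sum_mono \<theta>) (auto simp: coords_eq_layers)
  also have "\<dots> \<le> layer_size p N * B"
    using card_layer_widths[OF assms(1-3)] B by (simp add: mult_right_mono)
  finally show ?thesis .
qed

lemma net_abs_le:
  assumes N: "p \<ge> 1" "N \<ge> 1" "L \<ge> 1" and B: "B \<ge> 0"
    and \<theta>: "\<And>c. c \<in> coords_N p L N \<Longrightarrow> \<bar>\<theta> c\<bar> \<le> B" and x: "x \<in> cube p"
  shows "\<bar>net_N p L N \<theta> x\<bar> \<le> (1 + layer_size p N * B) ^ L"
proof -
  let ?w = "widths p L N"
  let ?v = "\<lambda>l. 1 + (\<Sum>c\<in>layer ?w l. \<bar>\<theta> c\<bar>)"
  have "\<bar>net_N p L N \<theta> x\<bar> \<le> (\<Prod>k=1..L. ?v k)"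
    using N cube_abs_le_1[OF x]
    by (intro network_bounds(1)[where \<theta>'=\<theta> and u="\<lambda>_. 0"]) (auto simp: widths_def)
  also have "\<dots> \<le> (\<Prod>k=1..L. 1 + layer_size p N * B)"
    using sum_layer_le[OF N _ B \<theta>] by (intro prod_mono) (auto intro!: add_nonneg_nonneg sum_nonneg)
  finally show ?thesis by simp
qed

text \<open>Only \<open>\<theta>\<close> is assumed bounded; \<open>\<theta>'\<close> may be a draw
  from normal slabs and arbitrarily far away. Its layer norms exceed those of
  \<open>\<theta>\<close> by at most the perturbation itself, which is where the factor
  \<open>exp U\<close> comes from.\<close>

lemma net_perturbation:
  assumes N: "p \<ge> 1" "N \<ge> 1" "L \<ge> 1" and B: "B \<ge> 0"
    and \<theta>: "\<And>c. c \<in> coords_N p L N \<Longrightarrow> \<bar>\<theta> c\<bar> \<le> B" and x: "x \<in> cube p"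
    and U: "(\<Sum>c\<in>coords_N p L N. \<bar>\<theta> c - \<theta>' c\<bar>) \<le> U"
  shows "\<bar>net_N p L N \<theta> x - net_N p L N \<theta>' x\<bar> \<le> (1 + layer_size p N * B) ^ L * (U * exp U)"
proof -
  let ?w = "widths p L N"
  define u where "u l = (\<Sum>c\<in>layer ?w l. \<bar>\<theta> c - \<theta>' c\<bar>)" for l
  define S where "S l = (\<Sum>c\<in>layer ?w l. \<bar>\<theta> c\<bar>)" for l
  have u0: "u l \<ge> 0" and S0: "S l \<ge> 0" for l by (auto simp: u_def S_def intro: sum_nonneg)
  have D0: "layer_size p N * B \<ge> 0" using B layer_size_nonneg by simp
  have "\<bar>net_N p L N \<theta> x - net_N p L N \<theta>' x\<bar> \<le> (\<Prod>k=1..L. 1 + S k + u k) * (\<Sum>k=1..L. u k)"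
  proof (rule network_bounds(2))
    fix l
    have "(\<Sum>c\<in>layer ?w l. \<bar>\<theta>' c\<bar>) \<le> (\<Sum>c\<in>layer ?w l. \<bar>\<theta> c\<bar> + \<bar>\<theta> c - \<theta>' c\<bar>)"
      by (intro sum_mono) auto
    then show "1 + (\<Sum>c\<in>layer ?w l. \<bar>\<theta>' c\<bar>) \<le> 1 + S l + u l"
      by (simp add: S_def u_def sum.distrib)
    show "1 + (\<Sum>c\<in>layer ?w l. \<bar>\<theta> c\<bar>) \<le> 1 + S l + u l" using u0[of l] by (simp add: S_def)
    show "(\<Sum>c\<in>layer ?w l. \<bar>\<theta> c - \<theta>' c\<bar>) \<le> u l" by (simp add: u_def)
  qed (use N cube_abs_le_1[OF x] in \<open>auto simp: widths_def\<close>)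
  \<comment> \<open>Enlarging the norm of layer \<open>k\<close> by \<open>u k\<close> costs at most
    a factor \<open>exp (u k)\<close>; over all layers these factors multiply to the exponential of
    the total perturbation, without any further dependence on the depth.\<close>
  also have "(\<Prod>k=1..L. 1 + S k + u k) \<le> (\<Prod>k=1..L. (1 + layer_size p N * B) * exp (u k))"
  proof (intro prod_mono conjI)
    fix k assume k: "k \<in> {1..L}"
    show "0 \<le> 1 + S k + u k" using u0[of k] S0[of k] by simp
    have "1 + S k + u k \<le> (1 + S k) * (1 + u k)" using u0[of k] S0[of k] by (simp add: algebra_simps)
    also have "\<dots> \<le> (1 + layer_size p N * B) * exp (u k)"
      using sum_layer_le[OF N k B \<theta>] u0[of k] S0[of k] D0 exp_ge_add_one_self[of "u k"]
      by (intro mult_mono) (auto simp: S_def)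
    finally show "1 + S k + u k \<le> (1 + layer_size p N * B) * exp (u k)" .
  qed
  also have "\<dots> = (1 + layer_size p N * B) ^ L * exp (\<Sum>k=1..L. u k)"
    by (simp add: prod.distrib exp_sum)
  also have "(1 + layer_size p N * B) ^ L * exp (\<Sum>k=1..L. u k) * (\<Sum>k=1..L. u k) =
      (1 + layer_size p N * B) ^ L * ((\<Sum>k=1..L. u k) * exp (\<Sum>k=1..L. u k))" by simp
  also have "\<dots> \<le> (1 + layer_size p N * B) ^ L * (U * exp U)"
  proof -
    have "(\<Sum>k=1..L. u k) \<le> U" "0 \<le> (\<Sum>k=1..L. u k)"
      using U u0 unfolding u_def sum_coords by (auto intro: sum_nonneg)
    then show ?thesis using D0 by (intro mult_left_mono mult_mono) auto
  qed
  finally show ?thesis using u0 by (simp add: mult_right_mono sum_nonneg)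
qed

section \<open>Measurability of networks jointly in parameters and input\<close>

lemma param_component_measurable: "(\<lambda>\<theta>. \<theta> c) \<in> borel_measurable param_space"
  unfolding param_space_def by (rule measurable_component_singleton) simp

lemma hidden_measurable:
  assumes "i < w l" and T[measurable]: "T \<in> measurable M param_space"
    and X[measurable]: "X \<in> measurable M (\<Pi>\<^sub>M i\<in>{..<w 0}. borel)"
  shows "(\<lambda>z. hidden w (T z) (X z) l i) \<in> borel_measurable M"
  using assms(1)
proof (induction l arbitrary: i)
  case 0
  then show ?case
    using measurable_compose[OF X measurable_component_singleton[of i "{..<w 0}" "\<lambda>_. borel"]] by simp
next
  case (Suc l)
  have T'[measurable]: "(\<lambda>z. T z c) \<in> borel_measurable M" for c
    by (rule measurable_compose[OF T param_component_measurable])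
  show ?case unfolding hidden.simps
    by (intro borel_measurable_max borel_measurable_const borel_measurable_diff borel_measurable_sum
        borel_measurable_times T' Suc.IH) auto
qed

lemma net_measurable:
  assumes "p \<ge> 1" and T: "T \<in> measurable M param_space"
    and X: "X \<in> measurable M (\<Pi>\<^sub>M i\<in>{..<p}. borel)"
  shows "(\<lambda>z. net_N p L N (T z) (X z)) \<in> borel_measurable M"
proof -
  have T': "(\<lambda>z. T z c) \<in> borel_measurable M" for c
    by (rule measurable_compose[OF T param_component_measurable])
  show ?thesis unfolding network_def
    by (intro borel_measurable_add borel_measurable_sum borel_measurable_times T' hidden_measurable T)
      (use X in \<open>auto simp: widths_def[of _ _ _ 0]\<close>)
qed

section \<open>Finite grids of sparse parameter vectors\<close>

definition grid :: "real \<Rightarrow> int \<Rightarrow> coord set \<Rightarrow> param set" where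
  "grid \<eta> m \<gamma> = (\<lambda>z c. if c \<in> \<gamma> then \<eta> * real_of_int (z c) else 0) ` (\<gamma> \<rightarrow>\<^sub>E {- m..m})"

lemma finite_grid: "finite \<gamma> \<Longrightarrow> finite (grid \<eta> m \<gamma>)"
  unfolding grid_def by (intro finite_imageI finite_PiE) auto

lemma card_grid: "finite \<gamma> \<Longrightarrow> card (grid \<eta> m \<gamma>) \<le> nat (2 * m + 1) ^ card \<gamma>"
  unfolding grid_def
  by (rule order_trans[OF card_image_le]) (auto simp: finite_PiE card_PiE)

text \<open>Rounding down on the support: the floor stays within \<open>{- m..m}\<close> because
  \<open>m\<close> is an integer above \<open>R / \<eta>\<close>. Inactive coordinates are zero on
  both sides and contribute no error.\<close>

lemma grid_approx:
  assumes \<eta>: "\<eta> > 0" and m: "R / \<eta> \<le> real_of_int m"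
    and \<theta>: "\<And>c. c \<notin> \<gamma> \<Longrightarrow> \<theta> c = 0" "\<And>c. \<bar>\<theta> c\<bar> \<le> R"
  shows "\<exists>\<theta>'\<in>grid \<eta> m \<gamma>. (\<forall>c. \<bar>\<theta> c - \<theta>' c\<bar> \<le> \<eta>) \<and> (\<forall>c. c \<notin> \<gamma> \<longrightarrow> \<theta>' c = 0)"
proof -
  define z where "z = (\<lambda>c\<in>\<gamma>. \<lfloor>\<theta> c / \<eta>\<rfloor>)"
  have "z \<in> \<gamma> \<rightarrow>\<^sub>E {- m..m}"
  proof -
    have "- m \<le> \<lfloor>\<theta> c / \<eta>\<rfloor> \<and> \<lfloor>\<theta> c / \<eta>\<rfloor> \<le> m" for c
    proof -
      have "\<bar>\<theta> c / \<eta>\<bar> \<le> R / \<eta>" using \<theta>(2)[of c] \<eta> by (simp add: divide_right_mono)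
      then have "- real_of_int m \<le> \<theta> c / \<eta>" "\<theta> c / \<eta> \<le> real_of_int m" using m by linarith+
      then show ?thesis by linarith
    qed
    then show ?thesis by (auto simp: z_def)
  qed
  moreover have "\<bar>\<theta> c - \<eta> * real_of_int \<lfloor>\<theta> c / \<eta>\<rfloor>\<bar> \<le> \<eta>" for c
  proof -
    have "\<bar>\<theta> c / \<eta> - real_of_int \<lfloor>\<theta> c / \<eta>\<rfloor>\<bar> \<le> 1" by linarith
    then have "\<eta> * \<bar>\<theta> c / \<eta> - real_of_int \<lfloor>\<theta> c / \<eta>\<rfloor>\<bar> \<le> \<eta> * 1" using \<eta> by (intro mult_left_mono) auto
    moreover have "\<eta> * \<bar>\<theta> c / \<eta> - real_of_int \<lfloor>\<theta> c / \<eta>\<rfloor>\<bar> = \<bar>\<eta> * (\<theta> c / \<eta> - real_of_int \<lfloor>\<theta> c / \<eta>\<rfloor>)\<bar>"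
      using \<eta> by (simp add: abs_mult)
    ultimately show ?thesis using \<eta> by (simp add: right_diff_distrib)
  qed
  ultimately show ?thesis
    using \<theta>(1) \<eta> unfolding grid_def by (intro bexI[OF _ imageI[of z]]) (auto simp: z_def)
qed

section \<open>Integration with respect to the prior\<close>

abbreviation state_space :: "(param \<times> nat \<times> nat) measure" where
  "state_space \<equiv> param_space \<Otimes>\<^sub>M (count_space UNIV \<Otimes>\<^sub>M count_space UNIV)"

lemma sets_at_Ns: "sets M = sets param_space \<Longrightarrow> sets (at_Ns M N s) = sets state_space"
  unfolding at_Ns_def by (intro sets_pair_measure_cong) auto

lemma
  assumes "prob_space M" and sets[measurable_cong]: "sets M = sets param_space"
  shows prob_space_at_Ns: "prob_space (at_Ns M N s)"
    and nn_integral_at_Ns: "u \<in> borel_measurable state_space \<Longrightarrow>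
      (\<integral>\<^sup>+t. u t \<partial>at_Ns M N s) = (\<integral>\<^sup>+\<theta>. u (\<theta>, N, s) \<partial>M)"
proof -
  interpret M: prob_space M by fact
  let ?N = "return (count_space UNIV) N" and ?s = "return (count_space UNIV) s"
  interpret N: prob_space ?N by (rule prob_space_return) simp
  interpret s: prob_space ?s by (rule prob_space_return) simp
  interpret Ns: pair_prob_space ?N ?s ..
  interpret MNs: pair_prob_space M "?N \<Otimes>\<^sub>M ?s" ..
  show "prob_space (at_Ns M N s)" unfolding at_Ns_def by (rule MNs.prob_space_axioms)
  have s1: "sets (M \<Otimes>\<^sub>M (?N \<Otimes>\<^sub>M ?s)) = sets state_space"
    using sets by (intro sets_pair_measure_cong) auto
  assume u: "u \<in> borel_measurable state_space"
  then have u': "u \<in> borel_measurable (M \<Otimes>\<^sub>M (?N \<Otimes>\<^sub>M ?s))"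
    using measurable_cong_sets[OF s1 refl] by blast
  have "(\<integral>\<^sup>+t. u t \<partial>at_Ns M N s) = (\<integral>\<^sup>+\<theta>. \<integral>\<^sup>+r. u (\<theta>, r) \<partial>(?N \<Otimes>\<^sub>M ?s) \<partial>M)"
    unfolding at_Ns_def by (rule Ns.nn_integral_fst[OF u', symmetric])
  also have "\<dots> = (\<integral>\<^sup>+\<theta>. u (\<theta>, N, s) \<partial>M)"
  proof (intro nn_integral_cong)
    fix \<theta> assume "\<theta> \<in> space M"
    then have [measurable]: "\<theta> \<in> space param_space" using sets_eq_imp_space_eq[OF sets] by simp
    then have "(\<lambda>r. u (\<theta>, r)) \<in> borel_measurable (?N \<Otimes>\<^sub>M ?s)"
      using \<open>\<theta> \<in> space M\<close> by (intro measurable_compose[OF measurable_Pair1' u'])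
    then have "(\<integral>\<^sup>+r. u (\<theta>, r) \<partial>(?N \<Otimes>\<^sub>M ?s)) = (\<integral>\<^sup>+a. \<integral>\<^sup>+b. u (\<theta>, a, b) \<partial>?s \<partial>?N)"
      by (rule s.nn_integral_fst[symmetric])
    also have "\<dots> = u (\<theta>, N, s)" by (simp add: nn_integral_return)
    finally show "(\<integral>\<^sup>+r. u (\<theta>, r) \<partial>(?N \<Otimes>\<^sub>M ?s)) = u (\<theta>, N, s)" .
  qed
  finally show "(\<integral>\<^sup>+t. u t \<partial>at_Ns M N s) = (\<integral>\<^sup>+\<theta>. u (\<theta>, N, s) \<partial>M)" .
qed

section \<open>Product measures on finitely many coordinates, padded by zeros\<close>

lemma space_param_space[simp]: "space param_space = UNIV"
  by (simp add: param_space_def space_PiM)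

lemma sets_indep_coords[simp, measurable_cong]: "sets (indep_coords I M) = sets param_space"
  by (simp add: indep_coords_def)

definition extend_zero :: "coord set \<Rightarrow> param \<Rightarrow> param" where
  "extend_zero I \<theta> = (\<lambda>c. if c \<in> I then \<theta> c else 0)"

lemma indep_coords_eq: "indep_coords I M = distr (\<Pi>\<^sub>M c\<in>I. M c) param_space (extend_zero I)"
  unfolding indep_coords_def extend_zero_def ..

lemma extend_zero_measurable:
  assumes "\<And>c. c \<in> I \<Longrightarrow> sets (M c) = sets borel"
  shows "extend_zero I \<in> measurable (\<Pi>\<^sub>M c\<in>I. M c) param_space"
  unfolding param_space_def
proof (rule measurable_PiM_single')
  fix c :: coord
  show "(\<lambda>\<theta>. extend_zero I \<theta> c) \<in> borel_measurable (PiM I M)"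
  proof (cases "c \<in> I")
    case True
    then have "(\<lambda>\<theta>. \<theta> c) \<in> measurable (PiM I M) (M c)" by (rule measurable_component_singleton)
    then show ?thesis using True assms by (simp add: extend_zero_def cong: measurable_cong_sets)
  qed (simp add: extend_zero_def)
qed auto

context
  fixes I :: "coord set" and M :: "coord \<Rightarrow> real measure"
  assumes I: "finite I" and M: "\<And>c. c \<in> I \<Longrightarrow> prob_space (M c)" "\<And>c. c \<in> I \<Longrightarrow> sets (M c) = sets borel"
begin

lemma prob_space_indep_coords: "prob_space (indep_coords I M)"
  unfolding indep_coords_eq
  by (rule prob_space.prob_space_distr[OF prob_space_PiM extend_zero_measurable]) (use M in auto)

lemma nn_integral_indep_coords:
  assumes "u \<in> borel_measurable param_space"
  shows "(\<integral>\<^sup>+\<theta>. u \<theta> \<partial>indep_coords I M) = (\<integral>\<^sup>+\<theta>. u (extend_zero I \<theta>) \<partial>PiM I M)"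
  unfolding indep_coords_eq
  by (rule nn_integral_distr[OF extend_zero_measurable]) (use M assms in \<open>auto cong: measurable_cong_sets\<close>)

lemma nn_integral_indep_coords_component:
  assumes c: "c \<in> I" and f: "f \<in> borel_measurable borel"
  shows "(\<integral>\<^sup>+\<theta>. f (\<theta> c) \<partial>indep_coords I M) = (\<integral>\<^sup>+x. f x \<partial>M c)"
proof -
  have "(\<integral>\<^sup>+\<theta>. f (\<theta> c) \<partial>indep_coords I M) = (\<integral>\<^sup>+\<theta>. f (\<theta> c) \<partial>PiM I M)"
    using c by (subst nn_integral_indep_coords)
      (auto simp: extend_zero_def intro!: measurable_compose[OF param_component_measurable f])
  also have "\<dots> = (\<integral>\<^sup>+x. f x \<partial>distr (PiM I M) (M c) (\<lambda>\<theta>. \<theta> c))"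
    using c f M(2)[OF c] by (intro nn_integral_distr[symmetric] measurable_component_singleton) 
      (auto cong: measurable_cong_sets)
  also have "\<dots> = (\<integral>\<^sup>+x. f x \<partial>M c)" using distr_PiM_component[of I M c] M(1) c by simp
  finally show ?thesis .
qed

text \<open>The quantifier covers all coordinates, since outside \<open>I\<close> the value is the
  padding zero. Countability of the type of coordinates makes the event measurable, which the
  transfer along the image measure requires.\<close>

lemma AE_indep_coords:
  assumes J: "\<And>c. c \<in> I \<Longrightarrow> AE x in M c. P c x" "\<And>c. Measurable.pred borel (P c)" "\<And>c. c \<notin> I \<Longrightarrow> P c 0"
  shows "AE \<theta> in indep_coords I M. \<forall>c. P c (\<theta> c)"
proof -
  have "AE \<theta> in PiM I M. \<forall>c\<in>I. P c (\<theta> c)"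
    using M(1) J(1) I by (intro AE_finite_allI AE_PiM_component) auto
  then have "AE \<theta> in PiM I M. \<forall>c. P c (extend_zero I \<theta> c)"
    by eventually_elim (auto simp: extend_zero_def J(3))
  moreover have "{\<theta> \<in> space param_space. \<forall>c. P c (\<theta> c)} \<in> sets param_space"
  proof -
    have "UNIV = range (\<lambda>(l, i, j). Weight l i j) \<union> range (\<lambda>(l, i). Bias l i)"
      by (auto simp: image_iff) (metis coord.exhaust)
    then have "countable (UNIV :: coord set)" by (metis countable_Un countable_image countableI_type)
    then have "{\<theta> \<in> space param_space. \<forall>c\<in>UNIV. P c (\<theta> c)} \<in> sets param_space"
      by (intro sets.sets_Collect_countable_All')
        (use measurable_compose[OF param_component_measurable J(2)] in \<open>auto simp: pred_def\<close>)
    then show ?thesis by simp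
  qed
  ultimately show ?thesis
    unfolding indep_coords_eq using M(2)
    by (subst AE_distr_iff[OF extend_zero_measurable]) (auto simp: pred_def)
qed

end


lemma PiM_density:
  assumes I: "finite I" and P: "\<And>c. prob_space (P c)" and M: "\<And>c. prob_space (M c)"
    and g: "\<And>c. g c \<in> borel_measurable (P c)" and dens: "\<And>c. M c = density (P c) (g c)"
  shows "PiM I M = density (PiM I P) (\<lambda>\<theta>. \<Prod>c\<in>I. g c (\<theta> c))"
proof -
  interpret M: prob_space "M c" for c by (rule M)
  interpret P: prob_space "P c" for c by (rule P)
  interpret M: product_sigma_finite M by standard
  interpret P: product_sigma_finite P by standard
  have sets: "sets (M c) = sets (P c)" for c by (simp add: dens)
  have gm[measurable]: "(\<lambda>\<theta>. g c (\<theta> c)) \<in> borel_measurable (PiM I P)" if "c \<in> I" for c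
    by (rule measurable_compose[OF measurable_component_singleton[OF that] g])
  show ?thesis
  proof (rule M.PiM_eqI[symmetric, OF I])
    show "sets (density (PiM I P) (\<lambda>\<theta>. \<Prod>c\<in>I. g c (\<theta> c))) = sets (PiM I M)"
      using sets by (simp cong: sets_PiM_cong)
    fix A assume A: "\<And>c. c \<in> I \<Longrightarrow> A c \<in> sets (M c)"
    have A': "A c \<in> sets (P c)" if "c \<in> I" for c using A[OF that] sets by simp
    have "emeasure (density (PiM I P) (\<lambda>\<theta>. \<Prod>c\<in>I. g c (\<theta> c))) (Pi\<^sub>E I A) =
        (\<integral>\<^sup>+\<theta>. (\<Prod>c\<in>I. g c (\<theta> c)) * indicator (Pi\<^sub>E I A) \<theta> \<partial>PiM I P)"
      using A' I by (intro emeasure_density borel_measurable_prod_ennreal gm sets_PiM_I_finite)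
    also have "\<dots> = (\<integral>\<^sup>+\<theta>. (\<Prod>c\<in>I. g c (\<theta> c) * indicator (A c) (\<theta> c)) \<partial>PiM I P)"
    proof (intro nn_integral_cong)
      fix \<theta> assume "\<theta> \<in> space (PiM I P)"
      then have "indicator (Pi\<^sub>E I A) \<theta> = (\<Prod>c\<in>I. indicator (A c) (\<theta> c) :: ennreal)"
        using I by (auto simp: indicator_def space_PiM PiE_iff split: if_splits)
      then show "(\<Prod>c\<in>I. g c (\<theta> c)) * indicator (Pi\<^sub>E I A) \<theta> =
          (\<Prod>c\<in>I. g c (\<theta> c) * indicator (A c) (\<theta> c))" by (simp add: prod.distrib)
    qed
    also have "\<dots> = (\<Prod>c\<in>I. \<integral>\<^sup>+x. g c x * indicator (A c) x \<partial>P c)"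
      using A' g by (intro P.product_nn_integral_prod I) auto
    also have "\<dots> = (\<Prod>c\<in>I. emeasure (M c) (A c))"
      unfolding dens using A' g by (intro prod.cong refl emeasure_density[symmetric]) auto
    finally show "emeasure (density (PiM I P) (\<lambda>\<theta>. \<Prod>c\<in>I. g c (\<theta> c))) (Pi\<^sub>E I A) =
        (\<Prod>c\<in>I. emeasure (M c) (A c))" .
  qed
qed

text \<open>Coordinatewise bounds on densities multiply, so the product law of the competitor is
  dominated by that of the prior slabs with weight \<open>exp\<close> of the summed prices. This
  holds for every nonnegative integrand, in particular for indicators of sets.\<close>

lemma nn_integral_indep_coords_density_le:
  assumes I: "finite I" and P: "\<And>c. prob_space (P c)" "\<And>c. sets (P c) = sets borel"
    and M: "\<And>c. prob_space (M c)"
    and g: "\<And>c. g c \<in> borel_measurable borel" and dens: "\<And>c. M c = density (P c) (g c)"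
    and k: "\<And>c. k c \<in> borel_measurable borel" "\<And>c x. g c x \<le> ennreal (exp (k c x))"
    and u: "u \<in> borel_measurable param_space"
  shows "(\<integral>\<^sup>+\<theta>. u \<theta> \<partial>indep_coords I M) \<le>
    (\<integral>\<^sup>+\<theta>. ennreal (exp (\<Sum>c\<in>I. k c (\<theta> c))) * u \<theta> \<partial>indep_coords I P)"
proof -
  have g': "g c \<in> borel_measurable (P c)" for c
    using g[of c] measurable_cong_sets[OF P(2)[of c] refl] by blast
  have M2: "sets (M c) = sets borel" for c by (simp add: dens P)
  have ue: "(\<lambda>\<theta>. u (extend_zero I \<theta>)) \<in> borel_measurable (PiM I P)"
    by (rule measurable_compose[OF extend_zero_measurable u]) (rule P)
  have gm: "(\<lambda>\<theta>. \<Prod>c\<in>I. g c (\<theta> c)) \<in> borel_measurable (PiM I P)"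
    by (rule borel_measurable_prod_ennreal)
      (rule measurable_compose[OF measurable_component_singleton], assumption, rule g')
  have km: "(\<lambda>\<theta>. ennreal (exp (\<Sum>c\<in>I. k c (\<theta> c))) * u \<theta>) \<in> borel_measurable param_space"
  proof -
    have [measurable]: "(\<lambda>\<theta>. k c (\<theta> c)) \<in> borel_measurable param_space" for c
      by (rule measurable_compose[OF param_component_measurable k(1)])
    note u[measurable]
    show ?thesis by measurable
  qed
  have "(\<integral>\<^sup>+\<theta>. u \<theta> \<partial>indep_coords I M) = (\<integral>\<^sup>+\<theta>. u (extend_zero I \<theta>) \<partial>PiM I M)"
    by (rule nn_integral_indep_coords[OF I M M2 u])
  also have "\<dots> = (\<integral>\<^sup>+\<theta>. (\<Prod>c\<in>I. g c (\<theta> c)) * u (extend_zero I \<theta>) \<partial>PiM I P)"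
    unfolding PiM_density[OF I P(1) M g' dens] by (rule nn_integral_density[OF gm ue])
  also have "\<dots> \<le> (\<integral>\<^sup>+\<theta>. ennreal (exp (\<Sum>c\<in>I. k c (extend_zero I \<theta> c))) * u (extend_zero I \<theta>) \<partial>PiM I P)"
  proof (intro nn_integral_mono mult_right_mono)
    fix \<theta>
    have "(\<Prod>c\<in>I. g c (\<theta> c)) \<le> (\<Prod>c\<in>I. ennreal (exp (k c (\<theta> c))))"
      using I by (induction I rule: finite_induct) (auto intro!: mult_mono k(2))
    also have "\<dots> = ennreal (exp (\<Sum>c\<in>I. k c (extend_zero I \<theta> c)))"
      using I by (simp add: prod_ennreal exp_sum extend_zero_def)
    finally show "(\<Prod>c\<in>I. g c (\<theta> c)) \<le> ennreal (exp (\<Sum>c\<in>I. k c (extend_zero I \<theta> c)))" .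
  qed simp
  also have "\<dots> = (\<integral>\<^sup>+\<theta>. ennreal (exp (\<Sum>c\<in>I. k c (\<theta> c))) * u \<theta> \<partial>indep_coords I P)"
    by (rule nn_integral_indep_coords[OF I P km, symmetric])
  finally show ?thesis .
qed

section \<open>The prior as a mixture over width, sparsity and support\<close>

definition slabs :: "slab \<Rightarrow> coord set \<Rightarrow> coord \<Rightarrow> real measure" where
  "slabs S \<gamma> c = (if c \<in> \<gamma> then prior_slab S else return borel 0)"

lemma sets_slabs[simp]: "sets (slabs S \<gamma> c) = sets borel"
  by (simp add: slabs_def)

lemma prob_space_slabs: "admissible_slab S B \<Longrightarrow> prob_space (slabs S \<gamma> c)"
  by (auto simp: slabs_def intro: prob_space_prior_slab prob_space_return)

abbreviation slab_params :: "slab \<Rightarrow> nat \<Rightarrow> nat \<Rightarrow> nat \<Rightarrow> coord set \<Rightarrow> param measure" where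
  "slab_params S p L N \<gamma> \<equiv> indep_coords (coords_N p L N) (slabs S \<gamma>)"

context
  fixes S :: slab and B :: real and p L :: nat and lam lams :: real
  assumes adm: "admissible_slab S B" and lam: "lam > 0"
begin

lemma prob_space_slab_params: "prob_space (slab_params S p L N \<gamma>)"
  by (rule prob_space_indep_coords) (auto intro: prob_space_slabs[OF adm])

definition prior_kernel :: "nat \<times> nat \<times> coord set \<Rightarrow> (param \<times> nat \<times> nat) measure" where
  "prior_kernel = (\<lambda>(N, s, \<gamma>). at_Ns (slab_params S p L N \<gamma>) N s)"

lemma prior_eq: "prior S p L lam lams = measure_pmf (prior_index p L lam lams) \<bind> prior_kernel"
  unfolding prior_def prior_kernel_def slabs_def ..

lemma prob_space_prior_kernel: "prob_space (prior_kernel i)"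
  unfolding prior_kernel_def by (cases i) (auto intro!: prob_space_at_Ns prob_space_slab_params)

lemma prior_kernel_measurable: "prior_kernel \<in> measurable (measure_pmf (prior_index p L lam lams)) (subprob_algebra state_space)"
proof -
  have "prior_kernel i \<in> space (subprob_algebra state_space)" for i
    using prob_space_imp_subprob_space[OF prob_space_prior_kernel[of i]]
    by (cases i) (auto simp: space_subprob_algebra prior_kernel_def sets_at_Ns)
  then show ?thesis by auto
qed

lemma sets_prior: "sets (prior S p L lam lams) = sets state_space"
  unfolding prior_eq by (rule sets_bind) (auto simp: prior_kernel_def sets_at_Ns)

lemma prob_space_prior: "prob_space (prior S p L lam lams)"
  unfolding prior_eq
  by (rule measure_pmf.prob_space_bind[OF _ prior_kernel_measurable]) (simp add: prob_space_prior_kernel)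

lemma nn_integral_prior:
  assumes u: "u \<in> borel_measurable state_space"
  shows "(\<integral>\<^sup>+t. u t \<partial>prior S p L lam lams) =
    (\<integral>\<^sup>+N. \<integral>\<^sup>+s. \<integral>\<^sup>+\<gamma>. \<integral>\<^sup>+\<theta>. u (\<theta>, N, s) \<partial>slab_params S p L N \<gamma>
        \<partial>pmf_of_set {\<gamma>. \<gamma> \<subseteq> coords_N p L N \<and> card \<gamma> = s}
      \<partial>prior_s lams (card (coords_N p L N)) \<partial>prior_N lam)"
proof -
  have k: "(\<integral>\<^sup>+t. u t \<partial>prior_kernel (N, s, \<gamma>)) = (\<integral>\<^sup>+\<theta>. u (\<theta>, N, s) \<partial>slab_params S p L N \<gamma>)" for N s \<gamma>
    unfolding prior_kernel_def split_conv by (rule nn_integral_at_Ns[OF prob_space_slab_params _ u]) simp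
  have "(\<integral>\<^sup>+t. u t \<partial>prior S p L lam lams) = (\<integral>\<^sup>+i. \<integral>\<^sup>+t. u t \<partial>prior_kernel i \<partial>prior_index p L lam lams)"
    unfolding prior_eq by (rule nn_integral_bind[OF u prior_kernel_measurable])
  then show ?thesis by (simp add: prior_index_def k)
qed

lemma pmf_mult_le_nn_integral: "ennreal (pmf M x) * f x \<le> (\<integral>\<^sup>+y. f y \<partial>measure_pmf M)"
  unfolding nn_integral_measure_pmf by (rule nn_integral_ge_point) simp

text \<open>Keeps a single triple of width, sparsity and support out of the mixture. The lost factor
  is the probability of that triple, and its negative logarithm becomes the prior price of the
  competitor.\<close>

lemma prior_ge_atom:
  assumes u: "u \<in> borel_measurable state_space" and \<gamma>: "\<gamma> \<subseteq> coords_N p L N" "card \<gamma> = s"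
  shows "ennreal (pmf (prior_N lam) N * pmf (prior_s lams (card (coords_N p L N))) s / (card (coords_N p L N) choose s)) *
    (\<integral>\<^sup>+\<theta>. u (\<theta>, N, s) \<partial>slab_params S p L N \<gamma>) \<le> (\<integral>\<^sup>+t. u t \<partial>prior S p L lam lams)"
proof -
  let ?G = "{\<gamma>. \<gamma> \<subseteq> coords_N p L N \<and> card \<gamma> = s}" and ?H = "card (coords_N p L N)"
  have "finite ?G" by simp
  moreover have "\<gamma> \<in> ?G" using \<gamma> by simp
  moreover have "card ?G = ?H choose s" by (rule n_subsets) simp
  ultimately have pm: "pmf (pmf_of_set ?G) \<gamma> = 1 / (?H choose s)" by (subst pmf_of_set) auto
  have "ennreal (pmf (prior_N lam) N * pmf (prior_s lams ?H) s / (?H choose s)) *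
      (\<integral>\<^sup>+\<theta>. u (\<theta>, N, s) \<partial>slab_params S p L N \<gamma>) =
    ennreal (pmf (prior_N lam) N) * (ennreal (pmf (prior_s lams ?H) s) *
      (ennreal (pmf (pmf_of_set ?G) \<gamma>) * (\<integral>\<^sup>+\<theta>. u (\<theta>, N, s) \<partial>slab_params S p L N \<gamma>)))"
    unfolding pm by (simp add: ennreal_mult[symmetric] mult.assoc[symmetric])
  also have "\<dots> \<le> ennreal (pmf (prior_N lam) N) * (ennreal (pmf (prior_s lams ?H) s) *
      (\<integral>\<^sup>+\<gamma>. \<integral>\<^sup>+\<theta>. u (\<theta>, N, s) \<partial>slab_params S p L N \<gamma> \<partial>pmf_of_set ?G))"
    by (intro mult_left_mono pmf_mult_le_nn_integral) auto
  also have "\<dots> \<le> ennreal (pmf (prior_N lam) N) * (\<integral>\<^sup>+s. \<integral>\<^sup>+\<gamma>. \<integral>\<^sup>+\<theta>. u (\<theta>, N, s) \<partial>slab_params S p L N \<gamma>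
        \<partial>pmf_of_set {\<gamma>. \<gamma> \<subseteq> coords_N p L N \<and> card \<gamma> = s} \<partial>prior_s lams ?H)"
    by (intro mult_left_mono pmf_mult_le_nn_integral[of _ s]) auto
  also have "\<dots> \<le> (\<integral>\<^sup>+t. u t \<partial>prior S p L lam lams)"
    unfolding nn_integral_prior[OF u] by (rule pmf_mult_le_nn_integral)
  finally show ?thesis .
qed

text \<open>The normaliser is at least its term at 0, so the mass at \<open>s\<close> is at most
  \<open>exp (- lams * s)\<close>; the margin 1 leaves \<open>exp (- s) \<le> (1/2) ^ s\<close>, a
  series with sum 2. The bound does not depend on the number \<open>H\<close> of coordinates, which
  is unbounded in \<open>N\<close>.\<close>

lemma nn_integral_prior_s_exp_le:
  assumes "lams \<ge> b + 1"
  shows "(\<integral>\<^sup>+s. ennreal (exp (b * real s)) \<partial>prior_s lams H) \<le> 2"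
proof -
  have "(\<integral>\<^sup>+s. ennreal (exp (b * real s)) \<partial>prior_s lams H) =
      (\<integral>\<^sup>+s. ennreal (pmf (prior_s lams H) s) * ennreal (exp (b * real s)) \<partial>count_space UNIV)"
    by (rule nn_integral_measure_pmf)
  also have "\<dots> \<le> (\<integral>\<^sup>+s. ennreal ((1/2) ^ s) \<partial>count_space UNIV)"
  proof (intro nn_integral_mono)
    fix s :: nat
    let ?Z = "\<Sum>t\<le>H. exp (- lams * real t)"
    have "exp (- lams * real 0) \<le> ?Z" by (rule member_le_sum) auto
    then have Z: "?Z \<ge> 1" by simp
    have "pmf (prior_s lams H) s \<le> exp (- lams * real s)"
      unfolding pmf_prior_s using Z by (auto simp: divide_le_eq mult_left_mono[of 1 ?Z, simplified])
    then have "pmf (prior_s lams H) s * exp (b * real s) \<le> exp (- lams * real s) * exp (b * real s)"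
      by (rule mult_right_mono) simp
    also have "\<dots> = exp (real s * (b - lams))" by (simp add: mult_exp_exp algebra_simps)
    also have "\<dots> \<le> exp (real s * (- 1))" using assms by (intro exp_mono mult_left_mono) auto
    also have "\<dots> = exp (- 1) ^ s" by (simp only: exp_of_nat_mult)
    also have "\<dots> \<le> (1/2) ^ s"
    proof (rule power_mono)
      have "(2::real) \<le> exp 1" using exp_ge_add_one_self[of 1] by simp
      then show "exp (- 1) \<le> (1/2::real)" by (simp add: exp_minus field_simps)
    qed simp
    finally show "ennreal (pmf (prior_s lams H) s) * ennreal (exp (b * real s)) \<le> ennreal ((1/2) ^ s)"
      by (simp add: ennreal_mult[symmetric] ennreal_leI)
  qed
  also have "\<dots> = (\<Sum>s. ennreal ((1/2) ^ s))" by (rule nn_integral_count_space_nat)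
  also have "\<dots> = 2"
  proof -
    have "(\<lambda>s. (1/2::real) ^ s) sums 2" using geometric_sums[of "1/2::real"] by simp
    then have "(\<Sum>s. ennreal ((1/2) ^ s)) = ennreal 2" by (intro suminf_ennreal_eq) auto
    then show ?thesis by simp
  qed
  finally show ?thesis .
qed

text \<open>A Poisson law conditioned to be positive has all exponential moments; order 2 is the one
  that the tail \<open>N > n\<close> calls for.\<close>

lemma nn_integral_prior_N_exp:
  "(\<integral>\<^sup>+N. ennreal (exp (2 * real N)) \<partial>prior_N lam) \<le> ennreal (exp (lam * exp 2) / (exp lam - 1))"
proof -
  have pos: "exp lam - 1 > 0" using lam by simp
  have sums: "(\<lambda>N. (lam * exp 2) ^ N / (fact N * (exp lam - 1))) sums (exp (lam * exp 2) / (exp lam - 1))"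
    using sums_divide[OF exp_converges[of "lam * exp 2"], of "exp lam - 1"]
    by (simp add: scaleR_conv_of_real field_simps)
  have "(\<integral>\<^sup>+N. ennreal (exp (2 * real N)) \<partial>prior_N lam) =
      (\<integral>\<^sup>+N. ennreal (pmf (prior_N lam) N) * ennreal (exp (2 * real N)) \<partial>count_space UNIV)"
    by (rule nn_integral_measure_pmf)
  also have "\<dots> \<le> (\<integral>\<^sup>+N. ennreal ((lam * exp 2) ^ N / (fact N * (exp lam - 1))) \<partial>count_space UNIV)"
  proof (intro nn_integral_mono)
    fix N :: nat
    have "exp (2 * real N) = exp 2 ^ N" by (simp add: exp_of_nat_mult[symmetric] mult.commute)
    then have "pmf (prior_N lam) N * exp (2 * real N) \<le> (lam * exp 2) ^ N / (fact N * (exp lam - 1))"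
      unfolding pmf_prior_N[OF lam] using lam pos by (auto simp: power_mult_distrib field_simps)
    then show "ennreal (pmf (prior_N lam) N) * ennreal (exp (2 * real N)) \<le>
        ennreal ((lam * exp 2) ^ N / (fact N * (exp lam - 1)))"
      by (simp add: ennreal_mult[symmetric] ennreal_leI)
  qed
  also have "\<dots> = (\<Sum>N. ennreal ((lam * exp 2) ^ N / (fact N * (exp lam - 1))))"
    by (rule nn_integral_count_space_nat)
  also have "\<dots> = ennreal (exp (lam * exp 2) / (exp lam - 1))"
    using lam pos by (intro suminf_ennreal_eq[OF _ sums]) auto
  finally show ?thesis by simp
qed

text \<open>The last two terms of the bound dominate \<open>exp n\<close> on \<open>N > n\<close> and on \<open>s > n\<close>, so that the tails of
  the prior enter only through exponential moments.\<close>

lemma nn_integral_prior_le: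
  assumes u: "u \<in> borel_measurable state_space" and lams: "lams \<ge> b + 1" "lams \<ge> 3"
    and K: "K \<ge> 0" and E: "E \<ge> 0"
    and le: "\<And>N s \<gamma>. N \<ge> 1 \<Longrightarrow> \<gamma> \<subseteq> coords_N p L N \<Longrightarrow> card \<gamma> = s \<Longrightarrow>
      (\<integral>\<^sup>+\<theta>. u (\<theta>, N, s) \<partial>slab_params S p L N \<gamma>) \<le>
        ennreal (E * exp (b * real s) + exp (2 * real N) / exp (real n) + K * exp (2 * real s) / exp (real n))"
  shows "(\<integral>\<^sup>+t. u t \<partial>prior S p L lam lams) \<le>
    ennreal (2 * E + (exp (lam * exp 2) / (exp lam - 1) + 2 * K) / exp (real n))"
proof -
  define C where "C = exp (lam * exp 2) / (exp lam - 1)"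
  have C0: "C \<ge> 0" using lam by (simp add: C_def)
  let ?H = "\<lambda>N. card (coords_N p L N)"
  let ?G = "\<lambda>N s. {\<gamma>. \<gamma> \<subseteq> coords_N p L N \<and> card \<gamma> = s}"
  define v where "v N s = ennreal (E * exp (b * real s) + exp (2 * real N) / exp (real n) + K * exp (2 * real s) / exp (real n))"
    for N s :: nat
  have 1: "(\<integral>\<^sup>+\<gamma>. \<integral>\<^sup>+\<theta>. u (\<theta>, N, s) \<partial>slab_params S p L N \<gamma> \<partial>pmf_of_set (?G N s)) \<le> v N s"
    if "N \<ge> 1" "s \<le> ?H N" for N s
  proof -
    \<comment> \<open>The uniform law on supports is meaningful only when there is a support of size
      \<open>s\<close>, hence the restriction to \<open>s \<le> ?H N\<close>, which the prior of
      \<open>s\<close> guarantees.\<close>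
    have ne: "?G N s \<noteq> {}"
      using obtain_subset_with_card_n[OF that(2)] by blast
    have "(\<integral>\<^sup>+\<gamma>. \<integral>\<^sup>+\<theta>. u (\<theta>, N, s) \<partial>slab_params S p L N \<gamma> \<partial>pmf_of_set (?G N s)) \<le>
        (\<integral>\<^sup>+\<gamma>. v N s \<partial>pmf_of_set (?G N s))"
      using le[OF that(1)] ne
      by (intro nn_integral_mono_AE) (auto simp: AE_measure_pmf_iff v_def)
    then show ?thesis by simp
  qed
  have 2: "(\<integral>\<^sup>+s. \<integral>\<^sup>+\<gamma>. \<integral>\<^sup>+\<theta>. u (\<theta>, N, s) \<partial>slab_params S p L N \<gamma> \<partial>pmf_of_set (?G N s)
      \<partial>prior_s lams (?H N)) \<le> ennreal (2 * E + 2 * K / exp (real n)) + ennreal (exp (2 * real N)) * ennreal (1 / exp (real n))"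
    if "N \<ge> 1" for N
  proof -
    have "(\<integral>\<^sup>+s. \<integral>\<^sup>+\<gamma>. \<integral>\<^sup>+\<theta>. u (\<theta>, N, s) \<partial>slab_params S p L N \<gamma> \<partial>pmf_of_set (?G N s)
      \<partial>prior_s lams (?H N)) \<le> (\<integral>\<^sup>+s. v N s \<partial>prior_s lams (?H N))"
    proof (intro nn_integral_mono_AE)
      show "AE s in prior_s lams (?H N).
          (\<integral>\<^sup>+\<gamma>. \<integral>\<^sup>+\<theta>. u (\<theta>, N, s) \<partial>slab_params S p L N \<gamma> \<partial>pmf_of_set (?G N s)) \<le> v N s"
        using 1[OF that] by (auto simp: AE_measure_pmf_iff set_pmf_iff pmf_prior_s split: if_splits)
    qed
    also have "\<dots> = (\<integral>\<^sup>+s. ennreal E * ennreal (exp (b * real s)) + ennreal (exp (2 * real N) / exp (real n)) +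
        ennreal (K / exp (real n)) * ennreal (exp (2 * real s)) \<partial>prior_s lams (?H N))"
      using E K by (intro nn_integral_cong)
        (simp add: v_def ennreal_mult[symmetric] ennreal_plus[symmetric] del: ennreal_plus)
    also have "\<dots> = ennreal E * (\<integral>\<^sup>+s. ennreal (exp (b * real s)) \<partial>prior_s lams (?H N)) +
        ennreal (exp (2 * real N) / exp (real n)) +
        ennreal (K / exp (real n)) * (\<integral>\<^sup>+s. ennreal (exp (2 * real s)) \<partial>prior_s lams (?H N))"
      by (simp add: nn_integral_add nn_integral_cmult)
    also have "\<dots> \<le> ennreal E * 2 + ennreal (exp (2 * real N) / exp (real n)) + ennreal (K / exp (real n)) * 2"
      using lams by (intro add_mono mult_left_mono nn_integral_prior_s_exp_le) auto
    also have "\<dots> = ennreal (2 * E + 2 * K / exp (real n)) + ennreal (exp (2 * real N)) * ennreal (1 / exp (real n))"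
    proof -
      have two: "(2::ennreal) = ennreal 2" by simp
      show ?thesis unfolding two using E K
        by (simp add: ennreal_mult[symmetric] ennreal_plus[symmetric] del: ennreal_plus ennreal_numeral)
    qed
    finally show ?thesis .
  qed
  have "(\<integral>\<^sup>+t. u t \<partial>prior S p L lam lams) \<le>
      (\<integral>\<^sup>+N. ennreal (2 * E + 2 * K / exp (real n)) + ennreal (exp (2 * real N)) * ennreal (1 / exp (real n)) \<partial>prior_N lam)"
    unfolding nn_integral_prior[OF u]
  proof (intro nn_integral_mono_AE)
    show "AE N in prior_N lam. (\<integral>\<^sup>+s. \<integral>\<^sup>+\<gamma>. \<integral>\<^sup>+\<theta>. u (\<theta>, N, s) \<partial>slab_params S p L N \<gamma> \<partial>pmf_of_set (?G N s)
      \<partial>prior_s lams (?H N)) \<le> ennreal (2 * E + 2 * K / exp (real n)) + ennreal (exp (2 * real N)) * ennreal (1 / exp (real n))"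
    proof -
      have "N \<ge> 1" if "N \<in> set_pmf (prior_N lam)" for N
        using that by (cases "N \<ge> 1") (simp_all add: set_pmf_iff pmf_prior_N[OF lam])
      then show ?thesis using 2 by (auto simp: AE_measure_pmf_iff)
    qed
  qed
  also have "\<dots> = ennreal (2 * E + 2 * K / exp (real n)) +
      (\<integral>\<^sup>+N. ennreal (exp (2 * real N)) \<partial>prior_N lam) * ennreal (1 / exp (real n))"
    by (simp add: nn_integral_add nn_integral_multc)
  also have "\<dots> \<le> ennreal (2 * E + 2 * K / exp (real n)) + ennreal C * ennreal (1 / exp (real n))"
    unfolding C_def by (intro add_left_mono mult_right_mono nn_integral_prior_N_exp) auto
  also have "\<dots> = ennreal (2 * E + (C + 2 * K) / exp (real n))"
    using E K C0 by (simp add: ennreal_mult[symmetric] ennreal_plus[symmetric] add_divide_distrib del: ennreal_plus)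
  finally show ?thesis by (simp add: C_def)
qed

end

section \<open>Uniform control of the likelihood ratio\<close>

lemma (in finite_measure) measure_UN_le_card:
  assumes I: "finite I" and A: "\<And>i. i \<in> I \<Longrightarrow> A i \<in> sets M" and b: "\<And>i. i \<in> I \<Longrightarrow> measure M (A i) \<le> b"
  shows "measure M (\<Union>i\<in>I. A i) \<le> real (card I) * b"
proof -
  have "measure M (\<Union>i\<in>I. A i) \<le> (\<Sum>i\<in>I. measure M (A i))"
    using I A by (intro finite_measure_subadditive_finite) auto
  also have "\<dots> \<le> real (card I) * b" using sum_mono[OF b, of I "\<lambda>i. i"] by simp
  finally show ?thesis .
qed

text \<open>Markov's inequality with extended values, since it is applied to integrals over
  parameters that are kept as extended reals.\<close>

lemma (in prob_space) prob_gt_le_nn_integral_ennreal: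
  fixes X :: "'a \<Rightarrow> ennreal"
  assumes [measurable]: "X \<in> borel_measurable M" and le: "(\<integral>\<^sup>+x. X x \<partial>M) \<le> ennreal c"
    and t: "t > 0" and c: "c \<ge> 0"
  shows "prob {x \<in> space M. X x > ennreal t} \<le> c / t"
proof -
  have "emeasure M {x \<in> space M. X x > ennreal t} * ennreal t =
      (\<integral>\<^sup>+x. ennreal t * indicator {x \<in> space M. X x > ennreal t} x \<partial>M)"
    by (subst nn_integral_cmult_indicator) (auto simp: mult.commute)
  also have "\<dots> \<le> (\<integral>\<^sup>+x. X x \<partial>M)"
    by (intro nn_integral_mono) (auto simp: indicator_def)
  finally have "ennreal (prob {x \<in> space M. X x > ennreal t} * t) \<le> ennreal c"
    using le t by (simp add: emeasure_eq_measure ennreal_mult)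
  then show ?thesis using t c by (simp add: field_simps)
qed

lemma (in prob_space) prob_gt_le_nn_integral:
  assumes "X \<in> borel_measurable M" "(\<integral>\<^sup>+x. ennreal (X x) \<partial>M) \<le> ennreal c" "t > 0" "c \<ge> 0"
  shows "prob {x \<in> space M. X x > t} \<le> c / t"
proof -
  have "{x \<in> space M. X x > t} = {x \<in> space M. ennreal (X x) > ennreal t}"
    using assms(3) by (auto simp: ennreal_less_iff)
  then show ?thesis using prob_gt_le_nn_integral_ennreal[of "\<lambda>x. ennreal (X x)" c t] assms by simp
qed

definition sparse_grids :: "nat \<Rightarrow> nat \<Rightarrow> nat \<Rightarrow> real \<Rightarrow> int \<Rightarrow> nat \<Rightarrow> param set" where
  "sparse_grids p L N \<eta> m s = (\<Union>\<gamma>\<in>{\<gamma>. \<gamma> \<subseteq> coords_N p L N \<and> card \<gamma> = s}. grid \<eta> m \<gamma>)"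

lemma card_sparse_grids:
  "finite (sparse_grids p L N \<eta> m s)"
  "card (sparse_grids p L N \<eta> m s) \<le> (card (coords_N p L N) * nat (2 * m + 1)) ^ s"
proof -
  let ?G = "{\<gamma>. \<gamma> \<subseteq> coords_N p L N \<and> card \<gamma> = s}" and ?H = "card (coords_N p L N)"
  have fin: "finite \<gamma>" if "\<gamma> \<in> ?G" for \<gamma> using that finite_subset[OF _ finite_coords] by auto
  show "finite (sparse_grids p L N \<eta> m s)"
    unfolding sparse_grids_def using fin by (intro finite_UN_I finite_grid) auto
  have "card (sparse_grids p L N \<eta> m s) \<le> (\<Sum>\<gamma>\<in>?G. card (grid \<eta> m \<gamma>))"
    unfolding sparse_grids_def by (rule card_UN_le) simp
  also have "\<dots> \<le> (\<Sum>\<gamma>\<in>?G. nat (2 * m + 1) ^ s)"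
    using card_grid[OF fin] by (intro sum_mono) fastforce
  also have "\<dots> = (?H choose s) * nat (2 * m + 1) ^ s"
    using n_subsets[OF finite_coords[of L "widths p L N"], of s] by simp
  also have "(?H choose s) \<le> ?H ^ s"
    by (cases "s \<le> ?H") (auto simp: binomial_le_pow binomial_eq_0)
  finally show "card (sparse_grids p L N \<eta> m s) \<le> (?H * nat (2 * m + 1)) ^ s"
    by (simp add: power_mult_distrib)
qed

lemma net_N_measurable: "p \<ge> 1 \<Longrightarrow> net_N p L N \<theta> \<in> borel_measurable (\<Pi>\<^sub>M i\<in>{..<p}. borel)"
  by (rule net_measurable[where T="\<lambda>_. \<theta>" and X="\<lambda>x. x", simplified]) auto

section \<open>Events of high probability under the true distribution\<close>

locale bayes_net = regression +
  fixes S :: slab and B lam :: real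
  assumes p: "p \<ge> 1" and adm: "admissible_slab S B" and lam: "lam > 0"
begin

lemma hell_net_measurable: "(\<lambda>\<theta>. hell (net_N p L N \<theta>)) \<in> borel_measurable param_space"
proof -
  interpret U: prob_space "unif_cube p" by (rule prob_space_unif_cube)
  have [measurable]: "(\<lambda>z. net_N p L N (fst z) (snd z)) \<in> borel_measurable (param_space \<Otimes>\<^sub>M unif_cube p)"
    by (rule net_measurable[OF p]) measurable
  show ?thesis unfolding hellinger_sq_def by measurable
qed

lemma obs_component_measurable: "i < n \<Longrightarrow> (\<lambda>D. D i) \<in> measurable (data0 n) (obs_space p)"
  unfolding data_measure_def using measurable_component_singleton[of i "{..<n}" "\<lambda>_. obs0"]
  by (simp cong: measurable_cong_sets)

lemma llr_net_measurable:
  "(\<lambda>z. llr (net_N p L N (snd z)) n (fst z)) \<in> borel_measurable (data0 n \<Otimes>\<^sub>M param_space)"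
proof -
  have 1[measurable]: "(\<lambda>z. fst z i) \<in> measurable (data0 n \<Otimes>\<^sub>M param_space) (obs_space p)" if "i < n" for i
    by (rule measurable_compose[OF measurable_fst obs_component_measurable[OF that]])
  have 2[measurable]: "(\<lambda>z. net_N p L N (snd z) (fst (fst z i))) \<in> borel_measurable (data0 n \<Otimes>\<^sub>M param_space)"
    if "i < n" for i
    using that by (intro net_measurable[OF p]) measurable
  show ?thesis unfolding llr_def
    by (intro borel_measurable_sum borel_measurable_divide borel_measurable_const borel_measurable_diff
        borel_measurable_power)
      (auto intro!: measurable_compose[OF 1 measurable_snd] measurable_compose[OF measurable_compose[OF 1 measurable_fst] f0] 2)
qed

text \<open>Likelihood ratio times the exponential of the scaled Hellinger distance. At
  \<open>c = 0\<close> it is the likelihood ratio itself, so one function and one measurability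
  proof serve both the evidence and the exponential moment.\<close>

definition tilted :: "nat \<Rightarrow> real \<Rightarrow> nat \<Rightarrow> (nat \<Rightarrow> obs) \<Rightarrow> param \<times> nat \<times> nat \<Rightarrow> real" where
  "tilted L c n D = (\<lambda>(\<theta>, N, s). exp (llr (net_N p L N \<theta>) n D + c * real n * hell (net_N p L N \<theta>)))"

lemma tilted_measurable:
  "(\<lambda>z. tilted L c n (fst z) (snd z)) \<in> borel_measurable (data0 n \<Otimes>\<^sub>M state_space)"
proof -
  let ?M = "data0 n \<Otimes>\<^sub>M state_space"
  define F where "F N z = exp (llr (net_N p L N (fst (snd z))) n (fst z) + c * real n * hell (net_N p L N (fst (snd z))))"
    for N and z :: "(nat \<Rightarrow> obs) \<times> param \<times> nat \<times> nat"
  have "F N \<in> borel_measurable ?M" for N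
  proof -
    have "(\<lambda>z. (fst z, fst (snd z))) \<in> measurable ?M (data0 n \<Otimes>\<^sub>M param_space)" by measurable
    from measurable_compose[OF this llr_net_measurable[of L N n]]
    have [measurable]: "(\<lambda>z. llr (net_N p L N (fst (snd z))) n (fst z)) \<in> borel_measurable ?M" by simp
    have "(\<lambda>z. fst (snd z)) \<in> measurable ?M param_space" by measurable
    from measurable_compose[OF this hell_net_measurable[of L N]]
    have [measurable]: "(\<lambda>z. hell (net_N p L N (fst (snd z)))) \<in> borel_measurable ?M" .
    show ?thesis unfolding F_def[abs_def] by measurable
  qed
  \<comment> \<open>The width is a component of the state and changes the network; being a natural
    number, it can be held fixed first and then reinserted by countability.\<close>
  moreover have "(\<lambda>z. fst (snd (snd z))) \<in> measurable ?M (count_space UNIV)" by measurable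
  ultimately have "(\<lambda>z. F (fst (snd (snd z))) z) \<in> borel_measurable ?M"
    by (rule measurable_compose_countable)
  then show ?thesis by (simp add: tilted_def F_def case_prod_beta')
qed

text \<open>Markov's inequality at each grid point with threshold
  \<open>s * ln T + 3 * ln n\<close>: the first term pays for the at most \<open>T ^ s\<close> grid
  points, the second for the choices of \<open>N\<close> and \<open>s\<close>, and a failure
  probability of at most \<open>2 / n\<close> remains.\<close>

lemma grid_event:
  assumes n: "n \<ge> 1" and T: "T \<ge> 1"
    and card: "\<And>N. 1 \<le> N \<Longrightarrow> N \<le> n \<Longrightarrow> real (card (coords_N p L N) * nat (2 * m + 1)) \<le> T"
  shows "\<exists>A\<in>sets (data0 n). measure (data0 n) (space (data0 n) - A) \<le> 2 / real n \<and>
    (\<forall>D\<in>A. \<forall>N s. 1 \<le> N \<longrightarrow> N \<le> n \<longrightarrow> s \<le> n \<longrightarrow> (\<forall>\<theta>\<in>sparse_grids p L N \<eta> m s.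
      llr (net_N p L N \<theta>) n D / 2 + real n * hell (net_N p L N \<theta>) \<le> real s * ln T + 3 * ln (real n)))"
proof -
  interpret D: prob_space "data0 n" by (rule prob_space_data)
  define t where "t s = real s * ln T + 3 * ln (real n)" for s :: nat
  define bad where "bad N s \<theta> = {D \<in> space (data0 n). llr (net_N p L N \<theta>) n D / 2 + real n * hell (net_N p L N \<theta>) > t s}"
    for N s \<theta>
  have fm: "net_N p L N \<theta> \<in> borel_measurable (\<Pi>\<^sub>M i\<in>{..<p}. borel)" for N \<theta> by (rule net_N_measurable[OF p])
  note llrm[measurable] = llr_measurable[OF fm]
  have bad_sets[measurable]: "bad N s \<theta> \<in> sets (data0 n)" for N s \<theta> unfolding bad_def by measurable
  have et: "exp (- t s) = 1 / (T ^ s * real n ^ 3)" for s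
  proof -
    have "exp (t s) = T ^ s * real n ^ 3"
      using T n by (simp add: t_def exp_add exp_of_nat_mult exp_of_nat_mult[of 3, simplified])
    then show ?thesis by (simp add: exp_minus field_simps)
  qed
  have single: "D.prob (bad N s \<theta>) \<le> 1 / (T ^ s * real n ^ 3)" for N s \<theta>
  proof -
    let ?f = "net_N p L N \<theta>"
    have "(\<integral>\<^sup>+D. ennreal (exp (llr ?f n D / 2 + real n * hell ?f)) \<partial>data0 n) =
        (\<integral>\<^sup>+D. ennreal (exp (real n * hell ?f)) * ennreal (exp (llr ?f n D / 2)) \<partial>data0 n)"
      by (intro nn_integral_cong) (simp add: exp_add ennreal_mult mult.commute)
    also have "\<dots> = ennreal (exp (real n * hell ?f)) * (\<integral>\<^sup>+D. ennreal (exp (llr ?f n D / 2)) \<partial>data0 n)"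
      by (rule nn_integral_cmult) measurable
    also have "\<dots> \<le> ennreal (exp (real n * hell ?f)) * ennreal (exp (- real n * hell ?f))"
      by (intro mult_left_mono nn_integral_exp_half_llr fm) simp
    also have "\<dots> = ennreal 1" by (simp add: ennreal_mult[symmetric] mult_exp_exp)
    finally have "D.prob {D \<in> space (data0 n). exp (llr ?f n D / 2 + real n * hell ?f) > exp (t s)} \<le> 1 / exp (t s)"
      by (intro D.prob_gt_le_nn_integral) auto
    then show ?thesis using et[of s] by (simp add: bad_def exp_minus inverse_eq_divide)
  qed
  define U where "U N s = (\<Union>\<theta>\<in>sparse_grids p L N \<eta> m s. bad N s \<theta>)" for N s
  have U_sets[measurable]: "U N s \<in> sets (data0 n)" for N s
    unfolding U_def using card_sparse_grids(1) by (intro sets.finite_UN) auto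
  have U_le: "D.prob (U N s) \<le> 1 / real n ^ 3" if N: "1 \<le> N" "N \<le> n" for N s
  proof -
    let ?K = "card (sparse_grids p L N \<eta> m s)"
    have "D.prob (U N s) \<le> real ?K * (1 / (T ^ s * real n ^ 3))"
      unfolding U_def by (rule D.measure_UN_le_card) (use card_sparse_grids(1) single in auto)
    also have "real ?K \<le> real ((card (coords_N p L N) * nat (2 * m + 1)) ^ s)"
      using card_sparse_grids(2) by (simp only: of_nat_le_iff)
    also have "\<dots> \<le> T ^ s"
      unfolding of_nat_power by (intro power_mono card N) auto
    finally show ?thesis using T n by (simp add: field_simps)
  qed
  define V where "V = (\<Union>N\<in>{1..n}. \<Union>s\<in>{..n}. U N s)"
  have V_sets[measurable]: "V \<in> sets (data0 n)" unfolding V_def by measurable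
  have "D.prob V \<le> real (card {1..n}) * (real (card {..n}) * (1 / real n ^ 3))"
    unfolding V_def by (intro D.measure_UN_le_card U_le) auto
  also have "\<dots> = (real n + 1) / real n ^ 2" using n by (simp add: field_simps power2_eq_square power3_eq_cube)
  also have "\<dots> \<le> 2 / real n" using n by (simp add: field_simps power2_eq_square)
  finally have V_le: "D.prob V \<le> 2 / real n" .
  show ?thesis
  proof (intro bexI[of _ "space (data0 n) - V"] conjI ballI allI impI)
    have "space (data0 n) - (space (data0 n) - V) = V" using sets.sets_into_space[OF V_sets] by auto
    with V_le show "D.prob (space (data0 n) - (space (data0 n) - V)) \<le> 2 / real n" by simp
    fix D N s \<theta>
    assume "D \<in> space (data0 n) - V" "1 \<le> N" "N \<le> n" "s \<le> n" "\<theta> \<in> sparse_grids p L N \<eta> m s"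
    then have "D \<notin> bad N s \<theta>" "D \<in> space (data0 n)" by (auto simp: V_def U_def)
    then show "llr (net_N p L N \<theta>) n D / 2 + real n * hell (net_N p L N \<theta>) \<le> real s * ln T + 3 * ln (real n)"
      by (auto simp: bad_def t_def)
  qed measurable
qed



text \<open>A shift of at most \<open>\<tau>\<close> in the function changes one squared residual by
  at most \<open>\<tau> * (2 * \<bar>y\<bar> + 3 * G)\<close>. Summed over the data this needs
  control of the responses, and the single smallness condition on \<open>\<tau>\<close> is stated so
  as to serve both conclusions.\<close>

lemma llr_hell_close:
  fixes f g :: "(nat \<Rightarrow> real) \<Rightarrow> real"
  assumes fm: "f \<in> borel_measurable (\<Pi>\<^sub>M i\<in>{..<p}. borel)" and gm: "g \<in> borel_measurable (\<Pi>\<^sub>M i\<in>{..<p}. borel)"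
    and n: "n \<ge> 1" and G: "G \<ge> 1" and F0: "F0 \<ge> 0" and \<tau>: "0 \<le> \<tau>" "\<tau> \<le> 1"
    and \<tau>G: "\<tau> * (5 * (real n)\<^sup>2 * G * (1 + F0)) \<le> \<sigma>\<^sup>2"
    and f: "\<And>x. x \<in> cube p \<Longrightarrow> \<bar>f x\<bar> \<le> G" and fg: "\<And>x. x \<in> cube p \<Longrightarrow> \<bar>f x - g x\<bar> \<le> \<tau>"
    and f0b: "\<And>x. x \<in> cube p \<Longrightarrow> \<bar>f0 x\<bar> \<le> F0"
    and D: "\<And>i. i < n \<Longrightarrow> fst (D i) \<in> cube p" and y: "(\<Sum>i<n. \<bar>snd (D i)\<bar>) \<le> (real n)\<^sup>2"
  shows "llr f n D \<le> llr g n D + 1" and "real n * hell f \<le> real n * hell g + 1"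
proof -
  have n1: "real n \<ge> 1" "real n \<le> (real n)\<^sup>2" using n by (auto simp: power2_eq_square)
  \<comment> \<open>The sum is at most \<open>2 * G + \<tau>\<close>, and
    \<open>\<tau> \<le> 1 \<le> G\<close>.\<close>
  have g: "\<bar>f x + g x\<bar> \<le> 3 * G" if "x \<in> cube p" for x
    using f[OF that] fg[OF that] G \<tau> by (auto simp: abs_le_iff)
  have term_le: "((snd d - f0 (fst d))\<^sup>2 - (snd d - f (fst d))\<^sup>2) / (2 * \<sigma>\<^sup>2) \<le>
      ((snd d - f0 (fst d))\<^sup>2 - (snd d - g (fst d))\<^sup>2) / (2 * \<sigma>\<^sup>2) + \<tau> * (2 * \<bar>snd d\<bar> + 3 * G) / (2 * \<sigma>\<^sup>2)"
    if "fst d \<in> cube p" for d :: obs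
  proof -
    have "(snd d - g (fst d))\<^sup>2 - (snd d - f (fst d))\<^sup>2 =
        (f (fst d) - g (fst d)) * (2 * snd d - (f (fst d) + g (fst d)))"
      by (simp add: power2_eq_square algebra_simps)
    also have "\<dots> \<le> \<bar>f (fst d) - g (fst d)\<bar> * \<bar>2 * snd d - (f (fst d) + g (fst d))\<bar>"
      by (simp add: abs_mult[symmetric])
    also have "\<dots> \<le> \<tau> * (2 * \<bar>snd d\<bar> + 3 * G)"
      using fg[OF that] g[OF that] \<tau> by (intro mult_mono) auto
    finally have "(snd d - f0 (fst d))\<^sup>2 - (snd d - f (fst d))\<^sup>2 \<le>
        (snd d - f0 (fst d))\<^sup>2 - (snd d - g (fst d))\<^sup>2 + \<tau> * (2 * \<bar>snd d\<bar> + 3 * G)" by simp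
    then have "((snd d - f0 (fst d))\<^sup>2 - (snd d - f (fst d))\<^sup>2) / (2 * \<sigma>\<^sup>2) \<le>
        ((snd d - f0 (fst d))\<^sup>2 - (snd d - g (fst d))\<^sup>2 + \<tau> * (2 * \<bar>snd d\<bar> + 3 * G)) / (2 * \<sigma>\<^sup>2)"
      by (rule divide_right_mono) simp
    then show ?thesis by (simp add: add_divide_distrib)
  qed
  have "llr f n D \<le> (\<Sum>i<n. ((snd (D i) - f0 (fst (D i)))\<^sup>2 - (snd (D i) - g (fst (D i)))\<^sup>2) / (2 * \<sigma>\<^sup>2) +
      \<tau> * (2 * \<bar>snd (D i)\<bar> + 3 * G) / (2 * \<sigma>\<^sup>2))"
    unfolding llr_def using D by (intro sum_mono term_le) auto
  also have "\<dots> = llr g n D + \<tau> * (2 * (\<Sum>i<n. \<bar>snd (D i)\<bar>) + real n * (3 * G)) / (2 * \<sigma>\<^sup>2)"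
    unfolding sum.distrib llr_def[symmetric]
    by (simp add: sum_divide_distrib[symmetric] sum_distrib_left[symmetric] sum.distrib)
  also have "\<dots> \<le> llr g n D + 1"
  proof -
    have "2 * (\<Sum>i<n. \<bar>snd (D i)\<bar>) + real n * (3 * G) \<le> 2 * (real n)\<^sup>2 * G + (real n)\<^sup>2 * (3 * G)"
    proof (intro add_mono)
      have "(real n)\<^sup>2 * 1 \<le> (real n)\<^sup>2 * G" using G by (intro mult_left_mono) auto
      then show "2 * (\<Sum>i<n. \<bar>snd (D i)\<bar>) \<le> 2 * (real n)\<^sup>2 * G" using y by simp
    qed (use n1 G in \<open>intro mult_right_mono; simp\<close>)
    also have "\<dots> = (5 * (real n)\<^sup>2 * G) * 1" by simp
    also have "\<dots> \<le> (5 * (real n)\<^sup>2 * G) * (1 + F0)"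
      using F0 G by (intro mult_left_mono) auto
    finally have "\<tau> * (2 * (\<Sum>i<n. \<bar>snd (D i)\<bar>) + real n * (3 * G)) \<le> \<tau> * ((5 * (real n)\<^sup>2 * G) * (1 + F0))"
      using \<tau> by (intro mult_left_mono) auto
    also have "\<dots> \<le> \<sigma>\<^sup>2" using \<tau>G by (simp add: mult.assoc)
    also have "\<dots> \<le> 2 * \<sigma>\<^sup>2" by simp
    finally show ?thesis using \<sigma> by (simp add: divide_le_eq)
  qed
  finally show "llr f n D \<le> llr g n D + 1" .
  have "hell f \<le> hell g + 1 / real n"
  proof (rule hell_le_add[OF fm gm])
    fix x assume x: "x \<in> cube p"
    have "(f x - f0 x)\<^sup>2 - (g x - f0 x)\<^sup>2 = (f x - g x) * ((f x + g x) - 2 * f0 x)"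
      by (simp add: power2_eq_square algebra_simps)
    also have "\<dots> \<le> \<bar>f x - g x\<bar> * \<bar>(f x + g x) - 2 * f0 x\<bar>" by (simp add: abs_mult[symmetric])
    also have "\<dots> \<le> \<tau> * (3 * G + 2 * F0)"
      using fg[OF x] g[OF x] f0b[OF x] \<tau> by (intro mult_mono) auto
    also have "\<dots> \<le> 8 * \<sigma>\<^sup>2 * (1 / real n)"
    proof -
      have "3 * G + 2 * F0 \<le> 5 * G * (1 + F0)"
        using mult_right_mono[of 1 G F0] G F0 by (simp add: distrib_left)
      then have "real n * (3 * G + 2 * F0) \<le> (real n)\<^sup>2 * (5 * G * (1 + F0))"
        using n1 G F0 by (intro mult_mono) auto
      then have "\<tau> * (real n * (3 * G + 2 * F0)) \<le> \<tau> * ((real n)\<^sup>2 * (5 * G * (1 + F0)))"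
        using \<tau> by (intro mult_left_mono) auto
      also have "\<dots> = \<tau> * (5 * (real n)\<^sup>2 * G * (1 + F0))" by (simp only: mult_ac)
      also have "\<dots> \<le> \<sigma>\<^sup>2" by (rule \<tau>G)
      also have "\<dots> \<le> 8 * \<sigma>\<^sup>2" by simp
      finally show ?thesis using n1 by (simp add: field_simps)
    qed
    finally show "(f x - f0 x)\<^sup>2 \<le> (g x - f0 x)\<^sup>2 + 8 * \<sigma>\<^sup>2 * (1 / real n)" by simp
  qed simp
  then have "real n * hell f \<le> real n * (hell g + 1 / real n)" by (intro mult_left_mono) auto
  then show "real n * hell f \<le> real n * hell g + 1" using n by (simp add: distrib_left)
qed

text \<open>Weights are limited by \<open>n\<close> and not by \<open>B\<close>, so that under
  normal slabs the remaining set has exponentially small prior probability. The support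
  \<open>\<gamma>\<close> may contain zero weights, as the prior draws it before the weights. The
  factor \<open>16 * L * ln n\<close> is the logarithm of the number of grid choices per active
  weight.\<close>

definition controlled :: "nat \<Rightarrow> nat \<Rightarrow> (nat \<Rightarrow> obs) \<Rightarrow> bool" where
  "controlled L n D \<longleftrightarrow> (\<forall>N \<gamma> \<theta>. 1 \<le> N \<longrightarrow> N \<le> n \<longrightarrow> \<gamma> \<subseteq> coords_N p L N \<longrightarrow> card \<gamma> \<le> n \<longrightarrow>
     (\<forall>c. c \<notin> \<gamma> \<longrightarrow> \<theta> c = 0) \<longrightarrow> (\<forall>c. \<bar>\<theta> c\<bar> \<le> real n) \<longrightarrow>
     llr (net_N p L N \<theta>) n D / 2 + real n * hell (net_N p L N \<theta>) \<le>
       real (card \<gamma>) * (16 * real L * ln (real n)) + 3 * ln (real n) + 2)"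

text \<open>The mesh of the grid is so fine that rounding changes \<open>llr\<close> and \<open>n * hell\<close> by at most 1;
  since its logarithm is of order \<open>L * ln n\<close>, the union bound over the grid still costs only
  \<open>O(s * L * ln n)\<close>.\<close>

lemma net_event:
  assumes F0: "F0 \<ge> 0" and f0b: "\<And>x. x \<in> cube p \<Longrightarrow> \<bar>f0 x\<bar> \<le> F0"
  shows "\<exists>n0. \<forall>n\<ge>n0. \<forall>L. 1 \<le> L \<longrightarrow> L \<le> n \<longrightarrow>
    (\<exists>A\<in>sets (data0 n). measure (data0 n) (space (data0 n) - A) \<le> 2 / real n \<and>
      (\<forall>D\<in>A. (\<forall>i<n. fst (D i) \<in> cube p) \<longrightarrow> (\<Sum>i<n. \<bar>snd (D i)\<bar>) \<le> (real n)\<^sup>2 \<longrightarrow> controlled L n D))"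
proof -
  \<comment> \<open>Normalised so that
    \<open>15 * \<kappa> * (1 + F0) = min 1 (\<sigma>\<^sup>2)\<close>; here 15 is the product of
    the 3 in \<open>\<tau>\<close> and the 5 in the smallness condition of
    \<open>llr_hell_close\<close>.\<close>
  define \<kappa> where "\<kappa> = min 1 (\<sigma>\<^sup>2) / (15 * (1 + F0))"
  have \<kappa>: "\<kappa> > 0" "\<kappa> \<le> 1" "15 * \<kappa> * (1 + F0) \<le> 1" "15 * \<kappa> * (1 + F0) \<le> \<sigma>\<^sup>2"
  proof -
    have "15 * \<kappa> * (1 + F0) = min 1 (\<sigma>\<^sup>2)" using F0 by (simp add: \<kappa>_def field_simps)
    then show "15 * \<kappa> * (1 + F0) \<le> 1" "15 * \<kappa> * (1 + F0) \<le> \<sigma>\<^sup>2" by auto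
    show "\<kappa> > 0" using F0 \<sigma> by (simp add: \<kappa>_def)
    have "min 1 (\<sigma>\<^sup>2) \<le> 1 * (15 * (1 + F0))" using F0 by simp
    then show "\<kappa> \<le> 1" unfolding \<kappa>_def using F0 by (subst divide_le_eq) auto
  qed
  \<comment> \<open>From \<open>n0\<close> on, one extra power of \<open>n\<close> absorbs each
    constant: \<open>157 = 12 * 13 + 1\<close> from the layer size in the bound of \<open>G\<close>,
    and \<open>780 = 156 * 5\<close> from the number of coordinates times the number of grid
    values.\<close>
  define n0 where "n0 = nat \<lceil>max (max 2 (157 * (real p)\<^sup>2)) (780 * (real p)\<^sup>2 / \<kappa>)\<rceil>"
  show ?thesis
  proof (intro exI[of _ n0] allI impI)
    fix n L :: nat assume n0: "n0 \<le> n" and L: "1 \<le> L" "L \<le> n"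
    have "real n \<ge> max (max 2 (157 * (real p)\<^sup>2)) (780 * (real p)\<^sup>2 / \<kappa>)"
      using n0 unfolding n0_def by linarith
    then have n: "real n \<ge> 2" "157 * (real p)\<^sup>2 \<le> real n" "780 * (real p)\<^sup>2 / \<kappa> \<le> real n" by auto
    have n1: "n \<ge> 1" "real n \<ge> 1" using n by auto
    define Dn where "Dn = layer_size p n"
    define G where "G = (1 + Dn * real n) ^ L"
    have p1: "real p \<ge> 1" using p by simp
    have Dn: "0 \<le> Dn" "Dn \<le> 156 * (real p)\<^sup>2 * (real n)\<^sup>2"
    proof -
      have pn: "1 \<le> real p * real n" using mult_mono[of 1 "real p" 1 "real n"] p1 n1 by simp
      have "12 * real p * real n + 1 \<le> 13 * (real p * real n)" using pn by linarith
      then have "Dn \<le> 12 * real p * real n * (13 * (real p * real n))"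
        unfolding Dn_def layer_size_def by (intro mult_left_mono) auto
      then show "Dn \<le> 156 * (real p)\<^sup>2 * (real n)\<^sup>2" by (simp add: power2_eq_square mult_ac)
      show "0 \<le> Dn" unfolding Dn_def by (rule layer_size_nonneg)
    qed
    have G1: "G \<ge> 1" unfolding G_def using Dn by (intro one_le_power) auto
    have Gle: "G \<le> real n ^ (4 * L)"
    proof -
      have "1 \<le> (real p)\<^sup>2 * real n ^ 3"
        using mult_mono[of 1 "(real p)\<^sup>2" 1 "real n ^ 3"] p1 n1 by (simp add: one_le_power)
      moreover have "Dn * real n \<le> 156 * (real p)\<^sup>2 * (real n)\<^sup>2 * real n" using Dn n1 by (intro mult_right_mono) auto
      ultimately have "1 + Dn * real n \<le> 157 * (real p)\<^sup>2 * real n ^ 3"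
        by (simp add: power2_eq_square power3_eq_cube)
      also have "\<dots> \<le> real n * real n ^ 3" using n by (intro mult_right_mono) auto
      finally have "1 + Dn * real n \<le> real n ^ 4" by (simp add: power_numeral_reduce)
      then have "G \<le> (real n ^ 4) ^ L" unfolding G_def using Dn by (intro power_mono) auto
      then show ?thesis by (simp add: power_mult)
    qed
    \<comment> \<open>One factor \<open>G\<close> undoes the amplification of a weight error by the
      network, the other the size of the functions in the difference of squares. The power
      \<open>n ^ 3\<close> covers up to \<open>n\<close> active weights and the factor
      \<open>n ^ 2\<close> from the responses.\<close>
    define \<eta> where "\<eta> = \<kappa> / (G\<^sup>2 * real n ^ 3)"
    define m where "m = \<lceil>real n / \<eta>\<rceil>"
    have den: "G\<^sup>2 * real n ^ 3 \<ge> 1"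
      using mult_mono[of 1 "G\<^sup>2" 1 "real n ^ 3"] G1 n1 by (simp add: one_le_power)
    have \<eta>: "\<eta> > 0" "\<eta> * (G\<^sup>2 * real n ^ 3) = \<kappa>" using \<kappa> den n1 G1 by (auto simp: \<eta>_def)
    have n\<eta>: "real n * \<eta> \<le> 1"
    proof -
      have "real n * \<eta> * 1 \<le> real n * \<eta> * (G\<^sup>2 * (real n)\<^sup>2)"
        using \<eta> n1 G1 mult_mono[of 1 "G\<^sup>2" 1 "(real n)\<^sup>2"] by (intro mult_left_mono) (auto simp: one_le_power)
      also have "\<dots> = \<kappa>" using \<eta>(2) by (simp add: power2_eq_square power3_eq_cube mult_ac)
      finally show ?thesis using \<kappa> by simp
    qed
    \<comment> \<open>Perturbation bound for a total weight error of at most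
      \<open>n * \<eta> \<le> 1\<close>; the 3 bounds \<open>exp 1\<close>.\<close>
    define \<tau> where "\<tau> = 3 * G * (real n * \<eta>)"
    have \<tau>0: "\<tau> \<ge> 0" using G1 \<eta> by (simp add: \<tau>_def)
    have \<tau>G: "\<tau> * (5 * (real n)\<^sup>2 * G * (1 + F0)) = 15 * \<kappa> * (1 + F0)"
      unfolding \<tau>_def \<eta>(2)[symmetric] by (simp add: power2_eq_square power3_eq_cube mult_ac)
    have \<tau>1: "\<tau> \<le> 1"
    proof -
      have "1 \<le> (real n)\<^sup>2 * G * (1 + F0)"
        using mult_mono[of 1 "(real n)\<^sup>2 * G" 1 "1 + F0"] mult_mono[of 1 "(real n)\<^sup>2" 1 G] n1 G1 F0
        by (simp add: one_le_power)
      then have "\<tau> * 1 \<le> \<tau> * (5 * (real n)\<^sup>2 * G * (1 + F0))" using \<tau>0 by (intro mult_left_mono) auto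
      then show ?thesis using \<tau>G \<kappa> by simp
    qed
    have lsN: "layer_size p N \<le> Dn" if "N \<le> n" for N
      unfolding Dn_def layer_size_def using that by (intro mult_mono add_mono) auto
    have T: "real (card (coords_N p L N) * nat (2 * m + 1)) \<le> real n ^ (16 * L)" if N: "1 \<le> N" "N \<le> n" for N
    proof -
      have "real (card (coords_N p L N)) \<le> real L * layer_size p N" using card_coords_N p N L by simp
      also have "\<dots> \<le> real n * (156 * (real p)\<^sup>2 * (real n)\<^sup>2)"
        using L lsN[OF N(2)] Dn layer_size_nonneg[of p N] by (intro mult_mono) auto
      finally have H: "real (card (coords_N p L N)) \<le> 156 * (real p)\<^sup>2 * real n ^ 3"
        by (simp add: power2_eq_square power3_eq_cube mult_ac)
      have "1 * \<eta> \<le> real n * \<eta>" using n1 \<eta> by (intro mult_right_mono) auto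
      then have "\<eta> \<le> real n" using n\<eta> n1 by linarith
      then have n\<eta>1: "real n / \<eta> \<ge> 1" using \<eta> by (simp add: le_divide_eq)
      have "m \<ge> 0" using \<eta> unfolding m_def by (simp add: less_le_trans[of "-1" 0])
      then have "real (nat (2 * m + 1)) = 2 * real_of_int m + 1" by simp
      also have "\<dots> \<le> 2 * (real n / \<eta> + 1) + 1" unfolding m_def by (intro add_mono mult_left_mono) linarith+
      also have "\<dots> \<le> 5 * (real n / \<eta>)" using n\<eta>1 by simp
      also have "\<dots> = 5 * real n ^ 4 * G\<^sup>2 / \<kappa>" using \<kappa> den by (simp add: \<eta>_def power_numeral_reduce)
      finally have K: "real (nat (2 * m + 1)) \<le> 5 * real n ^ 4 * G\<^sup>2 / \<kappa>" .
      have "real (card (coords_N p L N) * nat (2 * m + 1)) \<le>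
          (156 * (real p)\<^sup>2 * real n ^ 3) * (5 * real n ^ 4 * G\<^sup>2 / \<kappa>)"
        unfolding of_nat_mult by (intro mult_mono H K) auto
      also have "\<dots> = (780 * (real p)\<^sup>2 / \<kappa>) * (real n ^ 7 * G\<^sup>2)" by (simp add: power_numeral_reduce)
      also have "\<dots> \<le> real n * (real n ^ 7 * (real n ^ (4 * L))\<^sup>2)"
        using n Gle G1 \<kappa> by (intro mult_mono power_mono) auto
      also have "\<dots> = real n ^ (8 + 8 * L)"
      proof -
        have "(real n ^ (4 * L))\<^sup>2 = real n ^ (8 * L)" by (simp only: power_mult[symmetric]) simp
        moreover have "real n ^ 8 = real n * real n ^ 7" by (simp add: power_numeral_reduce)
        ultimately show ?thesis by (simp only: power_add mult.assoc)
      qed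
      \<comment> \<open>Uses \<open>8 + 8 * L \<le> 16 * L\<close> for \<open>L \<ge> 1\<close>,
        which is the origin of the constant 16 in \<open>controlled\<close>.\<close>
      also have "\<dots> \<le> real n ^ (16 * L)" using L n1 by (intro power_increasing) auto
      finally show ?thesis .
    qed
    have "1 \<le> real n ^ (16 * L)" using n1 by (simp add: one_le_power)
    have "\<exists>A\<in>sets (data0 n). measure (data0 n) (space (data0 n) - A) \<le> 2 / real n \<and>
      (\<forall>D\<in>A. \<forall>N s. 1 \<le> N \<longrightarrow> N \<le> n \<longrightarrow> s \<le> n \<longrightarrow> (\<forall>\<theta>\<in>sparse_grids p L N \<eta> m s.
        llr (net_N p L N \<theta>) n D / 2 + real n * hell (net_N p L N \<theta>) \<le> real s * ln (real n ^ (16 * L)) + 3 * ln (real n)))"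
      by (rule grid_event[OF n1(1) \<open>1 \<le> real n ^ (16 * L)\<close>]) (rule T)
    then obtain A where A: "A \<in> sets (data0 n)" "measure (data0 n) (space (data0 n) - A) \<le> 2 / real n"
      and Ag: "\<forall>D\<in>A. \<forall>N s. 1 \<le> N \<longrightarrow> N \<le> n \<longrightarrow> s \<le> n \<longrightarrow> (\<forall>\<theta>\<in>sparse_grids p L N \<eta> m s.
        llr (net_N p L N \<theta>) n D / 2 + real n * hell (net_N p L N \<theta>) \<le> real s * ln (real n ^ (16 * L)) + 3 * ln (real n))"
      by (elim bexE conjE) (rule that)
    show "\<exists>A\<in>sets (data0 n). measure (data0 n) (space (data0 n) - A) \<le> 2 / real n \<and>
      (\<forall>D\<in>A. (\<forall>i<n. fst (D i) \<in> cube p) \<longrightarrow> (\<Sum>i<n. \<bar>snd (D i)\<bar>) \<le> (real n)\<^sup>2 \<longrightarrow> controlled L n D)"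
      unfolding controlled_def
    proof (intro bexI[OF _ A(1)] conjI A(2) ballI allI impI)
      fix D N \<gamma> \<theta>
      assume DA: "D \<in> A" and Dc: "\<forall>i<n. fst (D i) \<in> cube p" and y: "(\<Sum>i<n. \<bar>snd (D i)\<bar>) \<le> (real n)\<^sup>2"
        and N: "1 \<le> N" "N \<le> n" and \<gamma>: "\<gamma> \<subseteq> coords_N p L N" "card \<gamma> \<le> n"
        and \<theta>: "\<forall>c. c \<notin> \<gamma> \<longrightarrow> \<theta> c = 0" "\<forall>c. \<bar>\<theta> c\<bar> \<le> real n"
      have "real n / \<eta> \<le> real_of_int m" unfolding m_def by linarith
      then obtain \<theta>' where \<theta>': "\<theta>' \<in> grid \<eta> m \<gamma>" "\<And>c. \<bar>\<theta> c - \<theta>' c\<bar> \<le> \<eta>" "\<And>c. c \<notin> \<gamma> \<Longrightarrow> \<theta>' c = 0"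
        using grid_approx[OF \<eta>(1), of "real n" m \<gamma> \<theta>] \<theta> by blast
      have "\<theta>' \<in> sparse_grids p L N \<eta> m (card \<gamma>)" using \<theta>'(1) \<gamma> by (auto simp: sparse_grids_def)
      from Ag[rule_format, OF DA N \<gamma>(2) this]
      have key: "llr (net_N p L N \<theta>') n D / 2 + real n * hell (net_N p L N \<theta>') \<le>
          real (card \<gamma>) * (16 * real L * ln (real n)) + 3 * ln (real n)"
        using n1 by (simp add: ln_realpow)
      have U: "(\<Sum>c\<in>coords_N p L N. \<bar>\<theta> c - \<theta>' c\<bar>) \<le> real n * \<eta>"
      proof -
        have "(\<Sum>c\<in>coords_N p L N. \<bar>\<theta> c - \<theta>' c\<bar>) = (\<Sum>c\<in>\<gamma>. \<bar>\<theta> c - \<theta>' c\<bar>)"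
          using \<gamma>(1) \<theta>(1) \<theta>'(3) by (intro sum.mono_neutral_right) auto
        also have "\<dots> \<le> (\<Sum>c\<in>\<gamma>. \<eta>)" by (intro sum_mono \<theta>'(2))
        also have "\<dots> \<le> real n * \<eta>" using \<gamma>(2) \<eta> by (simp add: mult_right_mono)
        finally show ?thesis .
      qed
      have GN: "(1 + layer_size p N * real n) ^ L \<le> G"
        unfolding G_def using lsN[OF N(2)] layer_size_nonneg[of p N]
        by (intro power_mono add_mono mult_right_mono) auto
      have f: "\<bar>net_N p L N \<theta> x\<bar> \<le> G" if "x \<in> cube p" for x
        using net_abs_le[of p N L "real n" \<theta> x] p N L \<theta>(2) that GN by simp
      have fg: "\<bar>net_N p L N \<theta> x - net_N p L N \<theta>' x\<bar> \<le> \<tau>" if "x \<in> cube p" for x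
      proof -
        have "\<bar>net_N p L N \<theta> x - net_N p L N \<theta>' x\<bar> \<le> (1 + layer_size p N * real n) ^ L * (real n * \<eta> * exp (real n * \<eta>))"
          using p N L \<theta>(2) that U by (intro net_perturbation) auto
        also have "\<dots> \<le> G * (real n * \<eta> * 3)"
        proof -
          have "exp (real n * \<eta>) \<le> exp 1" using n\<eta> by simp
          then have "exp (real n * \<eta>) \<le> 3" using exp_le by linarith
          then show ?thesis using GN \<eta> G1 layer_size_nonneg[of p N] by (intro mult_mono) auto
        qed
        finally show ?thesis by (simp add: \<tau>_def mult_ac)
      qed
      have "\<tau> * (5 * (real n)\<^sup>2 * G * (1 + F0)) \<le> \<sigma>\<^sup>2" unfolding \<tau>G by (rule \<kappa>(4))
      note close = llr_hell_close[OF net_N_measurable[OF p] net_N_measurable[OF p] n1(1) G1 F0 \<tau>0 \<tau>1 this f fg f0b _ y]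
      have "llr (net_N p L N \<theta>) n D \<le> llr (net_N p L N \<theta>') n D + 1"
        and "real n * hell (net_N p L N \<theta>) \<le> real n * hell (net_N p L N \<theta>') + 1"
        using close Dc by blast+
      with key show "llr (net_N p L N \<theta>) n D / 2 + real n * hell (net_N p L N \<theta>) \<le>
          real (card \<gamma>) * (16 * real L * ln (real n)) + 3 * ln (real n) + 2" by linarith
    qed
  qed
qed


lemma nn_integral_data_component:
  assumes "i < n" and g: "g \<in> borel_measurable (obs_space p)"
  shows "(\<integral>\<^sup>+D. g (D i) \<partial>data0 n) = (\<integral>\<^sup>+d. g d \<partial>obs0)"
proof -
  have "distr (\<Pi>\<^sub>M i\<in>{..<n}. obs0) obs0 (\<lambda>D. D i) = obs0"
    using assms prob_space_obs by (intro distr_PiM_component) auto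
  moreover have "(\<integral>\<^sup>+d. g d \<partial>distr (\<Pi>\<^sub>M i\<in>{..<n}. obs0) obs0 (\<lambda>D. D i)) = (\<integral>\<^sup>+D. g (D i) \<partial>data0 n)"
    unfolding data_measure_def using assms
    by (intro nn_integral_distr measurable_component_singleton) (auto cong: measurable_cong_sets)
  ultimately show ?thesis by simp
qed

text \<open>The sum of absolute responses has mean of order \<open>n\<close>, so the generous
  threshold \<open>n\<^sup>2\<close> makes Markov's inequality give a probability of order
  \<open>1 / n\<close>. A sharper threshold would only change a power of \<open>n\<close> in the
  mesh of the grid.\<close>

lemma response_event:
  assumes F0: "F0 \<ge> 0" and f0b: "\<And>x. x \<in> cube p \<Longrightarrow> \<bar>f0 x\<bar> \<le> F0" and n: "n \<ge> 1"
  shows "measure (data0 n) {D \<in> space (data0 n). (\<Sum>i<n. \<bar>snd (D i)\<bar>) > (real n)\<^sup>2} \<le> (F0 + 1 + \<sigma>\<^sup>2) / real n"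
proof -
  interpret D: prob_space "data0 n" by (rule prob_space_data)
  interpret U: prob_space "unif_cube p" by (rule prob_space_unif_cube)
  interpret N: prob_space "normal_measure 0 \<sigma>" by (rule prob_space_normal_measure[OF \<sigma>])
  have sm: "(\<lambda>d. ennreal \<bar>snd d\<bar>) \<in> borel_measurable (obs_space p)" by measurable
  have Dm[measurable]: "(\<lambda>D. D i) \<in> measurable (data0 n) (obs_space p)" if "i < n" for i
    by (rule obs_component_measurable[OF that])
  have [measurable]: "(\<lambda>D. snd (D i)) \<in> borel_measurable (data0 n)" if "i < n" for i
    by (rule measurable_compose[OF Dm[OF that] measurable_snd])
  have [measurable]: "(\<lambda>D. \<Sum>i<n. \<bar>snd (D i)\<bar>) \<in> borel_measurable (data0 n)"
    by (intro borel_measurable_sum borel_measurable_abs) auto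
  have abs_le: "\<bar>e\<bar> \<le> 1 + e\<^sup>2" for e :: real
    using zero_le_power2[of "\<bar>e\<bar> - 1"] abs_ge_zero[of e] unfolding power2_diff power2_abs by (simp; linarith)
  have "(\<integral>\<^sup>+d. ennreal \<bar>snd d\<bar> \<partial>obs0) = (\<integral>\<^sup>+x. \<integral>\<^sup>+e. ennreal \<bar>f0 x + e\<bar> \<partial>normal_measure 0 \<sigma> \<partial>unif_cube p)"
    using nn_integral_obs[OF sm] by simp
  also have "\<dots> \<le> (\<integral>\<^sup>+x. ennreal (F0 + 1 + \<sigma>\<^sup>2) \<partial>unif_cube p)"
  proof (intro nn_integral_mono_AE)
    show "AE x in unif_cube p. (\<integral>\<^sup>+e. ennreal \<bar>f0 x + e\<bar> \<partial>normal_measure 0 \<sigma>) \<le> ennreal (F0 + 1 + \<sigma>\<^sup>2)"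
      using AE_unif_cube[of p]
    proof eventually_elim
      case (elim x)
      have "\<bar>f0 x + e\<bar> \<le> F0 + 1 + e\<^sup>2" for e using f0b[OF elim] abs_le[of e] by linarith
      then have "(\<integral>\<^sup>+e. ennreal \<bar>f0 x + e\<bar> \<partial>normal_measure 0 \<sigma>) \<le>
          (\<integral>\<^sup>+e. ennreal (F0 + 1) + ennreal (e\<^sup>2) \<partial>normal_measure 0 \<sigma>)"
        using F0 by (intro nn_integral_mono) (simp add: ennreal_plus[symmetric] ennreal_leI del: ennreal_plus)
      also have "\<dots> = ennreal (F0 + 1) + ennreal (\<sigma>\<^sup>2)"
      proof -
        have "(\<integral>\<^sup>+e. ennreal (F0 + 1) + ennreal (e\<^sup>2) \<partial>normal_measure 0 \<sigma>) =
            (\<integral>\<^sup>+e. ennreal (F0 + 1) \<partial>normal_measure 0 \<sigma>) + (\<integral>\<^sup>+e. ennreal (e\<^sup>2) \<partial>normal_measure 0 \<sigma>)"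
          by (rule nn_integral_add) measurable
        then show ?thesis using N.emeasure_space_1 by (simp add: nn_integral_square_normal_measure)
      qed
      finally show ?case using F0 by (simp add: ennreal_plus[symmetric] del: ennreal_plus)
    qed
  qed
  also have "\<dots> = ennreal (F0 + 1 + \<sigma>\<^sup>2)" by (simp add: U.emeasure_space_1)
  finally have one: "(\<integral>\<^sup>+d. ennreal \<bar>snd d\<bar> \<partial>obs0) \<le> ennreal (F0 + 1 + \<sigma>\<^sup>2)" .
  have "(\<integral>\<^sup>+D. ennreal (\<Sum>i<n. \<bar>snd (D i)\<bar>) \<partial>data0 n) = (\<integral>\<^sup>+D. (\<Sum>i<n. ennreal \<bar>snd (D i)\<bar>) \<partial>data0 n)"
    by (simp add: sum_ennreal)
  also have "\<dots> = (\<Sum>i<n. \<integral>\<^sup>+D. ennreal \<bar>snd (D i)\<bar> \<partial>data0 n)"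
    by (intro nn_integral_sum measurable_compose[OF Dm sm]) auto
  also have "\<dots> = (\<Sum>i<n. \<integral>\<^sup>+d. ennreal \<bar>snd d\<bar> \<partial>obs0)"
    using nn_integral_data_component[OF _ sm] by (intro sum.cong) auto
  also have "\<dots> \<le> (\<Sum>i<n. ennreal (F0 + 1 + \<sigma>\<^sup>2))" by (intro sum_mono one)
  also have "\<dots> = ennreal (real n * (F0 + 1 + \<sigma>\<^sup>2))" using F0 by (simp add: ennreal_mult ennreal_of_nat_eq_real_of_nat)
  finally have "D.prob {D \<in> space (data0 n). (\<Sum>i<n. \<bar>snd (D i)\<bar>) > (real n)\<^sup>2} \<le>
      real n * (F0 + 1 + \<sigma>\<^sup>2) / (real n)\<^sup>2"
    using n F0 by (intro D.prob_gt_le_nn_integral) auto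
  then show ?thesis using n by (simp add: power2_eq_square)
qed


text \<open>For fixed parameters the average over the data is accessible, so Fubini turns the
  expected prior integral into a prior integral of \<open>u\<close>. It is of order
  \<open>n ^ 3\<close>, and Markov's inequality at level \<open>n ^ 5\<close> leaves a failure
  probability of order \<open>1 / n\<close>. Constants are uniform in \<open>L\<close> and
  \<open>lams\<close>, since both may vary with \<open>n\<close>.\<close>

lemma tilted_integral_event:
  assumes F0: "F0 \<ge> 0" and f0b: "\<And>x. x \<in> cube p \<Longrightarrow> \<bar>f0 x\<bar> \<le> F0" and a: "a > 0"
  shows "\<exists>c>0. \<exists>K\<ge>0. \<exists>n0. \<forall>n\<ge>n0. \<forall>L lams. 1 \<le> L \<longrightarrow> L \<le> n \<longrightarrow> a * real L * ln (real n) \<le> lams \<longrightarrow>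
    (\<exists>A\<in>sets (data0 n). measure (data0 n) (space (data0 n) - A) \<le> K / real n \<and>
      (\<forall>D\<in>A. (\<integral>\<^sup>+t. ennreal (tilted L c n D t) \<partial>prior S p L lam lams) \<le> ennreal (real n ^ 5)))"
proof -
  obtain CS where CS: "CS \<ge> 1" "(\<integral>\<^sup>+x. ennreal (exp (2 * \<bar>x\<bar>)) \<partial>prior_slab S) \<le> ennreal CS"
    using nn_integral_exp_prior_slab[OF adm] by blast
  have "\<exists>n1. \<forall>n\<ge>n1. \<forall>L. 1 \<le> L \<longrightarrow> L \<le> n \<longrightarrow>
    (\<exists>A\<in>sets (data0 n). measure (data0 n) (space (data0 n) - A) \<le> 2 / real n \<and>
      (\<forall>D\<in>A. (\<forall>i<n. fst (D i) \<in> cube p) \<longrightarrow> (\<Sum>i<n. \<bar>snd (D i)\<bar>) \<le> (real n)\<^sup>2 \<longrightarrow> controlled L n D))"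
    (is "\<exists>n1. ?net n1")
    by (rule net_event[OF F0]) (rule f0b)
  then obtain n1 where net: "?net n1" by (elim exE) (rule that)
  \<comment> \<open>With \<open>c \<le> a / 32\<close> the cost \<open>16 * c * L * ln n\<close> per
    active weight is at most half of the prior decay; \<open>c \<le> 1\<close> keeps the exponent
    \<open>1 - c / 2\<close> nonnegative and the crude bound at \<open>exp n\<close>.\<close>
  define c where "c = min 1 (a / 32)"
  have c: "0 < c" "c \<le> 1" "32 * c \<le> a" using a by (auto simp: c_def)
  define C2 where "C2 = exp (lam * exp 2) / (exp lam - 1) + 2 * (1 + CS)"
  have C2: "C2 \<ge> 0" using CS lam by (simp add: C2_def)
  define K where "K = 2 + (F0 + 1 + \<sigma>\<^sup>2) + (4 * exp 2 + C2)"
  have K: "K \<ge> 0" using F0 C2 by (simp add: K_def)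
  \<comment> \<open>Ensures \<open>a * ln n \<ge> 2\<close>, so that the half of the decay not spent
    on \<open>b\<close> is at least the margin 1, and \<open>a * ln n \<ge> 3\<close>, so that the
    moment \<open>exp (2 * s)\<close> has the same margin.\<close>
  define n0 where "n0 = max n1 (nat \<lceil>max (exp (2 / a)) (exp (3 / a))\<rceil>) + 1"
  have main: "\<exists>A\<in>sets (data0 n). measure (data0 n) (space (data0 n) - A) \<le> K / real n \<and>
      (\<forall>D\<in>A. (\<integral>\<^sup>+t. ennreal (tilted L c n D t) \<partial>prior S p L lam lams) \<le> ennreal (real n ^ 5))"
    if n: "n \<ge> n0" and L: "1 \<le> L" "L \<le> n" and lams: "a * real L * ln (real n) \<le> lams" for n L lams
  proof -
    interpret D: prob_space "data0 n" by (rule prob_space_data)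
    interpret P: prob_space "prior S p L lam lams" by (rule prob_space_prior[OF adm lam])
    interpret PD: pair_prob_space "data0 n" "prior S p L lam lams" ..
    have sP: "sets (prior S p L lam lams) = sets state_space" by (rule sets_prior[OF adm lam])
    note sP[measurable_cong]
    have nr: "real n \<ge> exp (2 / a)" "real n \<ge> exp (3 / a)" "n \<ge> 1" "n \<ge> n1"
      using n unfolding n0_def by linarith+
    have n_pos: "real n > 0" using nr by simp
    have lnn: "a * ln (real n) \<ge> 2" "a * ln (real n) \<ge> 3"
      using nr a n_pos by (simp_all add: ln_ge_iff[symmetric] field_simps)
    have aL: "a * ln (real n) \<le> a * real L * ln (real n)"
      using L lnn(1) mult_right_mono[of 1 "real L" "a * ln (real n)"] by (simp add: mult_ac)
    define b where "b = 16 * c * real L * ln (real n)"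
    have lnn0: "ln (real n) \<ge> 0" using nr by simp
    have b: "lams \<ge> b + 1" "lams \<ge> 3"
    proof -
      have "32 * c * (real L * ln (real n)) \<le> a * (real L * ln (real n))"
        using c lnn0 by (intro mult_right_mono) auto
      then have "2 * b \<le> a * real L * ln (real n)" by (simp add: b_def mult_ac)
      then show "lams \<ge> b + 1" using lams aL lnn by linarith
      show "lams \<ge> 3" using lams aL lnn by linarith
    qed
    obtain A1 where A1[measurable]: "A1 \<in> sets (data0 n)"
      and A1p: "measure (data0 n) (space (data0 n) - A1) \<le> 2 / real n"
      and A1h: "\<forall>D\<in>A1. (\<forall>i<n. fst (D i) \<in> cube p) \<longrightarrow> (\<Sum>i<n. \<bar>snd (D i)\<bar>) \<le> (real n)\<^sup>2 \<longrightarrow> controlled L n D"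
      using net nr(4) L by blast
    have Dm[measurable]: "(\<lambda>D. D i) \<in> measurable (data0 n) (obs_space p)" if "i < n" for i
      by (rule obs_component_measurable[OF that])
    define Y where "Y = {D \<in> space (data0 n). (\<Sum>i<n. \<bar>snd (D i)\<bar>) > (real n)\<^sup>2}"
    have Ym[measurable]: "Y \<in> sets (data0 n)"
    proof -
      have [measurable]: "(\<lambda>D. \<Sum>i<n. \<bar>snd (D i)\<bar>) \<in> borel_measurable (data0 n)"
        using measurable_compose[OF Dm measurable_snd] by (intro borel_measurable_sum borel_measurable_abs) auto
      show ?thesis unfolding Y_def by measurable
    qed
    obtain Z where Zs: "{D \<in> space (data0 n). \<not> (\<forall>i<n. fst (D i) \<in> cube p)} \<subseteq> Z"
      "emeasure (data0 n) Z = 0" and Z[measurable]: "Z \<in> sets (data0 n)"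
      using AE_data_cube[of n] by (rule AE_E)
    have Z0: "measure (data0 n) Z = 0" using Zs(2) by (simp add: measure_def)
    have Zc: "\<forall>i<n. fst (D i) \<in> cube p" if "D \<in> space (data0 n) - Z" for D using Zs(1) that by auto
    \<comment> \<open>The likelihood ratios are controlled only for these data, so the average that
      defines \<open>u\<close> is restricted to them; the complement goes into the exceptional
      event.\<close>
    define V where "V = A1 - Y - Z"
    have Vm[measurable]: "V \<in> sets (data0 n)" unfolding V_def by measurable
    define u where "u t = (\<integral>\<^sup>+D. indicator V D * ennreal (tilted L c n D t) \<partial>data0 n)" for t
    have tm: "(\<lambda>z. indicator V (fst z) * ennreal (tilted L c n (fst z) (snd z))) \<in> borel_measurable (data0 n \<Otimes>\<^sub>M state_space)"
    proof -
      have [measurable]: "(\<lambda>z. ennreal (tilted L c n (fst z) (snd z))) \<in> borel_measurable (data0 n \<Otimes>\<^sub>M state_space)"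
        by (rule measurable_compose[OF tilted_measurable measurable_ennreal])
      show ?thesis by measurable
    qed
    have um: "u \<in> borel_measurable state_space"
    proof -
      have "(\<lambda>z. indicator V (snd z) * ennreal (tilted L c n (snd z) (fst z))) \<in> borel_measurable (state_space \<Otimes>\<^sub>M data0 n)"
        using measurable_compose[OF measurable_pair_swap' tm] by (simp add: case_prod_beta')
      from D.borel_measurable_nn_integral_fst[OF this] show ?thesis
        unfolding u_def[abs_def] by simp
    qed
    define E where "E = 2 * exp (c * (3 * ln (real n) + 2))"
    have E0: "E \<ge> 0" by (simp add: E_def)
    have u_good: "u (\<theta>, N, s) \<le> ennreal (E * exp (b * real s))"
      if N: "1 \<le> N" "N \<le> n" and \<gamma>: "\<gamma> \<subseteq> coords_N p L N" "card \<gamma> = s" "s \<le> n"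
        and \<theta>: "\<forall>c. c \<notin> \<gamma> \<longrightarrow> \<theta> c = 0" "\<forall>c. \<bar>\<theta> c\<bar> \<le> real n" for N s \<gamma> \<theta>
    proof -
      let ?f = "net_N p L N \<theta>"
      have fm: "?f \<in> borel_measurable (\<Pi>\<^sub>M i\<in>{..<p}. borel)" by (rule net_N_measurable[OF p])
      note llrm[measurable] = llr_measurable[OF fm]
      define W where "W = exp (c * (real s * (16 * real L * ln (real n)) + 3 * ln (real n) + 2))"
      have "u (\<theta>, N, s) \<le> (\<integral>\<^sup>+D. ennreal W * (1 + ennreal (exp (llr ?f n D))) \<partial>data0 n)"
        unfolding u_def
      proof (intro nn_integral_mono)
        fix D assume "D \<in> space (data0 n)"
        show "indicator V D * ennreal (tilted L c n D (\<theta>, N, s)) \<le> ennreal W * (1 + ennreal (exp (llr ?f n D)))"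
        proof (cases "D \<in> V")
          case True
          then have D: "D \<in> A1" "\<forall>i<n. fst (D i) \<in> cube p" "(\<Sum>i<n. \<bar>snd (D i)\<bar>) \<le> (real n)\<^sup>2"
            using Zc[of D] \<open>D \<in> space (data0 n)\<close> by (auto simp: V_def Y_def)
          define l where "l = llr ?f n D"
          have "l / 2 + real n * hell ?f \<le> real s * (16 * real L * ln (real n)) + 3 * ln (real n) + 2"
            using A1h D N \<gamma> \<theta> unfolding controlled_def l_def by blast
          then have "c * (l / 2 + real n * hell ?f) \<le> c * (real s * (16 * real L * ln (real n)) + 3 * ln (real n) + 2)"
            using c by (intro mult_left_mono) auto
          \<comment> \<open>Only the fraction \<open>c\<close> of the controlled quantity is spent.
            What remains is the power \<open>1 - c / 2\<close> of the likelihood ratio, which lies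
            below the sum of its powers 0 and 1 and hence has mean at most 2.\<close>
          then have "l + c * real n * hell ?f \<le> c * (real s * (16 * real L * ln (real n)) + 3 * ln (real n) + 2) + (1 - c / 2) * l"
            by (simp add: algebra_simps)
          then have "exp (l + c * real n * hell ?f) \<le> W * exp ((1 - c / 2) * l)"
            unfolding W_def by (simp add: mult_exp_exp)
          also have "exp ((1 - c / 2) * l) \<le> 1 + exp l"
          proof (cases "l \<ge> 0")
            case True
            then have "(1 - c / 2) * l \<le> 1 * l" using c by (intro mult_right_mono) auto
            then have "exp ((1 - c / 2) * l) \<le> exp l" by simp
            then show ?thesis by (rule order_trans) simp
          next
            case False
            then have "(1 - c / 2) * l \<le> 0" using c by (intro mult_nonneg_nonpos) auto
            then have "exp ((1 - c / 2) * l) \<le> 1" by simp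
            then show ?thesis by (rule order_trans) simp
          qed
          finally have "exp (l + c * real n * hell ?f) \<le> W * (1 + exp l)" by (simp add: W_def)
          then show ?thesis
            using True by (simp add: tilted_def l_def W_def ennreal_mult[symmetric] ennreal_1[symmetric]
                ennreal_plus[symmetric] ennreal_leI del: ennreal_plus ennreal_1)
        qed simp
      qed
      also have "\<dots> = ennreal W * (1 + 1)"
        using D.emeasure_space_1 nn_integral_exp_llr_1[OF fm, of n]
        by (simp add: nn_integral_cmult nn_integral_add)
      also have "\<dots> = ennreal (W * 2)" by (simp add: ennreal_mult W_def)
      also have "W * 2 = E * exp (b * real s)"
        by (simp add: W_def E_def b_def mult_exp_exp algebra_simps)
      finally show ?thesis .
    qed
    \<comment> \<open>Valid without any control: the Hellinger term is at most \<open>exp n\<close>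
      since \<open>c \<le> 1\<close> and \<open>hell \<le> 1\<close>, and the likelihood ratio has
      mean 1.\<close>
    have u_all: "u (\<theta>, N, s) \<le> ennreal (exp (real n))" for \<theta> N s
    proof -
      let ?f = "net_N p L N \<theta>"
      have fm: "?f \<in> borel_measurable (\<Pi>\<^sub>M i\<in>{..<p}. borel)" by (rule net_N_measurable[OF p])
      note llrm[measurable] = llr_measurable[OF fm]
      have "c * (real n * hell ?f) \<le> 1 * (real n * 1)"
        using c hell_le_1[OF fm] hell_nonneg[of ?f] by (intro mult_mono) auto
      then have "tilted L c n D (\<theta>, N, s) \<le> exp (real n) * exp (llr ?f n D)" for D
        by (simp add: tilted_def mult_exp_exp mult.assoc)
      then have "u (\<theta>, N, s) \<le> (\<integral>\<^sup>+D. ennreal (exp (real n)) * ennreal (exp (llr ?f n D)) \<partial>data0 n)"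
        unfolding u_def
        by (intro nn_integral_mono) (auto simp: indicator_def ennreal_mult[symmetric] intro!: ennreal_leI)
      also have "\<dots> = ennreal (exp (real n))"
        using nn_integral_exp_llr_1[OF fm, of n] by (simp add: nn_integral_cmult)
      finally show ?thesis .
    qed
    have u_le: "(\<integral>\<^sup>+\<theta>. u (\<theta>, N, s) \<partial>slab_params S p L N \<gamma>) \<le>
        ennreal (E * exp (b * real s) + exp (2 * real N) / exp (real n) + (1 + CS) * exp (2 * real s) / exp (real n))"
      if N: "N \<ge> 1" and \<gamma>: "\<gamma> \<subseteq> coords_N p L N" "card \<gamma> = s" for N s \<gamma>
    proof -
      interpret Q: prob_space "slab_params S p L N \<gamma>" by (rule prob_space_slab_params[OF adm lam])
      have fin: "finite \<gamma>" using \<gamma>(1) finite_coords by (rule finite_subset)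
      have [measurable]: "(\<lambda>\<theta>. exp (2 * \<bar>\<theta> c\<bar>)) \<in> borel_measurable param_space" for c :: coord
        by (rule measurable_compose[OF param_component_measurable]) measurable
      let ?w = "\<lambda>\<theta>::param. \<Sum>c\<in>\<gamma>. ennreal (exp (2 * \<bar>\<theta> c\<bar>))"
      let ?C = "E * exp (b * real s) + exp (2 * real N) / exp (real n) + exp (2 * real s) / exp (real n)"
      have supp: "AE \<theta> in slab_params S p L N \<gamma>. \<forall>c. c \<in> \<gamma> \<or> \<theta> c = 0"
      proof (rule AE_indep_coords)
        fix c assume "c \<in> coords_N p L N"
        show "AE x in slabs S \<gamma> c. c \<in> \<gamma> \<or> x = 0" 
        proof (cases "c \<in> \<gamma>")
          case False
          then have "slabs S \<gamma> c = return borel 0" by (simp add: slabs_def)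
          then show ?thesis by (simp only:) (subst AE_return; simp)
        qed simp
      qed (auto intro: prob_space_slabs[OF adm])
      have "(\<integral>\<^sup>+\<theta>. u (\<theta>, N, s) \<partial>slab_params S p L N \<gamma>) \<le>
          (\<integral>\<^sup>+\<theta>. ennreal ?C + ennreal (1 / exp (real n)) * ?w \<theta> \<partial>slab_params S p L N \<gamma>)"
      proof (intro nn_integral_mono_AE, use supp in eventually_elim)
        case (elim \<theta>)
        \<comment> \<open>In the last three cases the quantity that exceeds \<open>n\<close> turns
          the crude bound \<open>exp n\<close> into one of the tail terms, by
          \<open>exp n * exp n \<le> exp (2 * y)\<close> for \<open>y > n\<close>. A weight that
          exceeds \<open>n\<close> is nonzero, hence almost surely in \<open>\<gamma>\<close>, so
          the sum in \<open>?w\<close> catches it.\<close>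
        consider "N \<le> n \<and> s \<le> n \<and> (\<forall>c. \<bar>\<theta> c\<bar> \<le> real n)" | "n < N" | "n < s" | c where "\<bar>\<theta> c\<bar> > real n"
          by (meson not_le)
        then show ?case
        proof cases
          case 1
          then have "u (\<theta>, N, s) \<le> ennreal (E * exp (b * real s))" using elim N \<gamma> by (intro u_good[of N \<gamma> s \<theta>]) auto
          also have "\<dots> \<le> ennreal ?C" by (intro ennreal_leI) simp
          finally show ?thesis by (rule order_trans) simp
        next
          case 2
          then have "exp (real n) * exp (real n) \<le> exp (2 * real N)" by (simp add: mult_exp_exp)
          then have "exp (real n) \<le> exp (2 * real N) / exp (real n)" by (simp add: field_simps)
          then have "ennreal (exp (real n)) \<le> ennreal ?C" using E0 by (intro ennreal_leI) (simp add: add_increasing add_increasing2)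
          with u_all[of \<theta> N s] have "u (\<theta>, N, s) \<le> ennreal ?C" by (rule order_trans)
          then show ?thesis by (rule order_trans) simp
        next
          case 3
          then have "exp (real n) * exp (real n) \<le> exp (2 * real s)" by (simp add: mult_exp_exp)
          then have "exp (real n) \<le> exp (2 * real s) / exp (real n)" by (simp add: field_simps)
          then have "ennreal (exp (real n)) \<le> ennreal ?C" using E0 by (intro ennreal_leI) (simp add: add_increasing add_increasing2)
          with u_all[of \<theta> N s] have "u (\<theta>, N, s) \<le> ennreal ?C" by (rule order_trans)
          then show ?thesis by (rule order_trans) simp
        next
          case 4
          then have "\<theta> c \<noteq> 0" by auto
          then have "c \<in> \<gamma>" using elim by blast
          have "exp (real n) * exp (real n) \<le> exp (2 * \<bar>\<theta> c\<bar>)" using 4 by (simp add: mult_exp_exp)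
          then have "exp (real n) \<le> 1 / exp (real n) * exp (2 * \<bar>\<theta> c\<bar>)" by (simp add: field_simps)
          then have "ennreal (exp (real n)) \<le> ennreal (1 / exp (real n)) * ennreal (exp (2 * \<bar>\<theta> c\<bar>))"
            by (subst ennreal_mult[symmetric]) (auto intro: ennreal_leI)
          also have "\<dots> \<le> ennreal (1 / exp (real n)) * ?w \<theta>"
            using \<open>c \<in> \<gamma>\<close> fin by (intro mult_left_mono member_le_sum) auto
          finally have "u (\<theta>, N, s) \<le> ennreal (1 / exp (real n)) * ?w \<theta>" using u_all[of \<theta> N s] by (rule order_trans[rotated])
          then show ?thesis by (rule order_trans) simp
        qed
      qed
      also have "\<dots> = ennreal ?C + ennreal (1 / exp (real n)) * (\<Sum>c\<in>\<gamma>. \<integral>\<^sup>+\<theta>. ennreal (exp (2 * \<bar>\<theta> c\<bar>)) \<partial>slab_params S p L N \<gamma>)"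
        using Q.emeasure_space_1 by (simp add: nn_integral_add nn_integral_cmult nn_integral_sum del: sum_ennreal)
      also have "\<dots> \<le> ennreal ?C + ennreal (1 / exp (real n)) * (\<Sum>c\<in>\<gamma>. ennreal CS)"
      proof (intro add_left_mono mult_left_mono sum_mono)
        fix c assume c: "c \<in> \<gamma>"
        have "(\<integral>\<^sup>+\<theta>. ennreal (exp (2 * \<bar>\<theta> c\<bar>)) \<partial>slab_params S p L N \<gamma>) = (\<integral>\<^sup>+x. ennreal (exp (2 * \<bar>x\<bar>)) \<partial>slabs S \<gamma> c)"
          using c \<gamma>(1) by (intro nn_integral_indep_coords_component) (auto intro: prob_space_slabs[OF adm])
        then show "(\<integral>\<^sup>+\<theta>. ennreal (exp (2 * \<bar>\<theta> c\<bar>)) \<partial>slab_params S p L N \<gamma>) \<le> ennreal CS"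
          using CS(2) c by (simp add: slabs_def)
      qed auto
      also have "\<dots> = ennreal (?C + real s * CS / exp (real n))"
        using E0 CS \<gamma>(2) by (simp add: ennreal_of_nat_eq_real_of_nat ennreal_mult[symmetric] ennreal_plus[symmetric] del: ennreal_plus)
      also have "\<dots> \<le> ennreal (E * exp (b * real s) + exp (2 * real N) / exp (real n) + (1 + CS) * exp (2 * real s) / exp (real n))"
      proof (intro ennreal_leI)
        have "real s \<le> exp (2 * real s)" using exp_ge_add_one_self[of "2 * real s"] by linarith
        then have "real s * CS / exp (real n) \<le> exp (2 * real s) * CS / exp (real n)"
          using CS by (intro divide_right_mono mult_right_mono) auto
        then show "?C + real s * CS / exp (real n) \<le>
            E * exp (b * real s) + exp (2 * real N) / exp (real n) + (1 + CS) * exp (2 * real s) / exp (real n)"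
          by (simp add: distrib_right add_divide_distrib mult.commute)
      qed
      finally show ?thesis .
    qed
    have "(\<integral>\<^sup>+t. u t \<partial>prior S p L lam lams) \<le>
        ennreal (2 * E + (exp (lam * exp 2) / (exp lam - 1) + 2 * (1 + CS)) / exp (real n))"
      using CS by (intro nn_integral_prior_le[OF adm lam um b _ E0 u_le]) auto
    also have "\<dots> \<le> ennreal ((4 * exp 2 + C2) * real n ^ 3)"
    proof (intro ennreal_leI)
      \<comment> \<open>With \<open>c \<le> 1\<close> the threshold term \<open>3 * ln n + 2\<close>
        of \<open>controlled\<close> contributes at most \<open>exp 2 * n ^ 3\<close>.\<close>
      have "c * (3 * ln (real n) + 2) \<le> 1 * (3 * ln (real n) + 2)" using c lnn0 by (intro mult_right_mono) auto
      then have "exp (c * (3 * ln (real n) + 2)) \<le> exp (3 * ln (real n) + 2)" by simp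
      also have "\<dots> = exp 2 * real n ^ 3"
        using n_pos exp_of_nat_mult[of 3 "ln (real n)"] by (simp add: exp_add)
      finally have "2 * E \<le> 4 * exp 2 * real n ^ 3" by (simp add: E_def)
      moreover have "C2 / exp (real n) \<le> C2 * real n ^ 3"
      proof -
        have "C2 / exp (real n) \<le> C2" using C2 by (simp add: divide_le_eq mult_left_mono[of 1 _ C2, simplified])
        also have "\<dots> \<le> C2 * real n ^ 3" using C2 nr by (simp add: mult_left_mono[of 1 _ C2, simplified] one_le_power)
        finally show ?thesis .
      qed
      ultimately show "2 * E + (exp (lam * exp 2) / (exp lam - 1) + 2 * (1 + CS)) / exp (real n) \<le> (4 * exp 2 + C2) * real n ^ 3"
        by (simp add: C2_def distrib_right)
    qed
    finally have uP: "(\<integral>\<^sup>+t. u t \<partial>prior S p L lam lams) \<le> ennreal ((4 * exp 2 + C2) * real n ^ 3)" .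
    define J where "J D = (\<integral>\<^sup>+t. ennreal (tilted L c n D t) \<partial>prior S p L lam lams)" for D
    have tmP: "(\<lambda>z. ennreal (tilted L c n (fst z) (snd z))) \<in> borel_measurable (data0 n \<Otimes>\<^sub>M prior S p L lam lams)"
      using measurable_compose[OF tilted_measurable measurable_ennreal, of L c n] sP
      by (simp cong: measurable_cong_sets sets_pair_measure_cong)
    have Jm[measurable]: "J \<in> borel_measurable (data0 n)"
      using P.borel_measurable_nn_integral_fst[OF tmP] unfolding J_def[abs_def] by simp
    have "(\<integral>\<^sup>+D. indicator V D * J D \<partial>data0 n) =
        (\<integral>\<^sup>+D. \<integral>\<^sup>+t. indicator V D * ennreal (tilted L c n D t) \<partial>prior S p L lam lams \<partial>data0 n)"
    proof (intro nn_integral_cong)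
      fix D assume "D \<in> space (data0 n)"
      then have "(\<lambda>t. ennreal (tilted L c n D t)) \<in> borel_measurable (prior S p L lam lams)"
        using measurable_compose[OF measurable_Pair1' tmP] by simp
      then show "indicator V D * J D = (\<integral>\<^sup>+t. indicator V D * ennreal (tilted L c n D t) \<partial>prior S p L lam lams)"
        unfolding J_def by (rule nn_integral_cmult[symmetric])
    qed
    also have "\<dots> = (\<integral>\<^sup>+t. u t \<partial>prior S p L lam lams)"
      unfolding u_def
    proof (rule PD.Fubini'[symmetric])
      show "case_prod (\<lambda>D t. indicator V D * ennreal (tilted L c n D t)) \<in> borel_measurable (data0 n \<Otimes>\<^sub>M prior S p L lam lams)"
        using tm sP by (simp add: case_prod_beta' cong: measurable_cong_sets sets_pair_measure_cong)
    qed
    also note uP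
    finally have "D.prob {D \<in> space (data0 n). indicator V D * J D > ennreal (real n ^ 5)} \<le>
        (4 * exp 2 + C2) * real n ^ 3 / real n ^ 5"
      using n_pos C2 by (intro D.prob_gt_le_nn_integral_ennreal) auto
    also have "\<dots> = (4 * exp 2 + C2) * (1 / (real n)\<^sup>2)"
      using n_pos by (simp add: power_numeral_reduce field_simps)
    also have "\<dots> \<le> (4 * exp 2 + C2) * (1 / real n)"
      using nr C2 by (intro mult_left_mono) (auto simp: power2_eq_square field_simps)
    finally have Bp: "D.prob {D \<in> space (data0 n). indicator V D * J D > ennreal (real n ^ 5)} \<le> (4 * exp 2 + C2) / real n"
      by simp
    define A where "A = V - {D \<in> space (data0 n). indicator V D * J D > ennreal (real n ^ 5)}"
    have Am[measurable]: "A \<in> sets (data0 n)" unfolding A_def by measurable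
    have "space (data0 n) - A \<subseteq> (space (data0 n) - A1) \<union> (Y \<union> (Z \<union> {D \<in> space (data0 n). indicator V D * J D > ennreal (real n ^ 5)}))"
      by (auto simp: A_def V_def)
    then have "D.prob (space (data0 n) - A) \<le> D.prob ((space (data0 n) - A1) \<union> (Y \<union> (Z \<union> {D \<in> space (data0 n). indicator V D * J D > ennreal (real n ^ 5)})))"
      by (intro D.finite_measure_mono) measurable
    also have "\<dots> \<le> D.prob (space (data0 n) - A1) + (D.prob Y + (D.prob Z + D.prob {D \<in> space (data0 n). indicator V D * J D > ennreal (real n ^ 5)}))"
      by (intro order_trans[OF measure_Un_le] add_left_mono order_refl) measurable
    also have "\<dots> \<le> 2 / real n + ((F0 + 1 + \<sigma>\<^sup>2) / real n + (0 + (4 * exp 2 + C2) / real n))"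
      using response_event[OF F0 f0b nr(3)] by (intro add_mono A1p Bp) (auto simp: Y_def Z0)
    also have "\<dots> = K / real n" by (simp add: K_def add_divide_distrib)
    finally have "D.prob (space (data0 n) - A) \<le> K / real n" .
    moreover have "J D \<le> ennreal (real n ^ 5)" if "D \<in> A" for D
      using that sets.sets_into_space[OF Am] by (auto simp: A_def not_less)
    ultimately show ?thesis using Am unfolding J_def by blast
  qed
  then show ?thesis using c K by blast
qed

end

section \<open>The variational posterior and its competitors\<close>

text \<open>At inclusion probability 1 or 0 the Bernoulli mixture degenerates. A competitor with a
  deterministic support therefore belongs to the variational family.\<close>

lemma
  assumes "M \<in> var_slabs S"
  shows prob_space_spike_slab: "prob_space (spike_slab \<nu> M)"
    and sets_spike_slab: "sets (spike_slab \<nu> M) = sets borel"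
    and spike_slab_1: "spike_slab 1 M = M" and spike_slab_0: "spike_slab 0 M = return borel 0"
proof -
  let ?K = "\<lambda>g. if g then M else return borel 0"
  have M: "prob_space M" "sets M = sets borel" using assms var_slabs_prob_space sets_var_slabs by auto
  have "?K g \<in> space (subprob_algebra borel)" for g
    using M prob_space_imp_subprob_space[OF M(1)] prob_space_imp_subprob_space[OF prob_space_return[of 0 borel]]
    by (auto simp: space_subprob_algebra)
  then have K: "?K \<in> measurable (measure_pmf P) (subprob_algebra borel)" for P by auto
  show "prob_space (spike_slab \<nu> M)"
    unfolding spike_slab_def using M(1)
    by (intro measure_pmf.prob_space_bind[OF _ K]) (auto intro: prob_space_return)
  show "sets (spike_slab \<nu> M) = sets borel"
    unfolding spike_slab_def using M(2) by (intro sets_bind) auto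
  have ret: "measure_pmf (return_pmf g) \<bind> ?K = ?K g" for g
    using bind_return[of ?K "count_space UNIV" borel g] K[of undefined] by (simp add: return_pmf.rep_eq)
  have "bernoulli_pmf 1 = return_pmf True" "bernoulli_pmf 0 = return_pmf False"
    by (auto intro!: pmf_eqI simp: pmf_return indicator_def)
  then show "spike_slab 1 M = M" "spike_slab 0 M = return borel 0"
    unfolding spike_slab_def using ret[of True] ret[of False] by auto
qed

lemma var_family_prob_space:
  assumes "q \<in> var_family S p L"
  shows "prob_space q" and "sets q = sets state_space"
proof -
  obtain N s \<nu> M where q: "q = at_Ns (indep_coords (coords_N p L N) (\<lambda>c. spike_slab (\<nu> c) (M c))) N s"
    and M: "\<And>c. c \<in> coords_N p L N \<Longrightarrow> M c \<in> var_slabs S"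
    using assms unfolding var_family_def by blast
  have "prob_space (indep_coords (coords_N p L N) (\<lambda>c. spike_slab (\<nu> c) (M c)))"
    by (rule prob_space_indep_coords) (simp_all add: prob_space_spike_slab[OF M] sets_spike_slab[OF M])
  then show "prob_space q" unfolding q by (rule prob_space_at_Ns) simp
  show "sets q = sets state_space" unfolding q by (rule sets_at_Ns) simp
qed

section \<open>Posterior and variational risk for fixed data\<close>

context bayes_net
begin

context
  fixes L n :: nat and lams :: real and D :: "nat \<Rightarrow> obs"
  assumes D: "D \<in> space (data0 n)"
begin

text \<open>The marginal likelihood divided by the likelihood of \<open>f0\<close>. That factor does
  not depend on the parameter and cancels in the posterior, so everything can be expressed by
  likelihood ratios.\<close>

definition evidence :: real where
  "evidence = enn2real (\<integral>\<^sup>+t. ennreal (tilted L 0 n D t) \<partial>prior S p L lam lams)"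

abbreviation (input) post :: "(param \<times> nat \<times> nat) measure" where
  "post \<equiv> posterior S p \<sigma> L lam lams n D"

lemma tilted_measurable_state: "tilted L c n D \<in> borel_measurable state_space"
  using measurable_compose[OF measurable_Pair1'[OF D] tilted_measurable[of L c n]] by simp

lemma tilted_pos: "tilted L c n D t > 0"
  by (cases t) (simp add: tilted_def)

lemma evidence_eq: "ennreal evidence = (\<integral>\<^sup>+t. ennreal (tilted L 0 n D t) \<partial>prior S p L lam lams)" (is "_ = ?Z")
  and evidence_pos: "evidence > 0"
proof -
  interpret P: prob_space "prior S p L lam lams" by (rule prob_space_prior[OF adm lam])
  have [measurable]: "tilted L 0 n D \<in> borel_measurable (prior S p L lam lams)"
    using tilted_measurable_state measurable_cong_sets[OF sets_prior[OF adm lam] refl] by blast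
  \<comment> \<open>Dropping the nonpositive term of each summand of \<open>llr\<close> bounds the
    likelihood ratio by a constant that depends only on the data, so the evidence is finite for
    every data set and no exceptional event is needed.\<close>
  define b where "b = exp (\<Sum>i<n. (snd (D i) - f0 (fst (D i)))\<^sup>2 / (2 * \<sigma>\<^sup>2))"
  have "tilted L 0 n D t \<le> b" for t
    by (cases t) (auto simp: tilted_def b_def llr_def intro!: sum_mono divide_right_mono)
  then have "?Z \<le> (\<integral>\<^sup>+t. ennreal b \<partial>prior S p L lam lams)" by (intro nn_integral_mono ennreal_leI)
  also have "\<dots> < \<infinity>" by (simp add: P.emeasure_space_1)
  finally have fin: "?Z < \<infinity>" .
  then show "ennreal evidence = ?Z" unfolding evidence_def by simp
  have "?Z \<noteq> 0"
  proof
    assume "?Z = 0"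
    then have "AE t in prior S p L lam lams. ennreal (tilted L 0 n D t) = 0"
      by (subst (asm) nn_integral_0_iff_AE) auto
    then have "AE t in prior S p L lam lams. False"
      by eventually_elim (use tilted_pos in \<open>auto simp: ennreal_eq_0_iff not_le[symmetric]\<close>)
    then show False using P.AE_False by simp
  qed
  with fin show "evidence > 0" unfolding evidence_def
    by (simp add: enn2real_positive_iff zero_less_iff_neq_zero)
qed

lemma posterior_eq: "post = density (prior S p L lam lams) (\<lambda>t. ennreal (tilted L 0 n D t / evidence))"
proof -
  let ?l = "likelihood \<sigma> f0 n D"
  have l: "?l > 0" by (rule likelihood_pos)
  have [measurable]: "tilted L 0 n D \<in> borel_measurable (prior S p L lam lams)"
    using tilted_measurable_state measurable_cong_sets[OF sets_prior[OF adm lam] refl] by blast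
  define lik where "lik = (\<lambda>(\<theta>, N, s::nat). ennreal (likelihood \<sigma> (net_N p L N \<theta>) n D))"
  have lik: "lik t = ennreal ?l * ennreal (tilted L 0 n D t)" for t
    using l by (cases t) (simp add: lik_def tilted_def likelihood_eq_llr[of "net_N p L _ _"] ennreal_mult)
  have "(\<integral>\<^sup>+t. lik t \<partial>prior S p L lam lams) = ennreal ?l * ennreal evidence"
    unfolding lik evidence_eq by (rule nn_integral_cmult) measurable
  then have "lik t / (\<integral>\<^sup>+t. lik t \<partial>prior S p L lam lams) = ennreal (tilted L 0 n D t / evidence)" for t
    using l evidence_pos tilted_pos[of 0 t] unfolding lik
    by (simp add: ennreal_mult[symmetric] divide_ennreal)
  then show ?thesis unfolding posterior_def lik_def[symmetric] Let_def by simp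
qed

lemma sets_posterior: "sets post = sets state_space"
  unfolding posterior_eq by (simp add: sets_prior[OF adm lam])

lemma nn_integral_posterior:
  assumes "u \<in> borel_measurable state_space"
  shows "(\<integral>\<^sup>+t. u t \<partial>post) = (\<integral>\<^sup>+t. ennreal (tilted L 0 n D t / evidence) * u t \<partial>prior S p L lam lams)"
proof -
  note mc = measurable_cong_sets[OF sets_prior[OF adm lam, of p L lams] refl, of borel]
  have [measurable]: "tilted L 0 n D \<in> borel_measurable (prior S p L lam lams)"
    using tilted_measurable_state mc by blast
  show ?thesis unfolding posterior_eq using assms mc by (intro nn_integral_density) auto
qed

lemma prob_space_posterior: "prob_space post"
proof
  have "emeasure post (space post) = (\<integral>\<^sup>+t. 1 \<partial>post)" by simp
  also have "\<dots> = (\<integral>\<^sup>+t. ennreal (tilted L 0 n D t / evidence) * 1 \<partial>prior S p L lam lams)"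
    by (rule nn_integral_posterior) simp
  also have "\<dots> = (\<integral>\<^sup>+t. ennreal (1 / evidence) * ennreal (tilted L 0 n D t) \<partial>prior S p L lam lams)"
    using evidence_pos tilted_pos by (intro nn_integral_cong) (simp add: ennreal_mult[symmetric] less_imp_le)
  also have "\<dots> = ennreal (1 / evidence) * ennreal evidence"
    unfolding evidence_eq using tilted_measurable_state measurable_cong_sets[OF sets_prior[OF adm lam, of p L lams] refl, of borel]
    by (intro nn_integral_cmult measurable_compose[OF _ measurable_ennreal]) auto
  also have "\<dots> = 1" using evidence_pos by (simp add: ennreal_mult[symmetric])
  finally show "emeasure post (space post) = 1" .
qed

lemma hell_measurable_state: "(\<lambda>(\<theta>, N, s). hell (net_N p L N \<theta>)) \<in> borel_measurable state_space"
proof -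
  have "(\<lambda>t. hell (net_N p L N (fst t))) \<in> borel_measurable state_space" for N
    by (rule measurable_compose[OF measurable_fst hell_net_measurable])
  moreover have "(\<lambda>t. fst (snd t)) \<in> measurable state_space (count_space UNIV)" by measurable
  ultimately have "(\<lambda>t. hell (net_N p L (fst (snd t)) (fst t))) \<in> borel_measurable state_space"
    by (rule measurable_compose_countable)
  then show ?thesis by (simp add: case_prod_beta')
qed

text \<open>The evidence cancels between the two Kullback-Leibler divergences and the exponential
  moment under the posterior.\<close>

lemma adaptive_vp_hellinger_le:
  assumes q: "is_adaptive_vp S p \<sigma> L lam lams n D q"
    and q': "q' \<in> var_family S p L" "KL q' post \<le> ereal (R + ln evidence)"
    and J: "J > 0" "(\<integral>\<^sup>+t. ennreal (tilted L c n D t) \<partial>prior S p L lam lams) \<le> ennreal J"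
    and c: "c > 0" and n: "n \<ge> 1"
  shows "(\<integral>(\<theta>, N, s). hell (net_N p L N \<theta>) \<partial>q) \<le> (R + ln J) / (c * real n)"
proof -
  \<comment> \<open>Minimality only says that no competitor is strictly better; on the linearly
    ordered extended reals this is the inequality needed next.\<close>
  have qf: "q \<in> var_family S p L" and "\<not> KL q' post < KL q post"
    using q q'(1) unfolding is_adaptive_vp_def is_arg_min_def by auto
  then have KL: "KL q post \<le> ereal (R + ln evidence)" using q'(2) by (auto intro: order_trans)
  note Q = var_family_prob_space[OF qf]
  interpret Q: prob_space q by (rule Q)
  define h where "h = (\<lambda>(\<theta>, N, s::nat). hell (net_N p L N \<theta>))"
  have h: "h \<in> borel_measurable state_space" unfolding h_def by (rule hell_measurable_state)
  have hq: "h \<in> borel_measurable q" using h measurable_cong_sets[OF Q(2) refl] by blast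
  have h01: "0 \<le> h t" "h t \<le> 1" for t
    by (cases t; simp add: h_def hell_nonneg hell_le_1 net_N_measurable[OF p])+
  have ih: "integrable q h"
    by (rule Q.integrable_const_bound[of _ 1]) (use h01 hq in auto)
  have exp_h: "exp (c * real n * h t) * tilted L 0 n D t = tilted L c n D t" for t
    by (cases t) (simp add: h_def tilted_def mult_exp_exp add.commute)
  have hm[measurable]: "(\<lambda>t. c * real n * h t) \<in> borel_measurable state_space" using h by measurable
  have "(\<integral>\<^sup>+t. ennreal (exp (c * real n * h t)) \<partial>post) =
      (\<integral>\<^sup>+t. ennreal (tilted L 0 n D t / evidence) * ennreal (exp (c * real n * h t)) \<partial>prior S p L lam lams)"
    by (rule nn_integral_posterior) measurable
  also have "\<dots> = (\<integral>\<^sup>+t. ennreal (1 / evidence) * ennreal (tilted L c n D t) \<partial>prior S p L lam lams)"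
    using evidence_pos tilted_pos
    by (intro nn_integral_cong) (simp add: exp_h[symmetric] ennreal_mult[symmetric] less_imp_le mult.commute)
  also have "\<dots> = ennreal (1 / evidence) * (\<integral>\<^sup>+t. ennreal (tilted L c n D t) \<partial>prior S p L lam lams)"
    using tilted_measurable_state measurable_cong_sets[OF sets_prior[OF adm lam, of p L lams] refl, of borel]
    by (intro nn_integral_cmult measurable_compose[OF _ measurable_ennreal]) auto
  also have "\<dots> \<le> ennreal (1 / evidence) * ennreal J" by (intro mult_left_mono J) auto
  also have "\<dots> = ennreal (J / evidence)" using evidence_pos J by (simp add: ennreal_mult[symmetric])
  finally have mom: "(\<integral>\<^sup>+t. ennreal (exp (c * real n * h t)) \<partial>post) \<le> ennreal (J / evidence)" .
  have hp: "(\<lambda>t. c * real n * h t) \<in> borel_measurable post"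
    using hm measurable_cong_sets[OF sets_posterior refl] by blast
  have "ereal (\<integral>t. c * real n * h t \<partial>q) \<le> KL q post + ereal (ln (J / evidence))"
    using ih J evidence_pos
    by (intro integral_le_KL_plus_ln[OF prob_space_posterior Q(1) _ hp _ _ mom])
      (auto simp: Q(2) sets_posterior)
  also have "\<dots> \<le> ereal (R + ln evidence) + ereal (ln (J / evidence))" by (intro add_right_mono KL)
  finally have "c * real n * (\<integral>t. h t \<partial>q) \<le> R + ln J" using J evidence_pos by (simp add: ln_div)
  then show ?thesis using c n by (simp add: h_def field_simps)
qed

end

end

section \<open>Construction of the competitor around a near-optimal sparse network\<close>

lemma exp_mean_le_sum_exp:
  fixes a :: "'a \<Rightarrow> real"
  assumes "finite \<gamma>" "\<gamma> \<noteq> {}"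
  shows "exp ((\<Sum>c\<in>\<gamma>. a c) / real (card \<gamma>)) \<le> (\<Sum>c\<in>\<gamma>. exp (a c))"
proof -
  \<comment> \<open>Some term is at least the mean, and its exponential is one of the
    summands.\<close>
  have "\<exists>c\<in>\<gamma>. (\<Sum>c\<in>\<gamma>. a c) / real (card \<gamma>) \<le> a c"
  proof (rule ccontr)
    assume "\<not> ?thesis"
    then have "(\<Sum>c\<in>\<gamma>. a c) < (\<Sum>c\<in>\<gamma>. (\<Sum>c\<in>\<gamma>. a c) / real (card \<gamma>))"
      using assms by (intro sum_strict_mono) auto
    then show False using assms by simp
  qed
  then obtain c where c: "c \<in> \<gamma>" "exp ((\<Sum>c\<in>\<gamma>. a c) / real (card \<gamma>)) \<le> exp (a c)" by auto
  note c(2)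
  also have "exp (a c) \<le> (\<Sum>c\<in>\<gamma>. exp (a c))" using c(1) assms(1) by (intro member_le_sum) auto
  finally show ?thesis .
qed

text \<open>The perturbation bound involves \<open>exp U\<close> with \<open>U\<close> a sum over
  all active weights, while moments are available one coordinate at a time. Rescaled by
  \<open>\<eta> * s\<close>, \<open>U\<close> becomes an average, and the exponential of an average
  is at most a sum of one-coordinate exponentials. No product of \<open>s\<close> moments appears,
  so the cost is polynomial in \<open>s\<close>.\<close>

lemma net_close_sq:
  assumes N: "p \<ge> 1" "N \<ge> 1" "L \<ge> 1" and B: "B \<ge> 0"
    and \<theta>s: "\<And>c. c \<in> coords_N p L N \<Longrightarrow> \<bar>\<theta>s c\<bar> \<le> B" and x: "x \<in> cube p"
    and \<gamma>: "\<gamma> \<subseteq> coords_N p L N" "card \<gamma> = s" "s \<ge> 1"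
    and supp: "\<And>c. c \<notin> \<gamma> \<Longrightarrow> \<theta>s c = 0" "\<And>c. c \<notin> \<gamma> \<Longrightarrow> \<theta> c = 0"
    and \<eta>: "\<eta> > 0" "\<eta> * real s \<le> 1"
  shows "(net_N p L N \<theta> x - net_N p L N \<theta>s x)\<^sup>2 \<le>
    ((1 + layer_size p N * B) ^ L * (\<eta> * real s))\<^sup>2 * (\<Sum>c\<in>\<gamma>. exp (4 * \<bar>\<theta> c - \<theta>s c\<bar> / \<eta>))"
proof -
  let ?G = "(1 + layer_size p N * B) ^ L"
  have G0: "?G \<ge> 0" using B layer_size_nonneg[of p N] by simp
  have fin: "finite \<gamma>" using \<gamma>(1) by (rule finite_subset) simp
  define U where "U = (\<Sum>c\<in>\<gamma>. \<bar>\<theta> c - \<theta>s c\<bar>)"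
  have U0: "U \<ge> 0" unfolding U_def by (intro sum_nonneg) auto
  \<comment> \<open>The average rescaled deviation. Both \<open>Y \<le> exp Y\<close> and
    \<open>U \<le> Y\<close>, the latter from \<open>\<eta> * s \<le> 1\<close>, give a factor
    \<open>exp Y\<close>; squaring yields \<open>exp (4 * Y)\<close>, hence the order
    \<open>4 / \<eta>\<close> of the moments.\<close>
  define Y where "Y = U / (\<eta> * real s)"
  have es: "\<eta> * real s > 0" using \<eta> \<gamma> by simp
  have UY: "U = \<eta> * real s * Y" "Y \<ge> 0" using es U0 by (auto simp: Y_def)
  have "U \<le> 1 * Y" unfolding UY(1) using \<eta>(2) UY(2) by (rule mult_right_mono)
  have "(\<Sum>c\<in>coords_N p L N. \<bar>\<theta>s c - \<theta> c\<bar>) = U"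
    unfolding U_def using \<gamma>(1) supp by (subst abs_minus_commute, intro sum.mono_neutral_right) auto
  then have "\<bar>net_N p L N \<theta>s x - net_N p L N \<theta> x\<bar> \<le> ?G * (U * exp U)"
    by (intro net_perturbation[OF N B \<theta>s x]) auto
  also have "\<dots> \<le> ?G * ((\<eta> * real s * exp Y) * exp Y)"
  proof -
    have "Y \<le> exp Y" using exp_ge_add_one_self[of Y] by linarith
    then have "U \<le> \<eta> * real s * exp Y" unfolding UY(1) using es by (intro mult_left_mono) auto
    moreover have "exp U \<le> exp Y" using \<open>U \<le> 1 * Y\<close> by simp
    ultimately show ?thesis using G0 U0 es by (intro mult_left_mono mult_mono) auto
  qed
  finally have "\<bar>net_N p L N \<theta> x - net_N p L N \<theta>s x\<bar> \<le> ?G * (\<eta> * real s) * exp (2 * Y)"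
    by (simp add: abs_minus_commute mult_exp_exp mult.assoc)
  then have "\<bar>net_N p L N \<theta> x - net_N p L N \<theta>s x\<bar>\<^sup>2 \<le> (?G * (\<eta> * real s) * exp (2 * Y))\<^sup>2"
    by (rule power_mono) simp
  also have "\<dots> = (?G * (\<eta> * real s))\<^sup>2 * exp (4 * Y)"
    by (simp add: power_mult_distrib power2_eq_square mult_exp_exp)
  also have "4 * Y = (\<Sum>c\<in>\<gamma>. 4 * \<bar>\<theta> c - \<theta>s c\<bar> / \<eta>) / real (card \<gamma>)"
    using \<gamma> \<eta> by (simp add: Y_def U_def sum_divide_distrib[symmetric] sum_distrib_left[symmetric])
  also have "(?G * (\<eta> * real s))\<^sup>2 * exp \<dots> \<le> (?G * (\<eta> * real s))\<^sup>2 * (\<Sum>c\<in>\<gamma>. exp (4 * \<bar>\<theta> c - \<theta>s c\<bar> / \<eta>))"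
    using fin \<gamma> by (intro mult_left_mono exp_mean_le_sum_exp) auto
  finally show ?thesis by simp
qed

context bayes_net
begin

text \<open>The part of \<open>llr\<close> that is linear in the noise, up to the factor
  \<open>1 / \<sigma>\<^sup>2\<close>; the remainder is a multiple of the squared distance between
  \<open>f\<close> and \<open>f0\<close> at the design points.\<close>

definition noise_corr :: "((nat \<Rightarrow> real) \<Rightarrow> real) \<Rightarrow> nat \<Rightarrow> (nat \<Rightarrow> obs) \<Rightarrow> real" where
  "noise_corr f n D = (\<Sum>i<n. (snd (D i) - f0 (fst (D i))) * (f (fst (D i)) - f0 (fst (D i))))"

text \<open>Expanding the square separates the noise from the squared distance. The absolute value
  is kept because the divergence requires an integrable log-density and not merely a bound on its
  mean.\<close>

lemma abs_llr_le:
  assumes x: "\<And>i. i < n \<Longrightarrow> fst (D i) \<in> cube p" and H: "\<And>x. x \<in> cube p \<Longrightarrow> (f x - f0 x)\<^sup>2 \<le> H"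
  shows "\<bar>llr f n D\<bar> \<le> real n * H / (2 * \<sigma>\<^sup>2) + \<bar>noise_corr f n D\<bar> / \<sigma>\<^sup>2"
proof -
  have t: "(y - f0 x)\<^sup>2 - (y - f x)\<^sup>2 = 2 * ((y - f0 x) * (f x - f0 x)) - (f x - f0 x)\<^sup>2" for x y
    by (simp add: power2_eq_square algebra_simps)
  define Q where "Q = (\<Sum>i<n. (f (fst (D i)) - f0 (fst (D i)))\<^sup>2)"
  have "llr f n D = (2 * noise_corr f n D - Q) / (2 * \<sigma>\<^sup>2)"
    unfolding llr_def t noise_corr_def Q_def
    by (simp add: sum_divide_distrib[symmetric] sum_subtractf sum_distrib_left)
  also have "\<dots> = noise_corr f n D / \<sigma>\<^sup>2 - Q / (2 * \<sigma>\<^sup>2)" using \<sigma> by (simp add: diff_divide_distrib)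
  finally have "\<bar>llr f n D\<bar> \<le> \<bar>noise_corr f n D / \<sigma>\<^sup>2\<bar> + \<bar>Q / (2 * \<sigma>\<^sup>2)\<bar>" by linarith
  moreover have "0 \<le> Q" unfolding Q_def by (intro sum_nonneg) auto
  moreover have "Q \<le> real n * H"
    unfolding Q_def using sum_mono[of "{..<n}" "\<lambda>i. (f (fst (D i)) - f0 (fst (D i)))\<^sup>2" "\<lambda>_. H"] x H by simp
  then have "Q / (2 * \<sigma>\<^sup>2) \<le> real n * H / (2 * \<sigma>\<^sup>2)" by (intro divide_right_mono) auto
  ultimately show ?thesis by simp
qed

lemma noise_corr_measurable:
  "(\<lambda>z. noise_corr (net_N p L N (snd z)) n (fst z)) \<in> borel_measurable (data0 n \<Otimes>\<^sub>M param_space)"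
proof -
  have 1: "(\<lambda>z. fst z i) \<in> measurable (data0 n \<Otimes>\<^sub>M param_space) (obs_space p)" if "i < n" for i
    by (rule measurable_compose[OF measurable_fst obs_component_measurable[OF that]])
  have 2: "(\<lambda>z. net_N p L N (snd z) (fst (fst z i))) \<in> borel_measurable (data0 n \<Otimes>\<^sub>M param_space)"
    if "i < n" for i
    using measurable_compose[OF 1[OF that] measurable_fst] by (intro net_measurable[OF p]) auto
  show ?thesis unfolding noise_corr_def
    by (intro borel_measurable_sum borel_measurable_times borel_measurable_diff)
      (auto intro!: measurable_compose[OF 1 measurable_snd] measurable_compose[OF measurable_compose[OF 1 measurable_fst] f0] 2)
qed

lemma integral_at_Ns_le:
  assumes Q: "prob_space Q" "sets Q = sets param_space" and k: "k \<in> borel_measurable state_space"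
    and le: "(\<integral>\<^sup>+\<theta>. ennreal \<bar>k (\<theta>, N, s)\<bar> \<partial>Q) \<le> ennreal r" and r: "r \<ge> 0"
  shows "integrable (at_Ns Q N s) k" and "(\<integral>t. k t \<partial>at_Ns Q N s) \<le> r"
proof -
  have km: "k \<in> borel_measurable (at_Ns Q N s)"
    using k measurable_cong_sets[OF sets_at_Ns[OF Q(2)] refl] by blast
  have "(\<integral>\<^sup>+t. ennreal \<bar>k t\<bar> \<partial>at_Ns Q N s) = (\<integral>\<^sup>+\<theta>. ennreal \<bar>k (\<theta>, N, s)\<bar> \<partial>Q)"
    using k by (intro nn_integral_at_Ns[OF Q]) auto
  with le have nn: "(\<integral>\<^sup>+t. ennreal \<bar>k t\<bar> \<partial>at_Ns Q N s) \<le> ennreal r" by simp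
  then show int: "integrable (at_Ns Q N s) k"
    using km by (intro integrableI_bounded) (auto intro: le_less_trans)
  have "ennreal (\<integral>t. \<bar>k t\<bar> \<partial>at_Ns Q N s) \<le> ennreal r"
    using nn int by (subst nn_integral_eq_integral[symmetric]) auto
  then have "(\<integral>t. \<bar>k t\<bar> \<partial>at_Ns Q N s) \<le> r" using r by (simp add: ennreal_le_iff)
  moreover have "(\<integral>t. k t \<partial>at_Ns Q N s) \<le> (\<integral>t. \<bar>k t\<bar> \<partial>at_Ns Q N s)"
    using int by (intro integral_mono) auto
  ultimately show "(\<integral>t. k t \<partial>at_Ns Q N s) \<le> r" by simp
qed

text \<open>The competitor is dominated by \<open>exp\<close> of the summed slab prices times the
  slab law on \<open>\<gamma>\<close>, that law is at most \<open>1 / w\<close> times the prior, and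
  the prior is the posterior times the evidence over the likelihood ratio. The log-density against
  the posterior is thus at most the prices minus \<open>llr\<close>, minus \<open>ln w\<close>, plus
  \<open>ln\<close> of the evidence; \<open>r\<close> bounds the mean of the random part.\<close>

lemma KL_posterior_le:
  fixes k :: "coord \<Rightarrow> real \<Rightarrow> real"
  assumes D: "D \<in> space (data0 n)" and \<gamma>: "\<gamma> \<subseteq> coords_N p L N" "card \<gamma> = s"
    and w: "w > 0" "w \<le> pmf (prior_N lam) N * pmf (prior_s lams (card (coords_N p L N))) s / (card (coords_N p L N) choose s)"
    and M: "\<And>c. prob_space (M c)"
    and g: "\<And>c. g c \<in> borel_measurable borel" and dens: "\<And>c. M c = density (slabs S \<gamma> c) (g c)"
    and k: "\<And>c. k c \<in> borel_measurable borel" "\<And>c x. g c x \<le> ennreal (exp (k c x))"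
    and r: "r \<ge> 0" and le: "(\<integral>\<^sup>+\<theta>. ennreal \<bar>(\<Sum>c\<in>coords_N p L N. k c (\<theta> c)) - llr (net_N p L N \<theta>) n D\<bar>
      \<partial>indep_coords (coords_N p L N) M) \<le> ennreal r"
  shows "KL (at_Ns (indep_coords (coords_N p L N) M) N s) (posterior S p \<sigma> L lam lams n D) \<le>
    ereal (r - ln w + ln (evidence L n lams D))"
proof -
  let ?I = "coords_N p L N" and ?post = "posterior S p \<sigma> L lam lams n D"
  let ?Q = "indep_coords ?I M" and ?e = "evidence L n lams D"
  have Ms: "sets (M c) = sets borel" for c by (simp add: dens)
  have Q: "prob_space ?Q" by (rule prob_space_indep_coords) (simp_all add: M Ms)
  have e: "?e > 0" by (rule evidence_pos[OF D])
  \<comment> \<open>Written with \<open>ln (tilted L 0 n D t)\<close> and not with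
    \<open>llr\<close>, so that it is a function on the whole state space whose measurability is
    already known; at width \<open>N\<close> it is the integrand of the hypothesis.\<close>
  define k0 where "k0 t = (\<Sum>c\<in>?I. k c (fst t c)) - ln (tilted L 0 n D t)" for t :: "param \<times> nat \<times> nat"
  have tm: "tilted L 0 n D \<in> borel_measurable state_space" by (rule tilted_measurable_state[OF D])
  have kc: "(\<lambda>\<theta>. k c (\<theta> c)) \<in> borel_measurable param_space" for c
    by (rule measurable_compose[OF param_component_measurable k(1)])
  have kt: "(\<lambda>t. k c (fst t c)) \<in> borel_measurable state_space" for c
    by (rule measurable_compose[OF measurable_fst kc])
  have k0m: "k0 \<in> borel_measurable state_space"
    unfolding k0_def[abs_def] by (intro borel_measurable_diff borel_measurable_sum kt borel_measurable_ln tm)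
  have k0_eq: "k0 (\<theta>, N, s) = (\<Sum>c\<in>?I. k c (\<theta> c)) - llr (net_N p L N \<theta>) n D" for \<theta>
    by (simp add: k0_def tilted_def)
  note k0_int = integral_at_Ns_le[OF Q _ k0m _ r, where N=N and s=s]
  have int0: "integrable (at_Ns ?Q N s) k0" "(\<integral>t. k0 t \<partial>at_Ns ?Q N s) \<le> r"
    using k0_int le by (auto simp: k0_eq)
  interpret A: prob_space "at_Ns ?Q N s" by (rule prob_space_at_Ns[OF Q]) simp
  define K where "K t = k0 t + (ln ?e - ln w)" for t
  have Km: "K \<in> borel_measurable state_space" unfolding K_def[abs_def] using k0m by measurable
  have "KL (at_Ns ?Q N s) ?post \<le> ereal (\<integral>t. K t \<partial>at_Ns ?Q N s)"
  proof (rule KL_le_integral)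
    show "prob_space ?post" by (rule prob_space_posterior[OF D])
    show "prob_space (at_Ns ?Q N s)" by (rule A.prob_space_axioms)
    show "sets (at_Ns ?Q N s) = sets ?post" by (simp add: sets_at_Ns sets_posterior[OF D])
    show "K \<in> borel_measurable ?post" using Km measurable_cong_sets[OF sets_posterior[OF D] refl] by blast
    show "integrable (at_Ns ?Q N s) K" unfolding K_def[abs_def] using int0(1) by simp
    fix A assume "A \<in> sets ?post"
    then have A: "A \<in> sets state_space" by (simp add: sets_posterior[OF D])
    have iA: "(\<lambda>t. indicator A t :: ennreal) \<in> borel_measurable state_space" using A by measurable
    have iA': "(\<lambda>\<theta>. indicator A (\<theta>, N, s) :: ennreal) \<in> borel_measurable param_space"
      by (rule measurable_compose[OF _ iA]) measurable
    define v where "v t = ennreal (exp (\<Sum>c\<in>?I. k c (fst t c)) / w) * indicator A t" for t :: "param \<times> nat \<times> nat"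
    have vm: "v \<in> borel_measurable state_space"
    proof -
      have [measurable]: "(\<lambda>t. \<Sum>c\<in>?I. k c (fst t c)) \<in> borel_measurable state_space"
        by (intro borel_measurable_sum kt)
      note iA[measurable]
      show ?thesis unfolding v_def[abs_def] by measurable
    qed
    have "emeasure (at_Ns ?Q N s) A = (\<integral>\<^sup>+t. indicator A t \<partial>at_Ns ?Q N s)"
      using A by (intro nn_integral_indicator[symmetric]) (simp add: sets_at_Ns)
    also have "\<dots> = (\<integral>\<^sup>+\<theta>. indicator A (\<theta>, N, s) \<partial>?Q)"
      by (rule nn_integral_at_Ns[OF Q _ iA]) simp
    also have "\<dots> \<le> (\<integral>\<^sup>+\<theta>. ennreal (exp (\<Sum>c\<in>?I. k c (\<theta> c))) * indicator A (\<theta>, N, s) \<partial>slab_params S p L N \<gamma>)"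
      by (rule nn_integral_indep_coords_density_le[OF _ prob_space_slabs[OF adm] sets_slabs M g dens k iA']) simp
    also have "\<dots> = (\<integral>\<^sup>+\<theta>. ennreal w * v (\<theta>, N, s) \<partial>slab_params S p L N \<gamma>)"
    proof (intro nn_integral_cong)
      fix \<theta>
      have "ennreal (exp (\<Sum>c\<in>?I. k c (\<theta> c))) = ennreal w * ennreal (exp (\<Sum>c\<in>?I. k c (\<theta> c)) / w)"
        using w(1) by (subst ennreal_mult[symmetric]) auto
      then show "ennreal (exp (\<Sum>c\<in>?I. k c (\<theta> c))) * indicator A (\<theta>, N, s) = ennreal w * v (\<theta>, N, s)"
        by (simp add: v_def mult.assoc)
    qed
    also have "\<dots> = ennreal w * (\<integral>\<^sup>+\<theta>. v (\<theta>, N, s) \<partial>slab_params S p L N \<gamma>)"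
    proof (rule nn_integral_cmult)
      have "(\<lambda>\<theta>. v (\<theta>, N, s)) \<in> borel_measurable param_space"
        by (rule measurable_compose[OF _ vm]) measurable
      then show "(\<lambda>\<theta>. v (\<theta>, N, s)) \<in> borel_measurable (slab_params S p L N \<gamma>)"
        using measurable_cong_sets[OF sets_indep_coords refl] by blast
    qed
    also have "\<dots> \<le> ennreal (pmf (prior_N lam) N * pmf (prior_s lams (card ?I)) s / (card ?I choose s)) *
        (\<integral>\<^sup>+\<theta>. v (\<theta>, N, s) \<partial>slab_params S p L N \<gamma>)"
      by (intro mult_right_mono ennreal_leI w(2)) auto
    also have "\<dots> \<le> (\<integral>\<^sup>+t. v t \<partial>prior S p L lam lams)"
      by (rule prior_ge_atom[OF adm lam vm \<gamma>])
    \<comment> \<open>Change from prior to posterior: the first factor is the posterior density, and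
      \<open>K\<close> contains minus its logarithm, so their product restores the integrand
      \<open>v\<close>.\<close>
    also have "\<dots> = (\<integral>\<^sup>+t. ennreal (tilted L 0 n D t / ?e) * (ennreal (exp (K t)) * indicator A t) \<partial>prior S p L lam lams)"
    proof (intro nn_integral_cong)
      fix t
      have tp: "tilted L 0 n D t > 0" by (rule tilted_pos[OF D])
      have "tilted L 0 n D t / ?e * exp (K t) = exp (\<Sum>c\<in>?I. k c (fst t c)) / w"
        using tp e w(1) by (simp add: K_def k0_def exp_add exp_diff)
      then have "ennreal (exp (\<Sum>c\<in>?I. k c (fst t c)) / w) = ennreal (tilted L 0 n D t / ?e) * ennreal (exp (K t))"
        using tp e by (subst ennreal_mult[symmetric]) (auto simp: less_imp_le)
      then show "v t = ennreal (tilted L 0 n D t / ?e) * (ennreal (exp (K t)) * indicator A t)"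
        by (simp add: v_def mult.assoc)
    qed
    also have "\<dots> = (\<integral>\<^sup>+t. ennreal (exp (K t)) * indicator A t \<partial>?post)"
    proof (rule nn_integral_posterior[OF D, symmetric])
      note iA[measurable] and Km[measurable]
      show "(\<lambda>t. ennreal (exp (K t)) * indicator A t) \<in> borel_measurable state_space" by measurable
    qed
    finally show "emeasure (at_Ns ?Q N s) A \<le> (\<integral>\<^sup>+t. ennreal (exp (K t)) * indicator A t \<partial>?post)" .
  qed
  also have "(\<integral>t. K t \<partial>at_Ns ?Q N s) = (\<integral>t. k0 t \<partial>at_Ns ?Q N s) + (ln ?e - ln w)"
    unfolding K_def using int0(1) A.prob_space by simp
  also have "ereal \<dots> \<le> ereal (r - ln w + ln ?e)" using int0(2) by simp
  finally show ?thesis .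
qed


text \<open>The competitor is fixed before the data are seen, so Fubini applies: for each parameter
  the noise term has mean square at most \<open>n * \<sigma>\<^sup>2 * H \<theta>\<close>, and
  Markov's inequality is applied to the average over \<open>Q\<close>. The bound \<open>H\<close>
  depends on the parameter because draws from normal slabs admit no common bound.\<close>

lemma second_moment_event:
  assumes Q: "prob_space Q" "sets Q = sets param_space" and H: "H \<in> borel_measurable param_space"
    and close: "AE \<theta> in Q. \<forall>x\<in>cube p. (net_N p L N \<theta> x - f0 x)\<^sup>2 \<le> H \<theta>"
    and v: "(\<integral>\<^sup>+\<theta>. ennreal (H \<theta>) \<partial>Q) \<le> ennreal v" "v \<ge> 0" and \<kappa>: "\<kappa> > 0"
  shows "\<exists>A\<in>sets (data0 n). measure (data0 n) (space (data0 n) - A) \<le> real n * \<sigma>\<^sup>2 * v / \<kappa>\<^sup>2 \<and>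
    (\<forall>D\<in>A. (\<forall>i<n. fst (D i) \<in> cube p) \<and>
      (\<integral>\<^sup>+\<theta>. ennreal ((noise_corr (net_N p L N \<theta>) n D)\<^sup>2) \<partial>Q) \<le> ennreal (\<kappa>\<^sup>2))"
proof -
  interpret Q: prob_space Q by fact
  interpret D: prob_space "data0 n" by (rule prob_space_data)
  interpret DQ: pair_prob_space "data0 n" Q ..
  let ?V = "\<lambda>D \<theta>. noise_corr (net_N p L N \<theta>) n D"
  have sp: "sets (data0 n \<Otimes>\<^sub>M Q) = sets (data0 n \<Otimes>\<^sub>M param_space)"
    using Q(2) by (intro sets_pair_measure_cong) auto
  have [measurable]: "(\<lambda>z. noise_corr (net_N p L N (snd z)) n (fst z)) \<in> borel_measurable (data0 n \<Otimes>\<^sub>M Q)"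
    using noise_corr_measurable measurable_cong_sets[OF sp refl] by blast
  have V2: "(\<lambda>z. ennreal ((?V (fst z) (snd z))\<^sup>2)) \<in> borel_measurable (data0 n \<Otimes>\<^sub>M Q)" by measurable
  define W where "W D = (\<integral>\<^sup>+\<theta>. ennreal ((?V D \<theta>)\<^sup>2) \<partial>Q)" for D
  have Wm[measurable]: "W \<in> borel_measurable (data0 n)"
    using Q.borel_measurable_nn_integral_fst[OF V2] unfolding W_def[abs_def] by simp
  have HQ[measurable]: "H \<in> borel_measurable Q" using H measurable_cong_sets[OF Q(2) refl] by blast
  have "(\<integral>\<^sup>+D. W D \<partial>data0 n) = (\<integral>\<^sup>+\<theta>. \<integral>\<^sup>+D. ennreal ((?V D \<theta>)\<^sup>2) \<partial>data0 n \<partial>Q)"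
    unfolding W_def by (rule DQ.Fubini'[symmetric]) (use V2 in \<open>simp add: case_prod_beta'\<close>)
  also have "\<dots> \<le> (\<integral>\<^sup>+\<theta>. ennreal (real n * \<sigma>\<^sup>2) * ennreal (H \<theta>) \<partial>Q)"
  proof (intro nn_integral_mono_AE, use close in eventually_elim)
    case (elim \<theta>)
    have m: "(\<lambda>x. net_N p L N \<theta> x - f0 x) \<in> borel_measurable (\<Pi>\<^sub>M i\<in>{..<p}. borel)"
      using net_N_measurable[OF p, of L N \<theta>] by measurable
    have "(\<integral>\<^sup>+D. ennreal ((?V D \<theta>)\<^sup>2) \<partial>data0 n) \<le> ennreal (real n * (\<sigma>\<^sup>2 * H \<theta>))"
      unfolding noise_corr_def using elim by (intro noise_second_moment[OF m]) auto
    also have "\<dots> = ennreal (real n * \<sigma>\<^sup>2) * ennreal (H \<theta>)"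
      by (subst ennreal_mult'[symmetric]) (auto simp: mult.assoc)
    finally show ?case .
  qed
  also have "\<dots> = ennreal (real n * \<sigma>\<^sup>2) * (\<integral>\<^sup>+\<theta>. ennreal (H \<theta>) \<partial>Q)" by (rule nn_integral_cmult) measurable
  also have "\<dots> \<le> ennreal (real n * \<sigma>\<^sup>2) * ennreal v" by (intro mult_left_mono v) auto
  also have "\<dots> = ennreal (real n * \<sigma>\<^sup>2 * v)" using v(2) by (simp add: ennreal_mult)
  finally have "D.prob {D \<in> space (data0 n). W D > ennreal (\<kappa>\<^sup>2)} \<le> real n * \<sigma>\<^sup>2 * v / \<kappa>\<^sup>2"
    using \<kappa> v by (intro D.prob_gt_le_nn_integral_ennreal) auto
  note Wp = this
  obtain Z where Z: "{D \<in> space (data0 n). \<not> (\<forall>i<n. fst (D i) \<in> cube p)} \<subseteq> Z"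
    "emeasure (data0 n) Z = 0" and Zm[measurable]: "Z \<in> sets (data0 n)"
    using AE_data_cube[of n] by (rule AE_E)
  let ?Y = "{D \<in> space (data0 n). W D > ennreal (\<kappa>\<^sup>2)}"
  have Ym[measurable]: "?Y \<in> sets (data0 n)" by measurable
  show ?thesis
  proof (intro bexI[of _ "space (data0 n) - (Z \<union> ?Y)"] conjI ballI)
    have "space (data0 n) - (space (data0 n) - (Z \<union> ?Y)) \<subseteq> Z \<union> ?Y" by auto
    then have "D.prob (space (data0 n) - (space (data0 n) - (Z \<union> ?Y))) \<le> D.prob (Z \<union> ?Y)"
      by (intro D.finite_measure_mono) measurable
    also have "\<dots> \<le> D.prob Z + D.prob ?Y" by (intro measure_Un_le) measurable
    also have "D.prob Z = 0" using Z(2) by (simp add: measure_def)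
    finally show "D.prob (space (data0 n) - (space (data0 n) - (Z \<union> ?Y))) \<le> real n * \<sigma>\<^sup>2 * v / \<kappa>\<^sup>2" using Wp by simp
  next
    fix D assume D: "D \<in> space (data0 n) - (Z \<union> ?Y)"
    then show "\<forall>i<n. fst (D i) \<in> cube p" using Z(1) by auto
    show "(\<integral>\<^sup>+\<theta>. ennreal ((?V D \<theta>)\<^sup>2) \<partial>Q) \<le> ennreal (\<kappa>\<^sup>2)" using D by (auto simp: W_def not_less)
  qed measurable
qed

text \<open>Second moment to first moment by \<open>\<bar>V\<bar> \<le> \<kappa> / 2 + V\<^sup>2 /
  (2 * \<kappa>)\<close>.\<close>

lemma nn_integral_abs_le:
  assumes "prob_space Q" and V: "V \<in> borel_measurable Q" and \<kappa>: "\<kappa> > 0"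
    and le: "(\<integral>\<^sup>+\<theta>. ennreal ((V \<theta>)\<^sup>2) \<partial>Q) \<le> ennreal (\<kappa>\<^sup>2)"
  shows "(\<integral>\<^sup>+\<theta>. ennreal \<bar>V \<theta>\<bar> \<partial>Q) \<le> ennreal \<kappa>"
proof -
  interpret Q: prob_space Q by fact
  note V[measurable]
  have "(\<integral>\<^sup>+\<theta>. ennreal \<bar>V \<theta>\<bar> \<partial>Q) \<le> (\<integral>\<^sup>+\<theta>. ennreal (\<kappa> / 2) + ennreal (1 / (2 * \<kappa>)) * ennreal ((V \<theta>)\<^sup>2) \<partial>Q)"
  proof (intro nn_integral_mono)
    fix \<theta>
    have "0 \<le> (\<bar>V \<theta>\<bar> - \<kappa>)\<^sup>2" by simp
    then have "2 * \<bar>V \<theta>\<bar> * \<kappa> \<le> \<kappa>\<^sup>2 + (V \<theta>)\<^sup>2" by (simp add: power2_diff)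
    then have "\<bar>V \<theta>\<bar> \<le> \<kappa> / 2 + 1 / (2 * \<kappa>) * (V \<theta>)\<^sup>2" using \<kappa> by (simp add: field_simps power2_eq_square)
    then show "ennreal \<bar>V \<theta>\<bar> \<le> ennreal (\<kappa> / 2) + ennreal (1 / (2 * \<kappa>)) * ennreal ((V \<theta>)\<^sup>2)"
      using \<kappa> by (simp add: ennreal_mult[symmetric] ennreal_plus[symmetric] ennreal_leI del: ennreal_plus)
  qed
  also have "\<dots> = ennreal (\<kappa> / 2) + ennreal (1 / (2 * \<kappa>)) * (\<integral>\<^sup>+\<theta>. ennreal ((V \<theta>)\<^sup>2) \<partial>Q)"
    by (simp add: nn_integral_add nn_integral_cmult Q.emeasure_space_1)
  also have "\<dots> \<le> ennreal (\<kappa> / 2) + ennreal (1 / (2 * \<kappa>)) * ennreal (\<kappa>\<^sup>2)"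
    by (intro add_left_mono mult_left_mono le) auto
  also have "\<dots> = ennreal \<kappa>"
    using \<kappa> by (simp add: ennreal_mult[symmetric] ennreal_plus[symmetric] power2_eq_square del: ennreal_plus)
  finally show ?thesis .
qed

text \<open>The bound on the divergence has four sources: the slab prices
  \<open>s * ln (1 / \<eta>)\<close>, the squared distance of the competitor's networks to
  \<open>f0\<close>, the noise term at level \<open>\<kappa>\<close>, and the prior weight of the
  chosen support. The level \<open>\<kappa>\<close> is left free since it trades the bound against
  the probability of the event. Neither \<open>q\<close> nor \<open>C\<close> depends on the
  data.\<close>

lemma candidate:
  "\<exists>C\<ge>1. \<forall>n L N s \<theta>s \<zeta> lams \<kappa> w. n \<ge> 1 \<longrightarrow> L \<ge> 1 \<longrightarrow> N \<ge> 1 \<longrightarrow> s \<ge> 1 \<longrightarrow> s \<le> card (coords_N p L N) \<longrightarrow>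
    \<theta>s \<in> Theta_B L (widths p L N) s B \<longrightarrow> (\<forall>x\<in>cube p. \<bar>net_N p L N \<theta>s x - f0 x\<bar> \<le> \<zeta>) \<longrightarrow> \<kappa> > 0 \<longrightarrow>
    w > 0 \<longrightarrow> w \<le> pmf (prior_N lam) N * pmf (prior_s lams (card (coords_N p L N))) s / (card (coords_N p L N) choose s) \<longrightarrow>
    (\<exists>q\<in>var_family S p L. \<exists>A\<in>sets (data0 n).
      measure (data0 n) (space (data0 n) - A) \<le> real n * \<sigma>\<^sup>2 * (2 * \<zeta>\<^sup>2 + C / (real n)\<^sup>2) / \<kappa>\<^sup>2 \<and>
      (\<forall>D\<in>A. KL q (posterior S p \<sigma> L lam lams n D) \<le> ereal (
        real s * (real L * ln (1 + layer_size p N * B) + 2 * ln (real s) + ln (real n) + C) +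
        real n * (2 * \<zeta>\<^sup>2 + C / (real n)\<^sup>2) / (2 * \<sigma>\<^sup>2) + \<kappa> / \<sigma>\<^sup>2 - ln w + ln (evidence L n lams D))))"
proof -
  obtain C \<eta>0 where C: "C \<ge> 1" and \<eta>0: "0 < \<eta>0" "\<eta>0 \<le> 1"
    and slab: "\<And>\<eta> t. 0 < \<eta> \<Longrightarrow> \<eta> \<le> \<eta>0 \<Longrightarrow> \<bar>t\<bar> \<le> B \<Longrightarrow>
      \<exists>M\<in>var_slabs S. \<exists>g k. g \<in> borel_measurable borel \<and> k \<in> borel_measurable borel \<and>
        M = density (prior_slab S) g \<and> (\<forall>x. 0 \<le> k x \<and> g x \<le> ennreal (exp (k x))) \<and>
        (\<integral>\<^sup>+x. ennreal (k x) \<partial>M) \<le> ennreal (ln (1 / \<eta>) + C) \<and>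
        (\<integral>\<^sup>+x. ennreal (exp (4 * \<bar>x - t\<bar> / \<eta>)) \<partial>M) \<le> ennreal C"
    by (rule concentrated_slab[OF adm]) blast
  define C' where "C' = 2 * C + ln (1 / \<eta>0)"
  have l\<eta>0: "ln (1 / \<eta>0) \<ge> 0" using \<eta>0 by (intro ln_ge_zero) (simp add: field_simps)
  have C': "C' \<ge> 1" "2 * C \<le> C'" "ln (1 / \<eta>0) + C \<le> C'" using C l\<eta>0 by (auto simp: C'_def)
  have B1: "B \<ge> 1" using admissible_slab_ge_1[OF adm] .
  have main: "\<exists>q\<in>var_family S p L. \<exists>A\<in>sets (data0 n).
      measure (data0 n) (space (data0 n) - A) \<le> real n * \<sigma>\<^sup>2 * (2 * \<zeta>\<^sup>2 + C' / (real n)\<^sup>2) / \<kappa>\<^sup>2 \<and>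
      (\<forall>D\<in>A. KL q (posterior S p \<sigma> L lam lams n D) \<le> ereal (
        real s * (real L * ln (1 + layer_size p N * B) + 2 * ln (real s) + ln (real n) + C') +
        real n * (2 * \<zeta>\<^sup>2 + C' / (real n)\<^sup>2) / (2 * \<sigma>\<^sup>2) + \<kappa> / \<sigma>\<^sup>2 - ln w + ln (evidence L n lams D)))"
    if n: "n \<ge> 1" and L: "L \<ge> 1" and N: "N \<ge> 1" and s: "s \<ge> 1" "s \<le> card (coords_N p L N)"
      and \<theta>s: "\<theta>s \<in> Theta_B L (widths p L N) s B" and \<zeta>: "\<forall>x\<in>cube p. \<bar>net_N p L N \<theta>s x - f0 x\<bar> \<le> \<zeta>"
      and \<kappa>: "\<kappa> > 0" and w: "w > 0"
        "w \<le> pmf (prior_N lam) N * pmf (prior_s lams (card (coords_N p L N))) s / (card (coords_N p L N) choose s)"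
    for n L N s \<theta>s \<zeta> lams \<kappa> w
  proof -
    let ?I = "coords_N p L N"
    have \<theta>B: "\<bar>\<theta>s c\<bar> \<le> B" for c using \<theta>s B1 by (cases "c \<in> ?I") (auto simp: Theta_B_def)
    have "card {c \<in> ?I. \<theta>s c \<noteq> 0} \<le> s" using \<theta>s by (simp add: Theta_B_def)
    \<comment> \<open>The given network may have fewer than \<open>s\<close> nonzero weights, while
      the prior at sparsity \<open>s\<close> charges only supports of size exactly \<open>s\<close>;
      the support is filled up, and the added weights have target 0.\<close>
    then obtain \<gamma> where \<gamma>: "{c \<in> ?I. \<theta>s c \<noteq> 0} \<subseteq> \<gamma>" "\<gamma> \<subseteq> ?I" "card \<gamma> = s"
      using s(2) exists_subset_between[of "{c \<in> ?I. \<theta>s c \<noteq> 0}" s ?I] by auto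
    have supps: "\<theta>s c = 0" if "c \<notin> \<gamma>" for c using that \<gamma>(1) \<theta>s by (cases "c \<in> ?I") (auto simp: Theta_B_def)
    have fin: "finite \<gamma>" using \<gamma>(2) by (rule finite_subset) simp
    define G where "G = (1 + layer_size p N * B) ^ L"
    have G: "G \<ge> 1" using B1 layer_size_nonneg[of p N] by (simp add: G_def one_le_power)
    \<comment> \<open>Chosen so that \<open>G * \<eta> * s\<^sup>2 \<le> 1 / n\<close>: the random
      width of the slabs then adds only \<open>O(1 / n\<^sup>2)\<close> to the mean squared
      distance, while \<open>ln (1 / \<eta>)\<close> contains
      \<open>L * ln (1 + layer_size p N * B)\<close>, the logarithm of the amplification by the
      network.\<close>
    define \<eta> where "\<eta> = \<eta>0 / (G * (real s)\<^sup>2 * real n)"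
    have den: "G * (real s)\<^sup>2 * real n \<ge> 1"
      using mult_mono[of 1 "G * (real s)\<^sup>2" 1 "real n"] mult_mono[of 1 G 1 "(real s)\<^sup>2"] G s n by (simp add: one_le_power)
    have \<eta>: "0 < \<eta>" "\<eta> \<le> \<eta>0" using \<eta>0 den by (auto simp: \<eta>_def divide_le_eq mult_le_cancel_left1)
    have G\<eta>: "G * (\<eta> * (real s)\<^sup>2) \<le> 1 / real n"
    proof -
      have "G * (\<eta> * (real s)\<^sup>2) = \<eta>0 / real n" using G s n by (simp add: \<eta>_def)
      also have "\<dots> \<le> 1 / real n" using \<eta>0 by (intro divide_right_mono) auto
      finally show ?thesis .
    qed
    have \<eta>s: "\<eta> * real s \<le> 1"
    proof -
      have "\<eta> * real s * 1 \<le> \<eta> * real s * (G * real s)"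
        using \<eta> s G mult_mono[of 1 G 1 "real s"] by (intro mult_left_mono) auto
      also have "\<dots> = G * (\<eta> * (real s)\<^sup>2)" by (simp add: power2_eq_square)
      also have "\<dots> \<le> 1" using G\<eta> n by (simp add: order_trans[OF G\<eta>])
      finally show ?thesis by simp
    qed
    have "\<exists>M'. \<exists>g' k'. \<forall>c. M' c \<in> var_slabs S \<and> g' c \<in> borel_measurable borel \<and> k' c \<in> borel_measurable borel \<and>
        M' c = density (prior_slab S) (g' c) \<and> (\<forall>x. 0 \<le> k' c x \<and> g' c x \<le> ennreal (exp (k' c x))) \<and>
        (\<integral>\<^sup>+x. ennreal (k' c x) \<partial>M' c) \<le> ennreal (ln (1 / \<eta>) + C) \<and>
        (\<integral>\<^sup>+x. ennreal (exp (4 * \<bar>x - \<theta>s c\<bar> / \<eta>)) \<partial>M' c) \<le> ennreal C"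
      using slab[OF \<eta> \<theta>B] by (subst choice_iff[symmetric])+ blast
    then obtain M' g' k' where all: "\<forall>c. M' c \<in> var_slabs S \<and> g' c \<in> borel_measurable borel \<and> k' c \<in> borel_measurable borel \<and>
        M' c = density (prior_slab S) (g' c) \<and> (\<forall>x. 0 \<le> k' c x \<and> g' c x \<le> ennreal (exp (k' c x))) \<and>
        (\<integral>\<^sup>+x. ennreal (k' c x) \<partial>M' c) \<le> ennreal (ln (1 / \<eta>) + C) \<and>
        (\<integral>\<^sup>+x. ennreal (exp (4 * \<bar>x - \<theta>s c\<bar> / \<eta>)) \<partial>M' c) \<le> ennreal C"
      by (elim exE) (rule that)
    have M': "M' c \<in> var_slabs S"
      and g': "g' c \<in> borel_measurable borel" and k': "k' c \<in> borel_measurable borel"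
      and dens': "M' c = density (prior_slab S) (g' c)"
      and k'0: "0 \<le> k' c x" and gk': "g' c x \<le> ennreal (exp (k' c x))"
      and Ik': "(\<integral>\<^sup>+x. ennreal (k' c x) \<partial>M' c) \<le> ennreal (ln (1 / \<eta>) + C)"
      and Ie': "(\<integral>\<^sup>+x. ennreal (exp (4 * \<bar>x - \<theta>s c\<bar> / \<eta>)) \<partial>M' c) \<le> ennreal C" for c x
      using all by blast+
    define M where "M c = (if c \<in> \<gamma> then M' c else return borel 0)" for c
    define g where "g c = (if c \<in> \<gamma> then g' c else (\<lambda>_. 1))" for c
    define k where "k c = (if c \<in> \<gamma> then k' c else (\<lambda>_. 0))" for c
    have Mp: "prob_space (M c)" and Ms: "sets (M c) = sets borel" for c
      using var_slabs_prob_space[OF M'] sets_var_slabs[OF M'] by (auto simp: M_def intro: prob_space_return)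
    have gm: "g c \<in> borel_measurable borel" and km: "k c \<in> borel_measurable borel" for c
      using g' k' by (auto simp: g_def k_def)
    have dens: "M c = density (slabs S \<gamma> c) (g c)" for c
      using dens'[of c] by (simp add: M_def g_def slabs_def density_1)
    have gk: "g c x \<le> ennreal (exp (k c x))" for c x using gk' by (simp add: g_def k_def)
    let ?Q = "indep_coords ?I M"
    define q where "q = at_Ns ?Q N s"
    have "q \<in> var_family S p L"
    proof -
      \<comment> \<open>Inclusion probabilities 1 on \<open>\<gamma>\<close> and 0 elsewhere exhibit
        the competitor as a member of the variational family.\<close>
      have eq: "?Q = indep_coords ?I (\<lambda>c. spike_slab (if c \<in> \<gamma> then 1 else 0) (M' c))"
        unfolding indep_coords_def
        by (intro distr_cong PiM_cong refl) (auto simp: M_def spike_slab_1[OF M'] spike_slab_0[OF M'] cong: PiM_cong)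
      show ?thesis
        unfolding q_def var_family_def mem_Collect_eq eq
        by (rule exI[of _ N], rule exI[of _ s], rule exI[of _ "\<lambda>c. if c \<in> \<gamma> then 1 else 0 :: real"],
            rule exI[of _ M']) (use N M' in auto)
    qed
    have Q: "prob_space ?Q" by (rule prob_space_indep_coords) (simp_all add: Mp Ms)
    interpret Q: prob_space ?Q by (rule Q)
    have supp: "AE \<theta> in ?Q. \<forall>c. c \<in> \<gamma> \<or> \<theta> c = 0"
    proof (rule AE_indep_coords)
      fix c assume "c \<in> ?I"
      show "AE x in M c. c \<in> \<gamma> \<or> x = 0"
      proof (cases "c \<in> \<gamma>")
        case False
        then have "M c = return borel 0" by (simp add: M_def)
        then show ?thesis by (simp only:) (subst AE_return; simp)
      qed simp
    qed (use \<gamma>(2) in \<open>auto simp: Mp Ms\<close>)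
    define E where "E \<theta> = (\<Sum>c\<in>\<gamma>. exp (4 * \<bar>\<theta> c - \<theta>s c\<bar> / \<eta>))" for \<theta> :: param
    \<comment> \<open>Bounds the squared distance to \<open>f0\<close> over the whole cube at once,
      by splitting it at the near-optimal network: \<open>\<zeta>\<close> is the approximation error
      and the second term the deviation of the draw.\<close>
    define H where "H \<theta> = 2 * \<zeta>\<^sup>2 + 2 * (G * (\<eta> * real s))\<^sup>2 * E \<theta>" for \<theta>
    have em: "(\<lambda>x. exp (4 * \<bar>x - \<theta>s c\<bar> / \<eta>)) \<in> borel_measurable borel" for c by measurable
    have emp: "(\<lambda>\<theta>. exp (4 * \<bar>\<theta> c - \<theta>s c\<bar> / \<eta>)) \<in> borel_measurable param_space" for c
      by (rule measurable_compose[OF param_component_measurable em])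
    have Em[measurable]: "E \<in> borel_measurable param_space"
      unfolding E_def[abs_def] by (intro borel_measurable_sum emp)
    have Hm[measurable]: "H \<in> borel_measurable param_space" unfolding H_def[abs_def] by measurable
    have E0: "E \<theta> \<ge> 0" for \<theta> unfolding E_def by (intro sum_nonneg) auto
    define v where "v = 2 * \<zeta>\<^sup>2 + C' / (real n)\<^sup>2"
    have v0: "v \<ge> 0" using C' by (simp add: v_def)
    have IE: "(\<integral>\<^sup>+\<theta>. ennreal (E \<theta>) \<partial>?Q) \<le> ennreal (real s * C)"
    proof -
      have "(\<integral>\<^sup>+\<theta>. ennreal (E \<theta>) \<partial>?Q) = (\<Sum>c\<in>\<gamma>. \<integral>\<^sup>+\<theta>. ennreal (exp (4 * \<bar>\<theta> c - \<theta>s c\<bar> / \<eta>)) \<partial>?Q)"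
        using emp unfolding E_def by (subst nn_integral_sum[symmetric]) auto
      also have "\<dots> \<le> (\<Sum>c\<in>\<gamma>. ennreal C)"
      proof (intro sum_mono)
        fix c assume c: "c \<in> \<gamma>"
        have "(\<integral>\<^sup>+\<theta>. ennreal (exp (4 * \<bar>\<theta> c - \<theta>s c\<bar> / \<eta>)) \<partial>?Q) = (\<integral>\<^sup>+x. ennreal (exp (4 * \<bar>x - \<theta>s c\<bar> / \<eta>)) \<partial>M c)"
          using c \<gamma>(2) em by (intro nn_integral_indep_coords_component) (auto simp: Mp Ms)
        then show "(\<integral>\<^sup>+\<theta>. ennreal (exp (4 * \<bar>\<theta> c - \<theta>s c\<bar> / \<eta>)) \<partial>?Q) \<le> ennreal C" using Ie'[of c] c by (simp add: M_def)
      qed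
      also have "\<dots> = ennreal (real s * C)" using C \<gamma>(3) by (simp add: ennreal_of_nat_eq_real_of_nat ennreal_mult)
      finally show ?thesis .
    qed
    have IH: "(\<integral>\<^sup>+\<theta>. ennreal (H \<theta>) \<partial>?Q) \<le> ennreal v"
    proof -
      have "(\<integral>\<^sup>+\<theta>. ennreal (H \<theta>) \<partial>?Q) = (\<integral>\<^sup>+\<theta>. ennreal (2 * \<zeta>\<^sup>2) + ennreal (2 * (G * (\<eta> * real s))\<^sup>2) * ennreal (E \<theta>) \<partial>?Q)"
        using E0 unfolding H_def by (intro nn_integral_cong) (simp add: ennreal_mult[symmetric] ennreal_plus[symmetric] del: ennreal_plus)
      also have "\<dots> = ennreal (2 * \<zeta>\<^sup>2) + ennreal (2 * (G * (\<eta> * real s))\<^sup>2) * (\<integral>\<^sup>+\<theta>. ennreal (E \<theta>) \<partial>?Q)"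
        by (simp add: nn_integral_add nn_integral_cmult Q.emeasure_space_1)
      also have "\<dots> \<le> ennreal (2 * \<zeta>\<^sup>2) + ennreal (2 * (G * (\<eta> * real s))\<^sup>2) * ennreal (real s * C)"
        by (intro add_left_mono mult_left_mono IE) auto
      also have "\<dots> = ennreal (2 * \<zeta>\<^sup>2 + 2 * (G * (\<eta> * real s))\<^sup>2 * (real s * C))"
        using C by (simp add: ennreal_mult[symmetric] ennreal_plus[symmetric] del: ennreal_plus)
      also have "\<dots> \<le> ennreal v"
      proof (intro ennreal_leI)
        \<comment> \<open>The extra factor \<open>s\<close> comes from summing \<open>s\<close>
          exponential moments; rounding it up to \<open>s\<^sup>2\<close> fits the choice of
          \<open>\<eta>\<close>.\<close>
        have "(G * (\<eta> * real s))\<^sup>2 * real s \<le> (G * (\<eta> * real s))\<^sup>2 * (real s)\<^sup>2"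
          using s by (intro mult_left_mono) (auto simp: power2_eq_square)
        also have "\<dots> = (G * (\<eta> * (real s)\<^sup>2))\<^sup>2" by (simp add: power2_eq_square mult_ac)
        also have "\<dots> \<le> (1 / real n)\<^sup>2" using G\<eta> G \<eta> by (intro power_mono) auto
        finally have "(G * (\<eta> * real s))\<^sup>2 * real s * (2 * C) \<le> (1 / real n)\<^sup>2 * C'"
          using C C' by (intro mult_mono) auto
        then show "2 * \<zeta>\<^sup>2 + 2 * (G * (\<eta> * real s))\<^sup>2 * (real s * C) \<le> v"
          by (simp add: v_def power_divide mult_ac)
      qed
      finally show ?thesis .
    qed
    have close: "AE \<theta> in ?Q. \<forall>x\<in>cube p. (net_N p L N \<theta> x - f0 x)\<^sup>2 \<le> H \<theta>"
      using supp
    proof (eventually_elim, intro ballI)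
      fix \<theta> :: param and x assume \<theta>: "\<forall>c. c \<in> \<gamma> \<or> \<theta> c = 0" and x: "x \<in> cube p"
      define d1 where "d1 = net_N p L N \<theta> x - net_N p L N \<theta>s x"
      define d2 where "d2 = net_N p L N \<theta>s x - f0 x"
      have "d1\<^sup>2 \<le> (G * (\<eta> * real s))\<^sup>2 * E \<theta>"
        unfolding d1_def G_def E_def using B1 \<theta> supps
        by (intro net_close_sq[OF p N L _ \<theta>B x \<gamma>(2,3) s(1) _ _ \<eta>(1) \<eta>s]) auto
      moreover have "d2\<^sup>2 \<le> \<zeta>\<^sup>2" using \<zeta> x unfolding d2_def by (intro abs_le_square_iff[THEN iffD1]) (auto intro: order_trans[OF _ abs_ge_self])
      moreover have "(net_N p L N \<theta> x - f0 x)\<^sup>2 \<le> 2 * d2\<^sup>2 + 2 * d1\<^sup>2"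
        using sum_squares_bound[of d1 d2] unfolding d1_def d2_def by (simp add: power2_eq_square algebra_simps)
      ultimately show "(net_N p L N \<theta> x - f0 x)\<^sup>2 \<le> H \<theta>" by (simp add: H_def)
    qed
    obtain A where A: "A \<in> sets (data0 n)" "measure (data0 n) (space (data0 n) - A) \<le> real n * \<sigma>\<^sup>2 * v / \<kappa>\<^sup>2"
      and Ac: "\<forall>D\<in>A. (\<forall>i<n. fst (D i) \<in> cube p) \<and>
        (\<integral>\<^sup>+\<theta>. ennreal ((noise_corr (net_N p L N \<theta>) n D)\<^sup>2) \<partial>?Q) \<le> ennreal (\<kappa>\<^sup>2)"
      using second_moment_event[OF Q sets_indep_coords Hm close IH v0 \<kappa>, of n] by (elim bexE conjE) (rule that)
    define X where "X = real s * (real L * ln (1 + layer_size p N * B) + 2 * ln (real s) + ln (real n) + C')"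
    have X: "real s * (ln (1 / \<eta>) + C) \<le> X"
    proof -
      have "ln (1 / \<eta>) = ln (1 / \<eta>0) + (real L * ln (1 + layer_size p N * B) + 2 * ln (real s) + ln (real n))"
      proof -
        have "0 < 1 + layer_size p N * B" using B1 layer_size_nonneg[of p N] by (simp add: add_pos_nonneg)
        then have "ln G = real L * ln (1 + layer_size p N * B)" unfolding G_def by (simp add: ln_realpow)
        moreover have "1 / \<eta> = 1 / \<eta>0 * (G * (real s)\<^sup>2 * real n)" by (simp add: \<eta>_def)
        moreover have "ln (a * (b * c * d)) = ln a + (ln b + ln c + ln d)"
          if "a > 0" "b > 0" "c > 0" "d > 0" for a b c d :: real
          using that by (simp add: ln_mult_pos)
        then have "ln (1 / \<eta>0 * (G * (real s)\<^sup>2 * real n)) = ln (1 / \<eta>0) + (ln G + ln ((real s)\<^sup>2) + ln (real n))"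
          by this (use \<eta>0 G s n in auto)
        moreover have "ln ((real s)\<^sup>2) = 2 * ln (real s)" by (simp add: ln_realpow)
        ultimately show ?thesis by simp
      qed
      then show ?thesis unfolding X_def using C'(3) by (intro mult_left_mono) auto
    qed
    have X0: "ln (1 / \<eta>) + C \<ge> 0" using \<eta> \<eta>0 C by (intro add_nonneg_nonneg ln_ge_zero) (auto simp: field_simps)
    have kcm: "(\<lambda>\<theta>. k c (\<theta> c)) \<in> borel_measurable param_space" for c
      by (rule measurable_compose[OF param_component_measurable km])
    have k0: "k c x \<ge> 0" for c x using k'0 by (simp add: k_def)
    have Ik: "(\<integral>\<^sup>+\<theta>. ennreal (\<Sum>c\<in>?I. k c (\<theta> c)) \<partial>?Q) \<le> ennreal X"
    proof -
      have "(\<Sum>c\<in>?I. k c (\<theta> c)) = (\<Sum>c\<in>\<gamma>. k' c (\<theta> c))" for \<theta> :: param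
        using \<gamma>(2) by (intro sum.mono_neutral_cong_right) (auto simp: k_def)
      then have "(\<integral>\<^sup>+\<theta>. ennreal (\<Sum>c\<in>?I. k c (\<theta> c)) \<partial>?Q) = (\<Sum>c\<in>\<gamma>. \<integral>\<^sup>+\<theta>. ennreal (k' c (\<theta> c)) \<partial>?Q)"
        using k'0 measurable_compose[OF param_component_measurable k']
        by (subst nn_integral_sum[symmetric]) auto
      also have "\<dots> \<le> (\<Sum>c\<in>\<gamma>. ennreal (ln (1 / \<eta>) + C))"
      proof (intro sum_mono)
        fix c assume c: "c \<in> \<gamma>"
        have "(\<integral>\<^sup>+\<theta>. ennreal (k' c (\<theta> c)) \<partial>?Q) = (\<integral>\<^sup>+x. ennreal (k' c x) \<partial>M c)"
          using c \<gamma>(2) k' by (intro nn_integral_indep_coords_component) (auto simp: Mp Ms)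
        then show "(\<integral>\<^sup>+\<theta>. ennreal (k' c (\<theta> c)) \<partial>?Q) \<le> ennreal (ln (1 / \<eta>) + C)" using Ik'[of c] c by (simp add: M_def)
      qed
      also have "\<dots> = ennreal (real s * (ln (1 / \<eta>) + C))"
        using X0 \<gamma>(3) by (simp add: ennreal_of_nat_eq_real_of_nat ennreal_mult del: ennreal_plus)
      finally show ?thesis using X by (meson ennreal_leI order_trans)
    qed
    have X_nn: "X \<ge> 0" using X X0 by (meson mult_nonneg_nonneg of_nat_0_le_iff order_trans)
    define r where "r = X + real n * v / (2 * \<sigma>\<^sup>2) + \<kappa> / \<sigma>\<^sup>2"
    have r0: "r \<ge> 0" using X_nn v0 \<kappa> by (simp add: r_def)
    have KL: "KL q (posterior S p \<sigma> L lam lams n D) \<le> ereal (r - ln w + ln (evidence L n lams D))" if D: "D \<in> A" for D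
      unfolding q_def
    proof (rule KL_posterior_le[OF _ \<gamma>(2,3) w Mp gm dens km gk r0])
      show Ds: "D \<in> space (data0 n)" using D sets.sets_into_space[OF A(1)] by auto
      have Dc: "\<And>i. i < n \<Longrightarrow> fst (D i) \<in> cube p"
        and DV: "(\<integral>\<^sup>+\<theta>. ennreal ((noise_corr (net_N p L N \<theta>) n D)\<^sup>2) \<partial>?Q) \<le> ennreal (\<kappa>\<^sup>2)"
        using Ac D by auto
      have Vm: "(\<lambda>\<theta>. noise_corr (net_N p L N \<theta>) n D) \<in> borel_measurable ?Q"
      proof -
        have "(\<lambda>\<theta>. noise_corr (net_N p L N \<theta>) n D) \<in> borel_measurable param_space"
          using measurable_compose[OF measurable_Pair1'[OF Ds] noise_corr_measurable[of L N n]] by simp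
        then show ?thesis using measurable_cong_sets[OF sets_indep_coords refl] by blast
      qed
      note IV = nn_integral_abs_le[OF Q Vm \<kappa> DV]
      let ?k = "\<lambda>\<theta>::param. \<Sum>c\<in>?I. k c (\<theta> c)"
      have kQ: "?k \<in> borel_measurable ?Q"
      proof -
        have "?k \<in> borel_measurable param_space" by (intro borel_measurable_sum kcm)
        then show ?thesis using measurable_cong_sets[OF sets_indep_coords refl] by blast
      qed
      have HQ: "H \<in> borel_measurable ?Q" using Hm measurable_cong_sets[OF sets_indep_coords refl] by blast
      have "(\<integral>\<^sup>+\<theta>. ennreal \<bar>?k \<theta> - llr (net_N p L N \<theta>) n D\<bar> \<partial>?Q) \<le>
          (\<integral>\<^sup>+\<theta>. ennreal (?k \<theta>) + (ennreal (real n / (2 * \<sigma>\<^sup>2)) * ennreal (H \<theta>) +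
            ennreal (1 / \<sigma>\<^sup>2) * ennreal \<bar>noise_corr (net_N p L N \<theta>) n D\<bar>) \<partial>?Q)"
      proof (intro nn_integral_mono_AE, use close in eventually_elim)
        case (elim \<theta>)
        have kk: "?k \<theta> \<ge> 0" by (intro sum_nonneg k0)
        have H0: "H \<theta> \<ge> 0" using E0 by (simp add: H_def)
        have "\<bar>llr (net_N p L N \<theta>) n D\<bar> \<le> real n * H \<theta> / (2 * \<sigma>\<^sup>2) + \<bar>noise_corr (net_N p L N \<theta>) n D\<bar> / \<sigma>\<^sup>2"
          using elim by (intro abs_llr_le Dc) auto
        then have "\<bar>?k \<theta> - llr (net_N p L N \<theta>) n D\<bar> \<le>
            ?k \<theta> + (real n / (2 * \<sigma>\<^sup>2) * H \<theta> + 1 / \<sigma>\<^sup>2 * \<bar>noise_corr (net_N p L N \<theta>) n D\<bar>)"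
          using kk by simp
        then show ?case using kk H0
          by (simp add: ennreal_mult[symmetric] ennreal_plus[symmetric] ennreal_leI del: ennreal_plus sum_ennreal)
      qed
      also have "\<dots> = (\<integral>\<^sup>+\<theta>. ennreal (?k \<theta>) \<partial>?Q) + (ennreal (real n / (2 * \<sigma>\<^sup>2)) * (\<integral>\<^sup>+\<theta>. ennreal (H \<theta>) \<partial>?Q) +
          ennreal (1 / \<sigma>\<^sup>2) * (\<integral>\<^sup>+\<theta>. ennreal \<bar>noise_corr (net_N p L N \<theta>) n D\<bar> \<partial>?Q))"
        using kQ HQ Vm by (simp add: nn_integral_add nn_integral_cmult)
      also have "\<dots> \<le> ennreal X + (ennreal (real n / (2 * \<sigma>\<^sup>2)) * ennreal v + ennreal (1 / \<sigma>\<^sup>2) * ennreal \<kappa>)"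
        by (intro add_mono mult_left_mono Ik IH IV) auto
      also have "\<dots> = ennreal r"
        using X_nn v0 \<kappa> by (simp add: r_def ennreal_mult[symmetric] ennreal_plus[symmetric] add.assoc del: ennreal_plus)
      finally show "(\<integral>\<^sup>+\<theta>. ennreal \<bar>?k \<theta> - llr (net_N p L N \<theta>) n D\<bar> \<partial>?Q) \<le> ennreal r" .
    qed
    show ?thesis
      using \<open>q \<in> var_family S p L\<close> A KL unfolding r_def X_def v_def by blast
  qed
  show ?thesis using C'(1) main by blast
qed

end

section \<open>Rates\<close>

text \<open>The error term offers \<open>ln (n * L / s)\<close>, whereas the prior and the slabs
  charge \<open>ln n\<close> per active weight; the two are comparable only if \<open>s\<close>
  stays a power of \<open>n\<close> below \<open>n * L\<close>. If \<open>p * N \<ge> 2\<close>, the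
  first term of the maximum forces \<open>s\<close> to be of order \<open>n powr \<alpha>\<close>.
  If \<open>p * N = 1\<close>, its logarithm vanishes and says nothing, but then there are at most
  \<open>156 * L\<close> coordinates.\<close>

lemma sparsity_regime:
  fixes \<alpha> :: real and p :: nat
  assumes p: "p \<ge> 1" and \<alpha>: "\<alpha> < 1"
  shows "\<exists>c>0. \<exists>n0. \<forall>n\<ge>n0. \<forall>L N s :: nat. 1 \<le> L \<longrightarrow> 1 \<le> N \<longrightarrow> 1 \<le> s \<longrightarrow> real s \<le> real L * layer_size p N \<longrightarrow>
    max (real L * real s * ln (real p * real N)) (real s * ln (real n * real L / real s)) \<le> real n powr \<alpha> \<longrightarrow>
    s \<le> n \<and> c * (real s * ln (real n)) \<le> real s * ln (real n * real L / real s)"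
proof -
  define c where "c = min ((1 - \<alpha>) / 2) (1 / 2)"
  have c: "c > 0" using \<alpha> by (simp add: c_def)
  have c_le: "c \<le> (1 - \<alpha>) / 2" "c \<le> 1 / 2" unfolding c_def by (rule min.cobounded1, rule min.cobounded2)
  have l2: "0 < ln (2::real)" "ln (2::real) \<le> 1" using ln_2_less_1 by auto
  \<comment> \<open>Three thresholds for \<open>n\<close>: the first makes
    \<open>n powr ((1 - \<alpha>) / 2)\<close> at least \<open>1 / ln 2\<close>, the second gives
    \<open>ln (n / 156) \<ge> ln n / 2\<close>, the third gives \<open>ln n \<ge> 2\<close>.\<close>
  define K where "K = max (max (exp (2 * - ln (ln 2) / (1 - \<alpha>))) (156 ^ 2)) (exp 2)"
  define n0 where "n0 = nat \<lceil>K\<rceil>"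
  show ?thesis
  proof (intro exI[of _ c] conjI c exI[of _ n0] allI impI)
    fix n L N s :: nat
    assume n0: "n \<ge> n0" and L: "1 \<le> L" and N: "1 \<le> N" and s: "1 \<le> s" and sH: "real s \<le> real L * layer_size p N"
      and m: "max (real L * real s * ln (real p * real N)) (real s * ln (real n * real L / real s)) \<le> real n powr \<alpha>"
    have K: "K \<le> real n" using n0 unfolding n0_def by linarith
    then have "exp (2 * - ln (ln 2) / (1 - \<alpha>)) \<le> real n" "156 ^ 2 \<le> real n" "exp 2 \<le> real n" by (auto simp: K_def)
    then have n: "real n \<ge> 1" and l_n: "2 \<le> ln (real n)" "2 * - ln (ln 2) / (1 - \<alpha>) \<le> ln (real n)" and n156: "156 ^ 2 \<le> real n"
      by (auto simp: ln_ge_iff)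
    have lln: "- ln (ln 2) \<le> (1 - \<alpha>) / 2 * ln (real n)" using l_n(2) \<alpha> by (simp add: field_simps)
    have powle: "real n powr \<alpha> \<le> real n" using powr_mono[of \<alpha> 1 "real n"] \<alpha> n by simp
    have key: "s \<le> n \<and> c * ln (real n) \<le> ln (real n * real L / real s)"
    proof (cases "p * N \<ge> 2")
      case True
      then have "2 \<le> real p * real N" by (metis of_nat_le_iff of_nat_mult of_nat_numeral)
      then have "ln 2 \<le> ln (real p * real N)" by (subst ln_le_cancel_iff) auto
      then have "1 * real s * ln 2 \<le> real L * real s * ln (real p * real N)"
        using L l2 by (intro mult_mono) auto
      also have "\<dots> \<le> real n powr \<alpha>" using m by simp
      finally have sl: "real s * ln 2 \<le> real n powr \<alpha>" by simp
      \<comment> \<open>Half of the exponent \<open>1 - \<alpha>\<close> is spent on absorbing the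
        constant \<open>ln 2\<close>; the other half is the gap between \<open>s\<close> and
        \<open>n\<close>.\<close>
      have "ln 2 * real n powr (1 - \<alpha>) \<ge> exp (- ((1 - \<alpha>) / 2 * ln (real n))) * real n powr (1 - \<alpha>)"
      proof (intro mult_right_mono)
        have "exp (- ((1 - \<alpha>) / 2 * ln (real n))) \<le> exp (ln (ln 2))"
          using lln by (subst exp_le_cancel_iff) linarith
        also have "\<dots> = ln 2" using l2(1) by (rule exp_ln)
        finally show "exp (- ((1 - \<alpha>) / 2 * ln (real n))) \<le> ln 2" .
      qed simp
      also have "exp (- ((1 - \<alpha>) / 2 * ln (real n))) * real n powr (1 - \<alpha>) = exp ((1 - \<alpha>) / 2 * ln (real n))"
        using n by (simp add: powr_def mult_exp_exp field_simps)
      finally have big: "exp ((1 - \<alpha>) / 2 * ln (real n)) \<le> ln 2 * real n powr (1 - \<alpha>)" .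
      have "real s * exp ((1 - \<alpha>) / 2 * ln (real n)) \<le> real s * (ln 2 * real n powr (1 - \<alpha>))"
        using big by (intro mult_left_mono) auto
      also have "\<dots> \<le> real n powr \<alpha> * real n powr (1 - \<alpha>)"
        using mult_right_mono[OF sl, of "real n powr (1 - \<alpha>)"] by (simp add: mult.assoc)
      also have "\<dots> = real n" using n by (simp add: powr_add[symmetric])
      finally have se: "real s * exp ((1 - \<alpha>) / 2 * ln (real n)) \<le> real n" .
      have e1: "1 \<le> exp ((1 - \<alpha>) / 2 * ln (real n))" using \<alpha> l_n by simp
      have "real s * 1 \<le> real s * exp ((1 - \<alpha>) / 2 * ln (real n))" using e1 by (intro mult_left_mono) auto
      then have sn: "real s \<le> real n" using se by simp
      have "real n * 1 \<le> real n * real L" using L by (intro mult_left_mono) auto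
      then have "exp ((1 - \<alpha>) / 2 * ln (real n)) \<le> real n * real L / real s"
        using se s by (simp add: le_divide_eq mult.commute)
      then have "(1 - \<alpha>) / 2 * ln (real n) \<le> ln (real n * real L / real s)"
        using n L s by (subst ln_ge_iff) auto
      moreover have "c * ln (real n) \<le> (1 - \<alpha>) / 2 * ln (real n)" using c_le l_n by (intro mult_right_mono) auto
      ultimately show ?thesis using sn by simp
    next
      case False
      then have "p * N = 1" using p N by (metis One_nat_def Suc_1 le_SucE mult_le_mono nat_mult_1 not_less_eq_eq)
      then have "real p * real N = 1" by (metis of_nat_1 of_nat_mult)
      then have "layer_size p N = 156" by (simp add: layer_size_def mult.assoc)
      then have "real s \<le> real L * 156" using sH by simp
      then have "real n * real s \<le> real n * (real L * 156)" by (intro mult_left_mono) auto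
      then have "real n / 156 \<le> real n * real L / real s" using s by (simp add: field_simps)
      then have "ln (real n / 156) \<le> ln (real n * real L / real s)"
        using n L s by (subst ln_le_cancel_iff) auto
      moreover have "ln (real n / 156) \<ge> 1 / 2 * ln (real n)"
      proof -
        have "ln ((156::real) ^ 2) \<le> ln (real n)" using n156 n by (subst ln_le_cancel_iff) auto
        then have "2 * ln (156::real) \<le> ln (real n)" by (simp only: ln_realpow of_nat_numeral)
        then show ?thesis using n by (simp add: ln_div)
      qed
      ultimately have half: "1 / 2 * ln (real n) \<le> ln (real n * real L / real s)" by linarith
      \<comment> \<open>Here \<open>s \<le> n\<close> comes from the second term of the maximum,
        whose logarithm is at least \<open>ln n / 2 \<ge> 1\<close>.\<close>
      have "real s * 1 \<le> real s * (1 / 2 * ln (real n))" using l_n by (intro mult_left_mono) auto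
      also have "\<dots> \<le> real s * ln (real n * real L / real s)" using half by (intro mult_left_mono) auto
      also have "\<dots> \<le> real n" using m powle by simp
      finally have "s \<le> n" by simp
      moreover have "c * ln (real n) \<le> 1 / 2 * ln (real n)" using c_le l_n by (intro mult_right_mono) auto
      ultimately show ?thesis using half by linarith
    qed
    then show "s \<le> n" by simp
    have "real s * (c * ln (real n)) \<le> real s * ln (real n * real L / real s)" using key by (intro mult_left_mono) auto
    then show "c * (real s * ln (real n)) \<le> real s * ln (real n * real L / real s)" by (simp add: mult_ac)
  qed
qed

text \<open>Apart from \<open>lams * s\<close>, every factor of the weight costs
  \<open>O(s * ln n)\<close>, and the 11 is \<open>1 + 5 + 5\<close>: the factorial by
  \<open>N ^ N\<close> with \<open>N \<le> s \<le> n\<close>, the normaliser of the sparsity prior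
  by \<open>H + 1\<close>, and the binomial coefficient by \<open>H ^ s\<close>, the last two with
  \<open>H + 1 \<le> n ^ 5\<close>.\<close>

lemma neg_ln_prior_weight_le:
  fixes lam lams :: real
  assumes lam: "lam > 0" and lams: "lams \<ge> 0" and N: "1 \<le> N" "N \<le> s" and s: "s \<le> n" "s \<le> H"
    and H: "real H + 1 \<le> real n ^ 5" and n: "1 \<le> ln (real n)"
  defines "w \<equiv> pmf (prior_N lam) N * pmf (prior_s lams H) s / (H choose s)"
  shows "w > 0" and "- ln w \<le> lams * real s + (lam + \<bar>ln lam\<bar> + 11) * (real s * ln (real n))"
proof -
  have s1: "real s \<ge> 1" and n1: "real n \<ge> 1" using N s by auto
  have x1: "1 \<le> real s * ln (real n)" using mult_mono[of 1 "real s" 1 "ln (real n)"] s1 n by simp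
  have e: "exp lam - 1 > 0" using lam by simp
  define a where "a = pmf (prior_N lam) N"
  define b where "b = pmf (prior_s lams H) s"
  let ?Z = "\<Sum>t\<le>H. exp (- lams * real t)"
  have Z: "?Z > 0" by (rule sum_pos) auto
  have a_eq: "a = lam ^ N / ((exp lam - 1) * fact N)" using N by (simp add: a_def pmf_prior_N[OF lam])
  have b_eq: "b = exp (- lams * real s) / ?Z" using s by (simp add: b_def pmf_prior_s)
  have a: "a > 0" using lam e by (simp add: a_eq)
  have b: "b > 0" using Z by (simp add: b_eq)
  have C: "real (H choose s) > 0" using s by simp
  show "w > 0" using a b C by (simp add: w_def a_def b_def)
  have "- ln a = ln (exp lam - 1) + ln (fact N) - real N * ln lam"
    using lam e by (simp add: a_eq ln_div ln_mult_pos ln_realpow)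
  also have "\<dots> \<le> lam + real s * ln (real n) + real s * \<bar>ln lam\<bar>"
  proof -
    have "ln (exp lam - 1) \<le> ln (exp lam)" using e by (subst ln_le_cancel_iff) auto
    moreover have "ln (fact N) \<le> real s * ln (real n)"
    proof -
      have "(fact N :: real) \<le> real N ^ N" 
        using fact_le_power[of N, where 'a=real] by simp
      then have "ln (fact N) \<le> ln (real N ^ N)" using N by (subst ln_le_cancel_iff) auto
      also have "\<dots> = real N * ln (real N)" using N by (simp add: ln_realpow)
      also have "\<dots> \<le> real s * ln (real n)" using N s by (intro mult_mono) auto
      finally show ?thesis .
    qed
    moreover have "- (real N * ln lam) \<le> real s * \<bar>ln lam\<bar>"
    proof -
      have "- (real N * ln lam) \<le> real N * \<bar>ln lam\<bar>" using mult_left_mono[of "- ln lam" "\<bar>ln lam\<bar>" "real N"] by simp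
      also have "\<dots> \<le> real s * \<bar>ln lam\<bar>" using N by (intro mult_right_mono) auto
      finally show ?thesis .
    qed
    ultimately show ?thesis by simp
  qed
  finally have la: "- ln a \<le> lam + real s * ln (real n) + real s * \<bar>ln lam\<bar>" .
  have H1: "ln (real H + 1) \<le> 5 * ln (real n)"
  proof -
    have "ln (real H + 1) \<le> ln (real n ^ 5)" using H n1 by (subst ln_le_cancel_iff) (auto simp: add_nonneg_pos)
    then show ?thesis by (simp add: ln_realpow)
  qed
  have "- ln b = lams * real s + ln ?Z" using Z by (simp add: b_eq ln_div)
  also have "ln ?Z \<le> ln (real H + 1)"
  proof -
    have "?Z \<le> (\<Sum>t\<le>H. 1)" using lams by (intro sum_mono) auto
    then show ?thesis using Z by (subst ln_le_cancel_iff) auto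
  qed
  finally have lb: "- ln b \<le> lams * real s + 5 * ln (real n)" using H1 by simp
  have "real (H choose s) \<le> real H ^ s" using s binomial_le_pow[of s H] by (metis of_nat_le_iff of_nat_power)
  then have "ln (real (H choose s)) \<le> ln (real H ^ s)" using C s N by (subst ln_le_cancel_iff) auto
  also have "\<dots> = real s * ln (real H)" by (simp add: ln_realpow)
  also have "\<dots> \<le> real s * (5 * ln (real n))"
  proof (intro mult_left_mono)
    have "ln (real H) \<le> ln (real H + 1)" using s N by (subst ln_le_cancel_iff) auto
    then show "ln (real H) \<le> 5 * ln (real n)" using H1 by simp
  qed simp
  finally have lC: "ln (real (H choose s)) \<le> 5 * (real s * ln (real n))" by simp
  have "- ln w = - ln a - ln b + ln (real (H choose s))"
    using a b C by (simp add: w_def a_def[symmetric] b_def[symmetric] ln_div ln_mult_pos)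
  also have "\<dots> \<le> lam + real s * ln (real n) + real s * \<bar>ln lam\<bar> + (lams * real s + 5 * ln (real n)) + 5 * (real s * ln (real n))"
    using la lb lC by simp
  also have "\<dots> \<le> lams * real s + (lam + \<bar>ln lam\<bar> + 11) * (real s * ln (real n))"
  proof -
    have "lam * 1 \<le> lam * (real s * ln (real n))" using x1 lam by (intro mult_left_mono) auto
    moreover have "\<bar>ln lam\<bar> * (real s * 1) \<le> \<bar>ln lam\<bar> * (real s * ln (real n))" using n by (intro mult_left_mono) auto
    moreover have "1 * ln (real n) \<le> real s * ln (real n)" using s1 n by (intro mult_right_mono) auto
    ultimately show ?thesis by (simp add: algebra_simps)
  qed
  finally show "- ln w \<le> lams * real s + (lam + \<bar>ln lam\<bar> + 11) * (real s * ln (real n))" .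
qed

text \<open>No attainment of the infimum is needed: a slack \<open>r\<close> on the squared distance
  is allowed. Taking for \<open>r\<close> the estimation error itself changes only constants in the
  final rate.\<close>

lemma sup_dist_near_minimizer:
  assumes xi: "xi_err p B f0 L N s = ereal x" and r: "r > 0"
  obtains \<theta> where "\<theta> \<in> Theta_B L (widths p L N) s B"
    "\<And>y. y \<in> cube p \<Longrightarrow> \<bar>net_N p L N \<theta> y - f0 y\<bar> \<le> sqrt (x + r)" "x \<ge> 0"
proof -
  have "xi_err p B f0 L N s < ereal (x + r)" using xi r by simp
  then obtain \<theta> where \<theta>: "\<theta> \<in> Theta_B L (widths p L N) s B"
    and lt: "(sup_dist p (net_N p L N \<theta>) f0)\<^sup>2 < ereal (x + r)"
    unfolding xi_err_def INF_less_iff by blast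
  have bound: "\<bar>net_N p L N \<theta> y - f0 y\<bar> \<le> sqrt (x + r)" if y: "y \<in> cube p" for y
  proof (rule real_le_rsqrt)
    let ?a = "\<bar>net_N p L N \<theta> y - f0 y\<bar>"
    have "ereal ?a \<le> sup_dist p (net_N p L N \<theta>) f0" unfolding sup_dist_def using y by (rule SUP_upper)
    then have "ereal ?a * ereal ?a \<le> sup_dist p (net_N p L N \<theta>) f0 * sup_dist p (net_N p L N \<theta>) f0"
      by (intro ereal_mult_mono) (auto intro: order_trans[of 0 "ereal ?a"])
    also have "\<dots> < ereal (x + r)" using lt by (simp add: power2_eq_square)
    finally show "?a\<^sup>2 \<le> x + r" by (simp add: power2_eq_square)
  qed
  have "0 \<le> xi_err p B f0 L N s"
    unfolding xi_err_def by (intro INF_greatest) (auto simp: power2_eq_square ereal_zero_le_0_iff linear)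
  then have "x \<ge> 0" using xi by simp
  with \<theta> bound show ?thesis by (rule that)
qed

text \<open>A statement for one sample size, with constants uniform in the architecture, so that
  sequences can be inserted afterwards. The number \<open>e\<close> stands for the square of the
  rate \<open>\<epsilon>\<close> and enters only as a bound for \<open>lams * s / n\<close>, the
  sparsity price of the competitor; all other costs are charged to \<open>r\<close> and
  \<open>x\<close>.\<close>

lemma (in bayes_net) contraction_event:
  assumes F0: "F0 \<ge> 0" "\<And>x. x \<in> cube p \<Longrightarrow> \<bar>f0 x\<bar> \<le> F0" and a: "a > 0" and c': "c' > 0"
  shows "\<exists>C>0. \<exists>K\<ge>0. \<exists>n0. \<forall>n\<ge>n0. \<forall>L N s lams x r e. 1 \<le> L \<longrightarrow> 1 \<le> N \<longrightarrow> 12 * p * N + L \<le> s \<longrightarrow> s \<le> n \<longrightarrow>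
    s \<le> card (coords_N p L N) \<longrightarrow> a * real L * ln (real n) \<le> lams \<longrightarrow> lams * real s \<le> real n * e \<longrightarrow>
    c' * (real s * ln (real n)) \<le> real n * r \<longrightarrow>
    real L * real s * ln (12 * B * real p * real N) \<le> real n * r \<longrightarrow> xi_err p B f0 L N s = ereal x \<longrightarrow>
    (\<exists>A\<in>sets (data0 n). measure (data0 n) A \<ge> 1 - (K / real n + K / ln (real n)) \<and>
      (\<forall>D\<in>A. \<forall>q. is_adaptive_vp S p \<sigma> L lam lams n D q \<longrightarrow>
        (\<integral>(\<theta>, N, s). hell (net_N p L N \<theta>) \<partial>q) \<le> C * (e + r + x)))"
proof -
  have "\<exists>c>0. \<exists>K1\<ge>0. \<exists>n1. \<forall>n\<ge>n1. \<forall>L lams. 1 \<le> L \<longrightarrow> L \<le> n \<longrightarrow> a * real L * ln (real n) \<le> lams \<longrightarrow>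
      (\<exists>A\<in>sets (data0 n). measure (data0 n) (space (data0 n) - A) \<le> K1 / real n \<and>
        (\<forall>D\<in>A. (\<integral>\<^sup>+t. ennreal (tilted L c n D t) \<partial>prior S p L lam lams) \<le> ennreal (real n ^ 5)))"
    (is "\<exists>c>0. \<exists>K1\<ge>0. \<exists>n1. ?tilt c K1 n1")
    by (rule tilted_integral_event[OF F0(1) _ a]) (rule F0(2))
  then obtain c K1 n1 where c: "c > 0" and K1: "K1 \<ge> 0" and tilt: "?tilt c K1 n1"
    by (elim exE conjE) (rule that)
  obtain C1 where C1: "C1 \<ge> 1"
    and cand: "\<forall>n L N s \<theta>s \<zeta> lams \<kappa> w. n \<ge> 1 \<longrightarrow> L \<ge> 1 \<longrightarrow> N \<ge> 1 \<longrightarrow> s \<ge> 1 \<longrightarrow> s \<le> card (coords_N p L N) \<longrightarrow>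
    \<theta>s \<in> Theta_B L (widths p L N) s B \<longrightarrow> (\<forall>x\<in>cube p. \<bar>net_N p L N \<theta>s x - f0 x\<bar> \<le> \<zeta>) \<longrightarrow> \<kappa> > 0 \<longrightarrow>
    w > 0 \<longrightarrow> w \<le> pmf (prior_N lam) N * pmf (prior_s lams (card (coords_N p L N))) s / (card (coords_N p L N) choose s) \<longrightarrow>
    (\<exists>q\<in>var_family S p L. \<exists>A\<in>sets (data0 n).
      measure (data0 n) (space (data0 n) - A) \<le> real n * \<sigma>\<^sup>2 * (2 * \<zeta>\<^sup>2 + C1 / (real n)\<^sup>2) / \<kappa>\<^sup>2 \<and>
      (\<forall>D\<in>A. KL q (posterior S p \<sigma> L lam lams n D) \<le> ereal (
        real s * (real L * ln (1 + layer_size p N * B) + 2 * ln (real s) + ln (real n) + C1) +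
        real n * (2 * \<zeta>\<^sup>2 + C1 / (real n)\<^sup>2) / (2 * \<sigma>\<^sup>2) + \<kappa> / \<sigma>\<^sup>2 - ln w + ln (evidence L n lams D))))"
    using candidate by (elim exE conjE) (rule that)
  have B1: "B \<ge> 1" by (rule admissible_slab_ge_1[OF adm])
  \<comment> \<open>Collects the coefficients of \<open>s * ln n\<close>: prior weight, slab prices,
    the \<open>1 / n\<^sup>2\<close> part of the squared distance, and \<open>ln (n ^ 5)\<close>
    from the exponential moment.\<close>
  define K2 where "K2 = (lam + \<bar>ln lam\<bar> + 11) + (3 + C1) + C1 / (2 * \<sigma>\<^sup>2) + 5"
  have K2: "K2 \<ge> 0" using lam C1 by (simp add: K2_def add_nonneg_nonneg)
  define C where "C = (1 + K2 / c' + 3 + 2 / \<sigma>\<^sup>2) / c"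
  have C: "C > 0" using c c' K2 \<sigma> by (simp add: C_def add_pos_nonneg)
  define K where "K = K1 + \<sigma>\<^sup>2 * (2 + C1) / c'"
  have K: "K \<ge> 0" "K1 \<le> K" "\<sigma>\<^sup>2 * (2 + C1) / c' \<le> K" using K1 C1 c' by (auto simp: K_def)
  \<comment> \<open>The 3 bounds \<open>exp 1\<close> and gives \<open>ln n \<ge> 1\<close>; the
    last entry gives \<open>c' * ln n \<ge> 1\<close>, hence \<open>n * r \<ge> 1\<close>.\<close>
  define n0 where "n0 = max (max n1 3) (nat \<lceil>exp (1 / c')\<rceil>)"
  have main: "\<exists>A\<in>sets (data0 n). measure (data0 n) A \<ge> 1 - (K / real n + K / ln (real n)) \<and>
      (\<forall>D\<in>A. \<forall>q. is_adaptive_vp S p \<sigma> L lam lams n D q \<longrightarrow>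
        (\<integral>(\<theta>, N, s). hell (net_N p L N \<theta>) \<partial>q) \<le> C * (e + r + x))"
    if n: "n \<ge> n0" and L: "1 \<le> L" and N: "1 \<le> N" and s: "12 * p * N + L \<le> s" "s \<le> n" "s \<le> card (coords_N p L N)"
      and lams: "a * real L * ln (real n) \<le> lams" "lams * real s \<le> real n * e"
      and r: "c' * (real s * ln (real n)) \<le> real n * r" "real L * real s * ln (12 * B * real p * real N) \<le> real n * r"
      and xi: "xi_err p B f0 L N s = ereal x"
    for n L N s lams x r e
  proof -
    interpret D: prob_space "data0 n" by (rule prob_space_data)
    have nn: "n \<ge> n1" "n \<ge> 3" "exp (1 / c') \<le> real n" using n unfolding n0_def by linarith+
    have ln1: "ln (real n) \<ge> 1"
    proof -
      have "exp 1 \<le> real n" using exp_le nn(2) by linarith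
      then show ?thesis using nn(2) by (subst ln_ge_iff) auto
    qed
    have lnc: "1 / c' \<le> ln (real n)" using nn by (subst ln_ge_iff) auto
    have pN1: "1 \<le> p * N" using p N by simp
    then have s13: "12 * (p * N) \<le> s" "L \<le> s" "N \<le> s" "1 \<le> s"
    proof -
      show "12 * (p * N) \<le> s" "L \<le> s" using s(1) by (simp_all add: mult.assoc)
      have "1 * N \<le> 12 * p * N" using p by (intro mult_right_mono) auto
      then show "N \<le> s" "1 \<le> s" using s(1) L by linarith+
    qed
    have sl1: "1 \<le> real s" "ln (real n) \<le> real s * ln (real n)" "1 \<le> real s * ln (real n)"
    proof -
      show s1: "1 \<le> real s" using s13 by simp
      show s2: "ln (real n) \<le> real s * ln (real n)" using mult_right_mono[OF s1, of "ln (real n)"] ln1 by simp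
      show "1 \<le> real s * ln (real n)" using s2 ln1 by linarith
    qed
    have nr: "c' * ln (real n) \<le> real n * r"
      using r(1) mult_left_mono[OF sl1(2), of c'] c' by linarith
    have nr1: "1 \<le> real n * r" using nr lnc c' by (simp add: field_simps)
    then have "0 < real n * r" by linarith
    then have r0: "r > 0" by (simp add: zero_less_mult_iff)
    obtain \<theta>s where \<theta>s: "\<theta>s \<in> Theta_B L (widths p L N) s B"
      "\<And>y. y \<in> cube p \<Longrightarrow> \<bar>net_N p L N \<theta>s y - f0 y\<bar> \<le> sqrt (x + r)" and x0: "x \<ge> 0"
      by (rule sup_dist_near_minimizer[OF xi r0]) (rule that)
    define \<zeta> where "\<zeta> = sqrt (x + r)"
    have \<zeta>2: "\<zeta>\<^sup>2 = x + r" using x0 r0 by (simp add: \<zeta>_def)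
    \<comment> \<open>The noise is allowed to be as large as the target rate. Its mean square is
      also of order \<open>\<kappa>\<close>, so Markov's inequality gives a failure probability of
      order \<open>1 / \<kappa>\<close>; this vanishes because
      \<open>\<kappa> \<ge> n * r \<ge> c' * ln n\<close>.\<close>
    define \<kappa> where "\<kappa> = real n * (x + r)"
    have \<kappa>: "\<kappa> \<ge> real n * r" using x0 by (simp add: \<kappa>_def distrib_left)
    have \<kappa>1: "\<kappa> \<ge> 1" "\<kappa> > 0" using \<kappa> nr1 by linarith+
    let ?H = "card (coords_N p L N)"
    \<comment> \<open>The sparsity dominates width and depth, and \<open>s \<le> n\<close>, so the
      number of coordinates is polynomial in \<open>n\<close>.\<close>
    have H5: "real ?H + 1 \<le> real n ^ 5"
    proof -
      have a: "12 * real p * real N \<le> real n"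
        using s13(1) s(2) by (metis (no_types, opaque_lifting) mult.assoc of_nat_le_iff of_nat_mult of_nat_numeral order_trans)
      have "real ?H \<le> real L * layer_size p N" using p N L by (rule card_coords_N)
      also have "\<dots> \<le> real n * (real n * (real n + 1))"
        unfolding layer_size_def using a s13(2) s(2) by (intro mult_mono add_mono) auto
      finally have H: "real ?H + 1 \<le> real n ^ 3 + (real n)\<^sup>2 + 1" by (simp add: power2_eq_square power3_eq_cube algebra_simps)
      have n3: "real n \<ge> 3" using nn by simp
      have "(real n)\<^sup>2 \<le> real n ^ 3" "1 \<le> real n ^ 3" using n3 by (auto simp: power_increasing one_le_power)
      then have "real n ^ 3 + (real n)\<^sup>2 + 1 \<le> 3 * real n ^ 3" by linarith
      also have "\<dots> \<le> (real n)\<^sup>2 * real n ^ 3"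
        using n3 mult_mono[of 3 "real n" 1 "real n"] by (intro mult_right_mono) (auto simp: power2_eq_square)
      also have "\<dots> = real n ^ 5" by (simp add: power_add[symmetric])
      finally show ?thesis using H by linarith
    qed
    define w where "w = pmf (prior_N lam) N * pmf (prior_s lams ?H) s / (?H choose s)"
    have lams0: "lams \<ge> 0"
    proof -
      have "0 \<le> a * real L * ln (real n)" using a ln1 by simp
      then show ?thesis using lams(1) by linarith
    qed
    have w: "w > 0" "- ln w \<le> lams * real s + (lam + \<bar>ln lam\<bar> + 11) * (real s * ln (real n))"
      unfolding w_def
      by (rule neg_ln_prior_weight_le[OF lam lams0 N s13(3) s(2,3) H5 ln1])+
    have Ln: "L \<le> n" using s13(2) s(2) by simp
    obtain A1 where A1[measurable]: "A1 \<in> sets (data0 n)" and A1p: "D.prob (space (data0 n) - A1) \<le> K1 / real n"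
      and A1h: "\<forall>D\<in>A1. (\<integral>\<^sup>+t. ennreal (tilted L c n D t) \<partial>prior S p L lam lams) \<le> ennreal (real n ^ 5)"
      using tilt[rule_format, OF nn(1) L Ln lams(1)] by (elim bexE conjE) (rule that)
    define R where "R = real s * (real L * ln (1 + layer_size p N * B) + 2 * ln (real s) + ln (real n) + C1) +
        real n * (2 * \<zeta>\<^sup>2 + C1 / (real n)\<^sup>2) / (2 * \<sigma>\<^sup>2) + \<kappa> / \<sigma>\<^sup>2 - ln w"
    have n_ge1: "1 \<le> n" using nn by simp
    have \<theta>s\<zeta>: "\<forall>y\<in>cube p. \<bar>net_N p L N \<theta>s y - f0 y\<bar> \<le> \<zeta>" using \<theta>s(2) by (simp add: \<zeta>_def)
    have "\<exists>q'\<in>var_family S p L. \<exists>A2\<in>sets (data0 n).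
        D.prob (space (data0 n) - A2) \<le> real n * \<sigma>\<^sup>2 * (2 * \<zeta>\<^sup>2 + C1 / (real n)\<^sup>2) / \<kappa>\<^sup>2 \<and>
        (\<forall>D\<in>A2. KL q' (posterior S p \<sigma> L lam lams n D) \<le> ereal (R + ln (evidence L n lams D)))"
      unfolding R_def
      by (rule cand[rule_format, OF n_ge1 L N s13(4) s(3) \<theta>s(1) _ \<kappa>1(2) w(1) eq_refl[OF w_def]])
        (rule \<theta>s\<zeta>[rule_format])
    then obtain q' A2 where q': "q' \<in> var_family S p L" and A2[measurable]: "A2 \<in> sets (data0 n)"
      and A2p: "D.prob (space (data0 n) - A2) \<le> real n * \<sigma>\<^sup>2 * (2 * \<zeta>\<^sup>2 + C1 / (real n)\<^sup>2) / \<kappa>\<^sup>2"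
      and A2h: "\<forall>D\<in>A2. KL q' (posterior S p \<sigma> L lam lams n D) \<le> ereal (R + ln (evidence L n lams D))"
      by (elim bexE conjE) (rule that)
    have A2p': "D.prob (space (data0 n) - A2) \<le> K / ln (real n)"
    proof -
      have "real n * (2 * \<zeta>\<^sup>2 + C1 / (real n)\<^sup>2) = 2 * \<kappa> + C1 / real n"
        using nn unfolding \<zeta>2 \<kappa>_def by (simp add: field_simps power2_eq_square)
      also have "\<dots> \<le> 2 * \<kappa> + C1 * \<kappa>"
      proof -
        have "C1 / real n \<le> C1 * 1" using C1 nn by (simp add: divide_le_eq mult_le_cancel_left1)
        also have "\<dots> \<le> C1 * \<kappa>" using C1 \<kappa>1 by (intro mult_left_mono) auto
        finally show ?thesis by simp
      qed
      finally have "\<sigma>\<^sup>2 * (real n * (2 * \<zeta>\<^sup>2 + C1 / (real n)\<^sup>2)) \<le> \<sigma>\<^sup>2 * ((2 + C1) * \<kappa>)"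
        by (intro mult_left_mono) (auto simp: distrib_right)
      then have "real n * \<sigma>\<^sup>2 * (2 * \<zeta>\<^sup>2 + C1 / (real n)\<^sup>2) / \<kappa>\<^sup>2 \<le> \<sigma>\<^sup>2 * ((2 + C1) * \<kappa>) / \<kappa>\<^sup>2"
        by (intro divide_right_mono) (auto simp: mult_ac)
      also have "\<dots> = \<sigma>\<^sup>2 * (2 + C1) / \<kappa>" using \<kappa>1 by (simp add: power2_eq_square)
      also have "\<dots> \<le> \<sigma>\<^sup>2 * (2 + C1) / (c' * ln (real n))"
        using \<kappa> \<kappa>1 nr c' ln1 C1 by (intro divide_left_mono mult_pos_pos) auto
      also have "\<dots> = \<sigma>\<^sup>2 * (2 + C1) / c' / ln (real n)" by simp
      also have "\<dots> \<le> K / ln (real n)" using K ln1 by (intro divide_right_mono) auto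
      finally show ?thesis using A2p by linarith
    qed
    define A where "A = A1 \<inter> A2"
    have Am: "A \<in> sets (data0 n)" unfolding A_def by measurable
    have "D.prob (space (data0 n) - A) \<le> D.prob ((space (data0 n) - A1) \<union> (space (data0 n) - A2))"
      unfolding A_def by (intro D.finite_measure_mono) auto
    also have "\<dots> \<le> D.prob (space (data0 n) - A1) + D.prob (space (data0 n) - A2)" by (intro measure_Un_le) auto
    also have "\<dots> \<le> K / real n + K / ln (real n)"
      using A1p A2p' K divide_right_mono[OF K(2), of "real n"] by linarith
    finally have "1 - (K / real n + K / ln (real n)) \<le> D.prob A" using D.prob_compl[OF Am] by simp
    have "(\<integral>(\<theta>, N, s). hell (net_N p L N \<theta>) \<partial>q) \<le> C * (e + r + x)"
      if D: "D \<in> A" and q: "is_adaptive_vp S p \<sigma> L lam lams n D q" for D q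
    proof -
      have Ds: "D \<in> space (data0 n)" using D sets.sets_into_space[OF Am] by auto
      have "(\<integral>(\<theta>, N, s). hell (net_N p L N \<theta>) \<partial>q) \<le> (R + ln (real n ^ 5)) / (c * real n)"
        using D nn A1h A2h unfolding A_def by (intro adaptive_vp_hellinger_le[OF Ds q q' _ _ _ c]) auto
      also have "\<dots> \<le> (real n * (e + (K2 / c' + 3) * r + 2 / \<sigma>\<^sup>2 * (x + r))) / (c * real n)"
      proof (intro divide_right_mono)
        let ?u = "real s * ln (real n)"
        \<comment> \<open>Translates the amplification factor of a layer into the logarithm of the
          estimation error: the layer size is quadratic in \<open>12 * p * N\<close>, and a third
          power absorbs the constant 3.\<close>
        have layer: "ln (1 + layer_size p N * B) \<le> 3 * ln (12 * B * real p * real N)"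
        proof -
          define t where "t = 12 * real p * real N"
          have "1 \<le> real p * real N" using of_nat_mono[OF pN1, where 'a=real] by simp
          then have t: "t \<ge> 12" unfolding t_def by linarith
          have "layer_size p N = t * (t + 1)" by (simp add: layer_size_def t_def)
          moreover have "t * (t + 1) \<le> t * (2 * t)" using t by (intro mult_left_mono) auto
          moreover have "1 \<le> t * t" using t mult_mono[of 1 t 1 t] by simp
          ultimately have "1 + layer_size p N * B \<le> t * t * B + t * (2 * t) * B"
            using B1 mult_mono[of 1 "t * t" 1 B] by (intro add_mono mult_right_mono) auto
          also have "\<dots> = 3 * (t * t * B)" by simp
          also have "\<dots> \<le> t * (t * t * B)" using t B1 by (intro mult_right_mono) auto
          also have "\<dots> \<le> t * (t * t * B) * (B * B)"
            using t B1 mult_mono[of 1 B 1 B] mult_left_mono[of 1 "B * B" "t * (t * t * B)"] by simp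
          also have "\<dots> = (12 * B * real p * real N) ^ 3" by (simp add: t_def power3_eq_cube)
          finally have le: "1 + layer_size p N * B \<le> (12 * B * real p * real N) ^ 3" .
          have "0 < 1 + layer_size p N * B" using B1 layer_size_nonneg[of p N] by (simp add: add_pos_nonneg)
          then have "ln (1 + layer_size p N * B) \<le> ln ((12 * B * real p * real N) ^ 3)"
            using le by (subst ln_le_cancel_iff) linarith+
          then show ?thesis by (simp add: ln_realpow)
        qed
        have 1: "real s * (real L * ln (1 + layer_size p N * B)) \<le> 3 * (real n * r)"
        proof -
          have "real s * (real L * ln (1 + layer_size p N * B)) \<le> real s * (real L * (3 * ln (12 * B * real p * real N)))"
            using layer by (intro mult_left_mono) auto
          also have "\<dots> = 3 * (real L * real s * ln (12 * B * real p * real N))" by simp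
          also have "\<dots> \<le> 3 * (real n * r)" using r(2) by (intro mult_left_mono) auto
          finally show ?thesis .
        qed
        have 2: "real s * (2 * ln (real s) + ln (real n) + C1) \<le> (3 + C1) * ?u"
        proof -
          have "ln (real s) \<le> ln (real n)" using s13 s(2) by (subst ln_le_cancel_iff) auto
          moreover have "C1 * 1 \<le> C1 * ln (real n)" using C1 ln1 by (intro mult_left_mono) auto
          ultimately have "2 * ln (real s) + ln (real n) + C1 \<le> (3 + C1) * ln (real n)" by (simp add: distrib_right)
          then have "real s * (2 * ln (real s) + ln (real n) + C1) \<le> real s * ((3 + C1) * ln (real n))"
            by (intro mult_left_mono) auto
          then show ?thesis by (simp add: mult_ac)
        qed
        have 3: "real n * (2 * \<zeta>\<^sup>2 + C1 / (real n)\<^sup>2) / (2 * \<sigma>\<^sup>2) \<le> \<kappa> / \<sigma>\<^sup>2 + C1 / (2 * \<sigma>\<^sup>2) * ?u"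
        proof -
          have "real n * (2 * \<zeta>\<^sup>2 + C1 / (real n)\<^sup>2) = 2 * \<kappa> + C1 / real n"
            using nn unfolding \<zeta>2 \<kappa>_def by (simp add: field_simps power2_eq_square)
          also have "C1 / real n \<le> C1 * 1" using C1 nn by (simp add: divide_le_eq mult_le_cancel_left1)
          also have "C1 * 1 \<le> C1 * ?u" using C1 sl1 by (intro mult_left_mono) auto
          finally have "real n * (2 * \<zeta>\<^sup>2 + C1 / (real n)\<^sup>2) \<le> 2 * \<kappa> + C1 * ?u" by simp
          then have "real n * (2 * \<zeta>\<^sup>2 + C1 / (real n)\<^sup>2) / (2 * \<sigma>\<^sup>2) \<le> (2 * \<kappa> + C1 * ?u) / (2 * \<sigma>\<^sup>2)"
            by (intro divide_right_mono) auto
          then show ?thesis by (simp add: add_divide_distrib)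
        qed
        have 4: "ln (real n ^ 5) \<le> 5 * ?u" using sl1(2) by (simp add: ln_realpow)
        have 5: "K2 * ?u \<le> K2 / c' * (real n * r)"
        proof -
          have "K2 / c' * (c' * ?u) \<le> K2 / c' * (real n * r)" using r(1) K2 c' by (intro mult_left_mono) auto
          then show ?thesis using c' by simp
        qed
        have "R + ln (real n ^ 5) \<le> 3 * (real n * r) + (3 + C1) * ?u + (\<kappa> / \<sigma>\<^sup>2 + C1 / (2 * \<sigma>\<^sup>2) * ?u) + \<kappa> / \<sigma>\<^sup>2 +
            (lams * real s + (lam + \<bar>ln lam\<bar> + 11) * ?u) + 5 * ?u"
          using 1 2 3 4 w(2) unfolding R_def by (simp add: distrib_left)
        also have "\<dots> = 3 * (real n * r) + K2 * ?u + 2 / \<sigma>\<^sup>2 * \<kappa> + lams * real s"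
          by (simp add: K2_def distrib_right)
        also have "\<dots> \<le> 3 * (real n * r) + K2 / c' * (real n * r) + 2 / \<sigma>\<^sup>2 * \<kappa> + real n * e" using 5 lams(2) by linarith
        also have "\<dots> = real n * (e + (K2 / c' + 3) * r + 2 / \<sigma>\<^sup>2 * (x + r))"
          by (simp add: \<kappa>_def algebra_simps)
        finally show "R + ln (real n ^ 5) \<le> real n * (e + (K2 / c' + 3) * r + 2 / \<sigma>\<^sup>2 * (x + r))" .
      qed (use c in simp)
      also have "\<dots> = (e + (K2 / c' + 3) * r + 2 / \<sigma>\<^sup>2 * (x + r)) / c" using nn by simp
      \<comment> \<open>All three coefficients are at most \<open>C * c\<close>; nonnegativity of
        \<open>e\<close> is inherited from \<open>lams * s\<close>.\<close>
      also have "\<dots> \<le> C * (e + r + x)"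
      proof -
        have e0: "e \<ge> 0"
        proof -
          have "0 \<le> lams * real s" using lams0 by simp
          then have "0 \<le> real n * e" using lams(2) by linarith
          then show ?thesis using nn by (simp add: zero_le_mult_iff)
        qed
        define G where "G = 1 + K2 / c' + 3 + 2 / \<sigma>\<^sup>2"
        have "1 * e \<le> G * e" "(K2 / c' + 3 + 2 / \<sigma>\<^sup>2) * r \<le> G * r" "2 / \<sigma>\<^sup>2 * x \<le> G * x"
          using e0 r0 x0 K2 c' by (intro mult_right_mono; simp add: G_def)+
        then have "e + (K2 / c' + 3) * r + 2 / \<sigma>\<^sup>2 * (x + r) \<le> G * (e + r + x)"
          by (simp only: distrib_left distrib_right)
        then have "(e + (K2 / c' + 3) * r + 2 / \<sigma>\<^sup>2 * (x + r)) / c \<le> G * (e + r + x) / c" using c by (intro divide_right_mono) auto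
        then show ?thesis by (simp add: C_def G_def)
      qed
      finally show ?thesis .
    qed
    then show ?thesis using Am \<open>1 - (K / real n + K / ln (real n)) \<le> D.prob A\<close> by blast
  qed
  show ?thesis using C K(1) main by blast
qed

text \<open>The event \<open>A n\<close> is fixed before \<open>q\<close>, so one event serves every
  minimiser at once, and neither uniqueness nor a measurable choice of the minimiser enters.\<close>

theorem theorem5p1:
  fixes p :: nat and \<sigma> :: real and f0 :: "(nat \<Rightarrow> real) \<Rightarrow> real"
    and S :: slab and B lam a \<alpha> \<delta> M' :: real
    and L Nst sst :: "nat \<Rightarrow> nat" and lams :: "nat \<Rightarrow> real"
  defines "r \<equiv> \<lambda>n. r_err p B n (L n) (Nst n) (sst n)"
    and "\<xi> \<equiv> \<lambda>n. xi_err p B f0 (L n) (Nst n) (sst n)"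
    and "\<epsilon> \<equiv> \<lambda>n. eps_star M' \<delta> n (L n) (Nst n) (sst n)"
    and "m \<equiv> \<lambda>n. max (real (L n) * real (sst n) * ln (real p * real (Nst n)))
                     (real (sst n) * ln (real n * real (L n) / real (sst n)))"
  assumes p: "p \<ge> 1" and \<sigma>: "\<sigma> > 0"
    and f0: "f0 \<in> borel_measurable (\<Pi>\<^sub>M i\<in>{..<p}. borel)"
    and L: "\<And>n. L n \<ge> 1"
    and slab: "admissible_slab S B"
    and lam: "lam > 0" and a: "a > 0" and \<alpha>: "\<alpha> < 1" and \<delta>: "\<delta> \<ge> 1" and M': "M' > 0"
    and argmin: "eventually (\<lambda>n. is_arg_min
          (\<lambda>(N, s). ereal (r_err p B n (L n) N s) + xi_err p B f0 (L n) N s)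
          (\<lambda>(N, s). 1 \<le> N \<and> s \<le> card (coords_N p (L n) N))
          (Nst n, sst n)) sequentially"
    and lams_upper: "lams \<in> o(\<lambda>n. real n * (\<epsilon> n)\<^sup>2 / real (sst n))"
    and lams_lower: "eventually (\<lambda>n. lams n \<ge> a * real (L n) * ln (real n)) sequentially"
    and cond1: "(\<lambda>_. 1) \<in> o(m)" "m \<in> o(\<lambda>n. real n powr \<alpha>)"
    and cond2: "\<exists>c1>0. \<exists>c2>0. eventually
          (\<lambda>n. ereal (c1 * r n) \<le> \<xi> n \<and> \<xi> n \<le> ereal (c2 * r n)) sequentially"
    and cond3: "eventually (\<lambda>n. sst n \<ge> 12 * p * Nst n + L n) sequentially"
  shows "\<exists>C''>0. \<exists>A. (\<forall>n. A n \<in> sets (data_measure p \<sigma> f0 n)) \<and>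
      (\<lambda>n. measure (data_measure p \<sigma> f0 n) (A n)) \<longlonglongrightarrow> 1 \<and>
      (\<forall>n. \<forall>D\<in>A n. \<forall>q. is_adaptive_vp S p \<sigma> (L n) lam (lams n) n D q \<longrightarrow>
         ereal (\<integral>(\<theta>, N, s). hellinger_sq p \<sigma> (net_N p (L n) N \<theta>) f0 \<partial>q)
           \<le> ereal C'' * (ereal ((\<epsilon> n)\<^sup>2) + ereal (r n) + \<xi> n))"
proof -
  have bn: "bayes_net p \<sigma> f0 S B lam" by unfold_locales (use p \<sigma> f0 slab lam in auto)
  interpret bayes_net p \<sigma> f0 S B lam by (rule bn)
  have B1: "B \<ge> 1" by (rule admissible_slab_ge_1[OF slab])
  have am: "eventually (\<lambda>n. 1 \<le> Nst n \<and> sst n \<le> card (coords_N p (L n) (Nst n))) sequentially"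
    using argmin by eventually_elim (auto simp: is_arg_min_def)
  obtain c0 n1 where c0: "c0 > 0" and regime: "\<forall>n\<ge>n1. \<forall>L N s :: nat. 1 \<le> L \<longrightarrow> 1 \<le> N \<longrightarrow> 1 \<le> s \<longrightarrow>
    real s \<le> real L * layer_size p N \<longrightarrow>
    max (real L * real s * ln (real p * real N)) (real s * ln (real n * real L / real s)) \<le> real n powr \<alpha> \<longrightarrow>
    s \<le> n \<and> c0 * (real s * ln (real n)) \<le> real s * ln (real n * real L / real s)"
    using sparsity_regime[OF p \<alpha>] by (elim exE conjE) (rule that)
  have m_le: "eventually (\<lambda>n. m n \<le> real n powr \<alpha>) sequentially"
    using landau_o.smallD[OF cond1(2) zero_less_one] by eventually_elim auto
  \<comment> \<open>In the regime given by the growth condition both summands of the estimation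
    error are nonnegative, so \<open>n * r n\<close> dominates each of them, and through the second
    one also \<open>s * ln n\<close> up to the constant \<open>c0\<close>.\<close>
  have reg: "eventually (\<lambda>n. sst n \<le> n \<and> c0 * (real (sst n) * ln (real n)) \<le> real n * r n \<and>
      real (L n) * real (sst n) * ln (12 * B * real p * real (Nst n)) \<le> real n * r n \<and> 1 \<le> sst n) sequentially"
  proof -
    show ?thesis
      using am m_le cond3 eventually_ge_at_top[of "max n1 1"]
    proof eventually_elim
      case (elim n)
      then have n: "n \<ge> n1" "n \<ge> 1" and N: "1 \<le> Nst n" and sH: "sst n \<le> card (coords_N p (L n) (Nst n))" by auto
      have s1: "1 \<le> sst n" using elim(3) L[of n] by linarith
      have "real (sst n) \<le> real (card (coords_N p (L n) (Nst n)))" using sH by simp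
      also have "\<dots> \<le> real (L n) * layer_size p (Nst n)" by (rule card_coords_N[OF p N L])
      finally have sL: "real (sst n) \<le> real (L n) * layer_size p (Nst n)" .
      have key: "sst n \<le> n \<and> c0 * (real (sst n) * ln (real n)) \<le> real (sst n) * ln (real n * real (L n) / real (sst n))"
        by (rule regime[rule_format, OF n(1) L N s1 sL]) (use elim(2) in \<open>simp add: m_def\<close>)
      have nr: "real n * r n = real (L n) * real (sst n) * ln (12 * B * real p * real (Nst n)) +
          real (sst n) * ln (real n * real (L n) / real (sst n))"
        using n by (simp add: r_def r_err_def distrib_left)
      have "1 \<le> real p * real (Nst n)" using p N mult_mono[of 1 "real p" 1 "real (Nst n)"] by simp
      then have "1 \<le> 12 * B * real p * real (Nst n)"
        using B1 mult_mono[of 1 "12 * B" 1 "real p * real (Nst n)"] by (simp add: mult.assoc)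
      then have "0 \<le> real (L n) * real (sst n) * ln (12 * B * real p * real (Nst n))" by simp
      moreover have "0 \<le> real (sst n) * ln (real n * real (L n) / real (sst n))"
      proof -
        have "0 \<le> c0 * (real (sst n) * ln (real n))" using c0 n by simp
        with key show ?thesis by linarith
      qed
      ultimately show ?case using key nr s1 by linarith
    qed
  qed
  obtain c1 c2 where c12: "c1 > 0" "c2 > 0" and xi12: "eventually (\<lambda>n. ereal (c1 * r n) \<le> \<xi> n \<and> \<xi> n \<le> ereal (c2 * r n)) sequentially"
    using cond2 by (elim exE conjE) (rule that)
  have r_pos: "eventually (\<lambda>n. r n > 0) sequentially"
    using reg eventually_ge_at_top[of 2]
  proof eventually_elim
    case (elim n)
    have "0 < c0 * (real (sst n) * ln (real n))" using elim c0 by simp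
    then have "0 < real n * r n" using elim by linarith
    then show ?case by (simp add: zero_less_mult_iff)
  qed
  have "eventually (\<lambda>n. 1 \<le> Nst n \<and> r n > 0 \<and> ereal (c1 * r n) \<le> \<xi> n \<and> \<xi> n \<le> ereal (c2 * r n)) sequentially"
    using am r_pos xi12 by eventually_elim auto
  \<comment> \<open>One sample size at which the approximation error is finite suffices:
    \<open>f0\<close> is then within finite sup-distance of a network, which is bounded on the cube,
    and \<open>f0\<close> does not depend on \<open>n\<close>.\<close>
  then obtain k where k: "1 \<le> Nst k" "r k > 0" "ereal (c1 * r k) \<le> \<xi> k" "\<xi> k \<le> ereal (c2 * r k)"
    unfolding eventually_sequentially by blast
  obtain F0 where F0: "F0 \<ge> 0" "\<And>x. x \<in> cube p \<Longrightarrow> \<bar>f0 x\<bar> \<le> F0"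
  proof -
    obtain x where x: "\<xi> k = ereal x" using k(3,4) by (cases "\<xi> k") auto
    obtain \<theta> where \<theta>: "\<theta> \<in> Theta_B (L k) (widths p (L k) (Nst k)) (sst k) B"
      "\<And>y. y \<in> cube p \<Longrightarrow> \<bar>net_N p (L k) (Nst k) \<theta> y - f0 y\<bar> \<le> sqrt (x + r k)" and "x \<ge> 0"
      by (rule sup_dist_near_minimizer[OF x[unfolded \<xi>_def] k(2)]) (rule that)
    define F where "F = (1 + layer_size p (Nst k) * B) ^ L k + sqrt (x + r k)"
    have "\<bar>f0 y\<bar> \<le> F" if y: "y \<in> cube p" for y
    proof -
      have "\<bar>net_N p (L k) (Nst k) \<theta> y\<bar> \<le> (1 + layer_size p (Nst k) * B) ^ L k"
        using \<theta>(1) B1 by (intro net_abs_le[OF p k(1) L _ _ y]) (auto simp: Theta_B_def)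
      then show ?thesis using \<theta>(2)[OF y] unfolding F_def by linarith
    qed
    moreover have "F \<ge> 0" using B1 layer_size_nonneg[of p "Nst k"] \<open>x \<ge> 0\<close> k(2) by (simp add: F_def)
    ultimately show ?thesis using that by blast
  qed
  have "\<exists>C>0. \<exists>K\<ge>0. \<exists>n0. \<forall>n\<ge>n0. \<forall>L N s lams x r e. 1 \<le> L \<longrightarrow> 1 \<le> N \<longrightarrow> 12 * p * N + L \<le> s \<longrightarrow> s \<le> n \<longrightarrow>
    s \<le> card (coords_N p L N) \<longrightarrow> a * real L * ln (real n) \<le> lams \<longrightarrow> lams * real s \<le> real n * e \<longrightarrow>
    c0 * (real s * ln (real n)) \<le> real n * r \<longrightarrow>
    real L * real s * ln (12 * B * real p * real N) \<le> real n * r \<longrightarrow> xi_err p B f0 L N s = ereal x \<longrightarrow>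
    (\<exists>A\<in>sets (data0 n). measure (data0 n) A \<ge> 1 - (K / real n + K / ln (real n)) \<and>
      (\<forall>D\<in>A. \<forall>q. is_adaptive_vp S p \<sigma> L lam lams n D q \<longrightarrow>
        (\<integral>(\<theta>, N, s). hell (net_N p L N \<theta>) \<partial>q) \<le> C * (e + r + x)))"
    (is "\<exists>C>0. \<exists>K\<ge>0. \<exists>n0. ?contr C K n0")
    by (rule contraction_event[OF F0(1) _ a c0]) (rule F0(2))
  then obtain C K n0 where C: "C > 0" and K: "K \<ge> 0" and contr: "?contr C K n0" by (elim exE conjE) (rule that)
  define good where "good n A \<longleftrightarrow> A \<in> sets (data0 n) \<and> measure (data0 n) A \<ge> 1 - (K / real n + K / ln (real n)) \<and>
    (\<forall>D\<in>A. \<forall>q. is_adaptive_vp S p \<sigma> (L n) lam (lams n) n D q \<longrightarrow>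
         ereal (\<integral>(\<theta>, N, s). hell (net_N p (L n) N \<theta>) \<partial>q) \<le> ereal C * (ereal ((\<epsilon> n)\<^sup>2) + ereal (r n) + \<xi> n))" for n A
  \<comment> \<open>From the little-o condition only the eventual bound with constant 1 is taken,
    which reads \<open>lams * s \<le> n * \<epsilon>\<^sup>2\<close>.\<close>
  have lams_le: "eventually (\<lambda>n. \<bar>lams n\<bar> \<le> \<bar>real n * (\<epsilon> n)\<^sup>2 / real (sst n)\<bar>) sequentially"
    using landau_o.smallD[OF lams_upper zero_less_one] by eventually_elim simp
  have ev_good: "eventually (\<lambda>n. \<exists>A. good n A) sequentially"
    using am reg xi12 cond3 lams_lower lams_le eventually_ge_at_top[of n0]
  proof eventually_elim
    case (elim n)
    obtain x where x: "\<xi> n = ereal x" using elim(3) by (cases "\<xi> n") auto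
    have "lams n \<le> real n * (\<epsilon> n)\<^sup>2 / real (sst n)" using elim(6) by simp
    then have lams: "lams n * real (sst n) \<le> real n * (\<epsilon> n)\<^sup>2" using elim(2) by (simp add: le_divide_eq)
    have "\<exists>A\<in>sets (data0 n). measure (data0 n) A \<ge> 1 - (K / real n + K / ln (real n)) \<and>
      (\<forall>D\<in>A. \<forall>q. is_adaptive_vp S p \<sigma> (L n) lam (lams n) n D q \<longrightarrow>
        (\<integral>(\<theta>, N, s). hell (net_N p (L n) N \<theta>) \<partial>q) \<le> C * ((\<epsilon> n)\<^sup>2 + r n + x))"
    proof (rule contr[rule_format, OF elim(7)])
      show "1 \<le> L n" by (rule L)
      show "1 \<le> Nst n" "sst n \<le> card (coords_N p (L n) (Nst n))" using elim(1) by auto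
      show "12 * p * Nst n + L n \<le> sst n" by (rule elim(4))
      show "sst n \<le> n" "c0 * (real (sst n) * ln (real n)) \<le> real n * r n"
        "real (L n) * real (sst n) * ln (12 * B * real p * real (Nst n)) \<le> real n * r n" using elim(2) by auto
      show "a * real (L n) * ln (real n) \<le> lams n" by (rule elim(5))
      show "lams n * real (sst n) \<le> real n * (\<epsilon> n)\<^sup>2" by (rule lams)
      show "xi_err p B f0 (L n) (Nst n) (sst n) = ereal x" using x by (simp add: \<xi>_def)
    qed
    then obtain A where A: "A \<in> sets (data0 n)" "measure (data0 n) A \<ge> 1 - (K / real n + K / ln (real n))"
      "\<forall>D\<in>A. \<forall>q. is_adaptive_vp S p \<sigma> (L n) lam (lams n) n D q \<longrightarrow>
        (\<integral>(\<theta>, N, s). hell (net_N p (L n) N \<theta>) \<partial>q) \<le> C * ((\<epsilon> n)\<^sup>2 + r n + x)"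
      by (elim bexE conjE) (rule that)
    have "good n A" using A unfolding good_def x by simp
    then show ?case ..
  qed
  \<comment> \<open>At the finitely many sample sizes without a good event the empty set is used: it
    makes the bound vacuous there, so the bound can be claimed for all \<open>n\<close>, and leaves
    the limit of the probabilities unchanged.\<close>
  define A where "A n = (if \<exists>A. good n A then SOME A. good n A else {})" for n
  have goodA: "good n (A n)" if "\<exists>A. good n A" for n
    using someI_ex[OF that] that by (simp add: A_def)
  have Asets: "A n \<in> sets (data0 n)" for n
    using goodA[of n] by (cases "\<exists>A. good n A") (auto simp: good_def A_def)
  have Abound: "ereal (\<integral>(\<theta>, N, s). hell (net_N p (L n) N \<theta>) \<partial>q) \<le> ereal C * (ereal ((\<epsilon> n)\<^sup>2) + ereal (r n) + \<xi> n)"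
    if "D \<in> A n" "is_adaptive_vp S p \<sigma> (L n) lam (lams n) n D q" for n D q
  proof -
    have "\<exists>A. good n A" using that(1) by (auto simp: A_def split: if_splits)
    from goodA[OF this] show ?thesis using that unfolding good_def by blast
  qed
  have "(\<lambda>n. measure (data0 n) (A n)) \<longlonglongrightarrow> 1"
  proof (rule tendsto_sandwich)
    show "eventually (\<lambda>n. 1 - (K / real n + K / ln (real n)) \<le> measure (data0 n) (A n)) sequentially"
      using ev_good by eventually_elim (use goodA in \<open>auto simp: good_def\<close>)
    show "eventually (\<lambda>n. measure (data0 n) (A n) \<le> 1) sequentially"
      using prob_space.prob_le_1[OF prob_space_data] by simp
    have "(\<lambda>n. K / real n) \<longlonglongrightarrow> 0" by (rule lim_const_over_n)
    moreover have "(\<lambda>n. K / ln (real n)) \<longlonglongrightarrow> 0"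
      by (rule tendsto_divide_0[OF tendsto_const])
        (intro filterlim_at_top_imp_at_infinity filterlim_compose[OF ln_at_top filterlim_real_sequentially])
    ultimately have "(\<lambda>n. 1 - (K / real n + K / ln (real n))) \<longlonglongrightarrow> 1 - (0 + 0)" by (intro tendsto_intros)
    then show "(\<lambda>n. 1 - (K / real n + K / ln (real n))) \<longlonglongrightarrow> 1" by simp
  qed simp
  then show ?thesis using C Asets Abound by blast
qed

end
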